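(* Let $X_1=(X_1(t))_{t\ge 0}$ be a Pearson diffusion in steady state (of Hermite, Laguerre or Jacobi type, as described in the context), so that its correlation function is $\mathrm{corr}[X_1(t),X_1(s)]=\exp(-\theta|t-s|)$ for all $t,s\ge 0$, where $\theta=\lambda_1>0$ is the smallest positive eigenvalue of $-\mathcal{G}$. Let $0<\beta_1<\beta_2<\cdots<\beta_n<1$, $c_1>0$, $c_2,\dots,c_n\ge0$, and let $D=(D(t))_{t\ge0}$ be a subordinator with $\mathbb{E}[e^{-sD(t)}]=e^{-t\psi(s)}$, where $\psi(s)=c_1s^{\beta_1}+c_2s^{\beta_2}+\cdots+c_ns^{\beta_n}$. Let $E(t)=\inf\{\tau\ge 0: D(\tau)>t\}$ be its inverse, assumed independent of $X_1$, let $X(t)=X_1(E(t))$ and $\Phi_{\theta,n}(t)=\mathbb{E}(e^{-\theta E(t)})$, and let $h_n$ be the function on $(0,\infty)$ with Laplace transform $\int_0^\infty e^{-sy}h_n(y)\,dy=1/\psi(s)$ for $s>0$. Then $$\Phi_{\theta,n}(t)\sim\frac{c_1}{\theta\,\Gamma(1-\beta_1)\,t^{\beta_1}}\qquad\text{as }t\to\infty,$$ and for every fixed $s>0$, $$\mathrm{corr}[X(t),X(s)]\sim\frac{1}{t^{\beta_1}\Gamma(1-\beta_1)}\left(\frac{c_1}{\theta}+c_1\int_0^s h_n(y)\,dy\right)\qquad\text{as }t\to\infty.$$ Therefore the time-changed Pearson diffusion $X(t)$ exhibits long-range dependence.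
   Context: Pearson diffusion: the solution $X_1(t)$ of the stochastic differential equation $dX_1(t)=\mu(X_1(t))\,dt+\sigma(X_1(t))\,dW(t)$, with $W$ a standard Brownian motion, $\mu(x)=a_0+a_1x$ and $D(x)=\sigma^2(x)/2=d_0+d_1x+d_2x^2$ (this polynomial $D(x)$ is not to be confused with the subordinator $D(t)$). Its generator is $\mathcal{G}=\mu(y)\frac{\partial}{\partial y}+\frac{\sigma^2(y)}{2}\frac{\partial^2}{\partial y^2}$, and $m$ denotes the density of its steady-state (stationary) distribution. It is assumed throughout that one of three cases holds: (1) Hermite: $d_1=d_2=0$, $d_0>0$, and $m$ is a normal density; (2) Laguerre: $d_2=0$, $d_1\neq0$, and $m$ is (up to an affine change of variable) a gamma density; (3) Jacobi: $D''<0$, $D(x)$ has two distinct real roots, and $m$ is (up to an affine change of variable) a beta density. In these cases $\mathcal{G}$ has eigenfunctions $Q_n$, $\mathcal{G}Q_n=-\lambda_nQ_n$, with $0=\lambda_0<\lambda_1<\lambda_2<\cdots$, which are orthogonal polynomials forming an orthonormal basis of $L^2(m(y)\,dy)$, and all moments exist. "In steady state" means that $X_1(0)$ has density $m$; then $X(t)=X_1(E(t))$ also has density $m$ for every $t$, with finite constant mean and variance. $\mathrm{corr}$ denotes the correlation coefficient of two random variables. $f(t)\sim g(t)$ as $t\to\infty$ means $f(t)/g(t)\to1$. Long-range dependence: a mean-zero, finite-variance process $Y(t)$ is short-range dependent if for fixed $t>0$, $\sum_{h=1}^\infty\mathbb{E}(Y(t)Y(t+h))<\infty$, and long-range dependent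 otherwise. For $X$ this is applied to the centered process $Y(t)=X(t)-\mathbb{E}[X(t)]$; here it means $\sum_{h=1}^\infty\mathrm{corr}[X(t),X(t+h)]=\infty$ for each fixed $t>0$. *)

theory Defs
  imports
    "HOL-Probability.Probability"
    "HOL-Computational_Algebra.Polynomial"
    "HOL-Library.Landau_Symbols"
begin

text \<open>Stochastic processes are functions \<open>real \<Rightarrow> 'a \<Rightarrow> real\<close> on a probability space \<open>M\<close>; only
  times \<open>t \<ge> 0\<close> are ever constrained.\<close>

section \<open>Brownian motion, Ito integral and stochastic differential equations\<close>

definition brownian_motion ::
    "'a measure \<Rightarrow> (real \<Rightarrow> 'a measure) \<Rightarrow> (real \<Rightarrow> 'a \<Rightarrow> real) \<Rightarrow> bool" where
  "brownian_motion M F W \<longleftrightarrow>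
     filtration (space M) F \<and> (\<forall>t. sets (F t) \<subseteq> sets M) \<and>
     (\<forall>t\<ge>0. W t \<in> borel_measurable (F t)) \<and>
     (AE \<omega> in M. W 0 \<omega> = 0) \<and>
     (\<forall>\<omega>\<in>space M. continuous_on {0..} (\<lambda>t. W t \<omega>)) \<and>
     (\<forall>s t. 0 \<le> s \<and> s < t \<longrightarrow>
        distributed M lborel (\<lambda>\<omega>. W t \<omega> - W s \<omega>) (\<lambda>x. ennreal (normal_density 0 (sqrt (t - s)) x)) \<and>
        prob_space.indep_set M (sets (F s))
          (sets (vimage_algebra (space M) (\<lambda>\<omega>. W t \<omega> - W s \<omega>) borel)))"

text \<open>An elementary process is given by a number \<open>k\<close> of steps, grid points \<open>\<tau> 0 \<le> \<dots> \<le> \<tau> k\<close> and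
  bounded heights \<open>e i\<close> that are known at time \<open>\<tau> i\<close>.\<close>

definition elementary_process ::
    "(real \<Rightarrow> 'a measure) \<Rightarrow> nat \<Rightarrow> (nat \<Rightarrow> real) \<Rightarrow> (nat \<Rightarrow> 'a \<Rightarrow> real) \<Rightarrow> bool" where
  "elementary_process F k \<tau> e \<longleftrightarrow>
     0 \<le> \<tau> 0 \<and> (\<forall>i<k. \<tau> i \<le> \<tau> (Suc i)) \<and>
     (\<forall>i<k. e i \<in> borel_measurable (F (\<tau> i)) \<and> (\<exists>C. \<forall>\<omega>\<in>space (F (\<tau> i)). \<bar>e i \<omega>\<bar> \<le> C))"

definition elementary_value ::
    "nat \<Rightarrow> (nat \<Rightarrow> real) \<Rightarrow> (nat \<Rightarrow> 'a \<Rightarrow> real) \<Rightarrow> real \<Rightarrow> 'a \<Rightarrow> real" where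
  "elementary_value k \<tau> e s \<omega> = (\<Sum>i<k. indicator {\<tau> i..<\<tau> (Suc i)} s * e i \<omega>)"

definition elementary_integral ::
    "(real \<Rightarrow> 'a \<Rightarrow> real) \<Rightarrow> nat \<Rightarrow> (nat \<Rightarrow> real) \<Rightarrow> (nat \<Rightarrow> 'a \<Rightarrow> real) \<Rightarrow> real \<Rightarrow> 'a \<Rightarrow> real" where
  "elementary_integral W k \<tau> e t \<omega> =
     (\<Sum>i<k. e i \<omega> * (W (min t (\<tau> (Suc i))) \<omega> - W (min t (\<tau> i)) \<omega>))"

text \<open>\<open>I\<close> is a version of the Ito integral of \<open>H\<close> over \<open>[0, t]\<close>: the \<open>L\<^sup>2\<close> limit of the integrals of
  elementary processes converging to \<open>H\<close> in \<open>L\<^sup>2\<close>. Nonnegative integrals are used so that no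
  integrability has to be presupposed.\<close>

definition has_ito_integral ::
    "'a measure \<Rightarrow> (real \<Rightarrow> 'a measure) \<Rightarrow> (real \<Rightarrow> 'a \<Rightarrow> real) \<Rightarrow> (real \<Rightarrow> 'a \<Rightarrow> real) \<Rightarrow> real \<Rightarrow>
      ('a \<Rightarrow> real) \<Rightarrow> bool" where
  "has_ito_integral M F W H t I \<longleftrightarrow>
     (\<lambda>(s, \<omega>). indicator {0..t} s * H s \<omega>) \<in> borel_measurable (lborel \<Otimes>\<^sub>M M) \<and>
     I \<in> borel_measurable M \<and>
     (\<exists>k \<tau> e. (\<forall>j. elementary_process F (k j) (\<tau> j) (e j)) \<and>
        (\<lambda>j. \<integral>\<^sup>+\<omega>. (\<integral>\<^sup>+s\<in>{0..t}. ennreal ((H s \<omega> - elementary_value (k j) (\<tau> j) (e j) s \<omega>)\<^sup>2) \<partial>lborel) \<partial>M)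
          \<longlonglongrightarrow> 0 \<and>
        (\<lambda>j. \<integral>\<^sup>+\<omega>. ennreal ((I \<omega> - elementary_integral W (k j) (\<tau> j) (e j) t \<omega>)\<^sup>2) \<partial>M) \<longlonglongrightarrow> 0)"

text \<open>\<open>X\<close> solves \<open>dX = \<mu>(X) dt + \<sigma>(X) dW\<close>.\<close>

definition sde_solution ::
    "'a measure \<Rightarrow> (real \<Rightarrow> 'a measure) \<Rightarrow> (real \<Rightarrow> 'a \<Rightarrow> real) \<Rightarrow> (real \<Rightarrow> real) \<Rightarrow> (real \<Rightarrow> real) \<Rightarrow>
      (real \<Rightarrow> 'a \<Rightarrow> real) \<Rightarrow> bool" where
  "sde_solution M F W \<mu> \<sigma> X \<longleftrightarrow>
     brownian_motion M F W \<and>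
     (\<forall>t\<ge>0. X t \<in> borel_measurable (F t)) \<and>
     (\<forall>\<omega>\<in>space M. continuous_on {0..} (\<lambda>t. X t \<omega>)) \<and>
     (\<forall>t\<ge>0. \<exists>I. has_ito_integral M F W (\<lambda>s \<omega>. \<sigma> (X s \<omega>)) t I \<and>
        (AE \<omega> in M. X t \<omega> = X 0 \<omega> + (LINT s:{0..t}|lborel. \<mu> (X s \<omega>)) + I \<omega>))"

section \<open>Pearson diffusions\<close>

definition gamma_density :: "real \<Rightarrow> real \<Rightarrow> real" where
  "gamma_density a x = (if 0 < x then x powr (a - 1) * exp (- x) / Gamma a else 0)"

definition beta_density :: "real \<Rightarrow> real \<Rightarrow> real \<Rightarrow> real" where
  "beta_density a b x =
     (if 0 < x \<and> x < 1 then x powr (a - 1) * (1 - x) powr (b - 1) / Beta a b else 0)"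

definition pearson_drift :: "real \<Rightarrow> real \<Rightarrow> real \<Rightarrow> real" where
  "pearson_drift a0 a1 x = a0 + a1 * x"

definition pearson_diffusivity :: "real \<Rightarrow> real \<Rightarrow> real \<Rightarrow> real \<Rightarrow> real" where
  "pearson_diffusivity d0 d1 d2 x = d0 + d1 * x + d2 * x\<^sup>2"

definition hermite_type :: "real \<Rightarrow> real \<Rightarrow> real \<Rightarrow> (real \<Rightarrow> real) \<Rightarrow> bool" where
  "hermite_type d0 d1 d2 m \<longleftrightarrow>
     d1 = 0 \<and> d2 = 0 \<and> 0 < d0 \<and> (\<exists>\<nu> r. 0 < r \<and> m = normal_density \<nu> r)"

definition laguerre_type :: "real \<Rightarrow> real \<Rightarrow> real \<Rightarrow> (real \<Rightarrow> real) \<Rightarrow> bool" where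
  "laguerre_type d0 d1 d2 m \<longleftrightarrow>
     d2 = 0 \<and> d1 \<noteq> 0 \<and>
     (\<exists>a p q. 0 < a \<and> q \<noteq> 0 \<and> m = (\<lambda>x. \<bar>q\<bar> * gamma_density a (p + q * x)))"

definition jacobi_type :: "real \<Rightarrow> real \<Rightarrow> real \<Rightarrow> (real \<Rightarrow> real) \<Rightarrow> bool" where
  "jacobi_type d0 d1 d2 m \<longleftrightarrow>
     d2 < 0 \<and>
     (\<exists>x y. x \<noteq> y \<and> pearson_diffusivity d0 d1 d2 x = 0 \<and> pearson_diffusivity d0 d1 d2 y = 0) \<and>
     (\<exists>a b p q. 0 < a \<and> 0 < b \<and> q \<noteq> 0 \<and> m = (\<lambda>x. \<bar>q\<bar> * beta_density a b (p + q * x)))"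

text \<open>Steady state: \<open>X 0\<close> has density \<open>m\<close>, and \<open>m\<close> is stationary, that is, it is preserved by the
  evolution.\<close>

definition in_steady_state :: "'a measure \<Rightarrow> (real \<Rightarrow> 'a \<Rightarrow> real) \<Rightarrow> (real \<Rightarrow> real) \<Rightarrow> bool" where
  "in_steady_state M X m \<longleftrightarrow> (\<forall>t\<ge>0. distributed M lborel (X t) (\<lambda>x. ennreal (m x)))"

text \<open>The relation \<open>\<sigma>\<^sup>2 / 2 = D\<close> is required on the state space only, because \<open>D\<close> is negative outside
  its closure in the Laguerre and Jacobi cases.\<close>

definition steady_state_pearson_diffusion ::
    "'a measure \<Rightarrow> (real \<Rightarrow> 'a measure) \<Rightarrow> (real \<Rightarrow> 'a \<Rightarrow> real) \<Rightarrow>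
      real \<Rightarrow> real \<Rightarrow> real \<Rightarrow> real \<Rightarrow> real \<Rightarrow> (real \<Rightarrow> real) \<Rightarrow> (real \<Rightarrow> real) \<Rightarrow>
      (real \<Rightarrow> 'a \<Rightarrow> real) \<Rightarrow> bool" where
  "steady_state_pearson_diffusion M F W a0 a1 d0 d1 d2 \<sigma> m X \<longleftrightarrow>
     (hermite_type d0 d1 d2 m \<or> laguerre_type d0 d1 d2 m \<or> jacobi_type d0 d1 d2 m) \<and>
     \<sigma> \<in> borel_measurable borel \<and>
     (\<forall>x. 0 < m x \<longrightarrow> (\<sigma> x)\<^sup>2 / 2 = pearson_diffusivity d0 d1 d2 x) \<and>
     sde_solution M F W (pearson_drift a0 a1) \<sigma> X \<and>
     in_steady_state M X m"

definition pearson_generator ::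
    "real \<Rightarrow> real \<Rightarrow> real \<Rightarrow> real \<Rightarrow> real \<Rightarrow> (real \<Rightarrow> real) \<Rightarrow> real \<Rightarrow> real" where
  "pearson_generator a0 a1 d0 d1 d2 f y =
     pearson_drift a0 a1 y * deriv f y + pearson_diffusivity d0 d1 d2 y * deriv (deriv f) y"

text \<open>The polynomial eigenfunctions of the generator form an orthonormal basis of \<open>L\<^sup>2(m)\<close>, so they
  give all eigenvalues. Further solutions of the differential equation \<open>\<G> f = - \<kappa> f\<close>, which violate
  the boundary conditions of the generator, must not be counted.\<close>

definition neg_generator_eigenvalue ::
    "real \<Rightarrow> real \<Rightarrow> real \<Rightarrow> real \<Rightarrow> real \<Rightarrow> real \<Rightarrow> bool" where
  "neg_generator_eigenvalue a0 a1 d0 d1 d2 \<kappa> \<longleftrightarrow>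
     (\<exists>Q :: real poly. Q \<noteq> 0 \<and>
        (\<forall>y. pearson_generator a0 a1 d0 d1 d2 (poly Q) y = - \<kappa> * poly Q y))"

definition smallest_positive_eigenvalue ::
    "real \<Rightarrow> real \<Rightarrow> real \<Rightarrow> real \<Rightarrow> real \<Rightarrow> real \<Rightarrow> bool" where
  "smallest_positive_eigenvalue a0 a1 d0 d1 d2 \<theta> \<longleftrightarrow>
     0 < \<theta> \<and> neg_generator_eigenvalue a0 a1 d0 d1 d2 \<theta> \<and>
     (\<forall>\<kappa>>0. neg_generator_eigenvalue a0 a1 d0 d1 d2 \<kappa> \<longrightarrow> \<theta> \<le> \<kappa>)"

section \<open>Subordinators, inverse subordinators and independence\<close>

definition subordinator :: "'a measure \<Rightarrow> (real \<Rightarrow> 'a \<Rightarrow> real) \<Rightarrow> bool" where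
  "subordinator M D \<longleftrightarrow>
     (\<forall>t\<ge>0. D t \<in> borel_measurable M) \<and>
     (AE \<omega> in M. D 0 \<omega> = 0) \<and>
     (\<forall>\<omega>\<in>space M. mono_on {0..} (\<lambda>t. D t \<omega>) \<and> (\<forall>t\<ge>0. continuous (at_right t) (\<lambda>t. D t \<omega>))) \<and>
     (\<forall>s\<ge>0. \<forall>t\<ge>0. distr M borel (\<lambda>\<omega>. D (s + t) \<omega> - D s \<omega>) = distr M borel (\<lambda>\<omega>. D t \<omega> - D 0 \<omega>)) \<and>
     (\<forall>(k::nat) \<tau>. 0 \<le> \<tau> 0 \<and> (\<forall>i<k. \<tau> i \<le> \<tau> (Suc i)) \<longrightarrow>
        prob_space.indep_vars M (\<lambda>_. borel) (\<lambda>i \<omega>. D (\<tau> (Suc i)) \<omega> - D (\<tau> i) \<omega>) {..<k})"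

text \<open>The set of passage times is empty only for bounded paths of \<open>D\<close>, which form a null set for the
  subordinators considered here; the default value \<open>0\<close> is immaterial.\<close>

definition inverse_subordinator :: "(real \<Rightarrow> 'a \<Rightarrow> real) \<Rightarrow> real \<Rightarrow> 'a \<Rightarrow> real" where
  "inverse_subordinator D t \<omega> =
     (if \<exists>\<tau>\<ge>0. D \<tau> \<omega> > t then Inf {\<tau>. 0 \<le> \<tau> \<and> D \<tau> \<omega> > t} else 0)"

definition indep_processes ::
    "'a measure \<Rightarrow> (real \<Rightarrow> 'a \<Rightarrow> real) \<Rightarrow> (real \<Rightarrow> 'a \<Rightarrow> real) \<Rightarrow> bool" where
  "indep_processes M Y Z \<longleftrightarrow>
     prob_space.indep_var M
       (\<Pi>\<^sub>M t\<in>{0..}. borel) (\<lambda>\<omega>. \<lambda>t\<in>{0..}. Y t \<omega>)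
       (\<Pi>\<^sub>M t\<in>{0..}. borel) (\<lambda>\<omega>. \<lambda>t\<in>{0..}. Z t \<omega>)"

section \<open>Correlation and long-range dependence\<close>

definition correlation :: "'a measure \<Rightarrow> ('a \<Rightarrow> real) \<Rightarrow> ('a \<Rightarrow> real) \<Rightarrow> real" where
  "correlation M X Y =
     prob_space.expectation M
       (\<lambda>\<omega>. (X \<omega> - prob_space.expectation M X) * (Y \<omega> - prob_space.expectation M Y)) /
     (sqrt (prob_space.variance M X) * sqrt (prob_space.variance M Y))"

definition long_range_dependent :: "'a measure \<Rightarrow> (real \<Rightarrow> 'a \<Rightarrow> real) \<Rightarrow> bool" where
  "long_range_dependent M X \<longleftrightarrow>
     (\<forall>t>0. filterlim (\<lambda>N. \<Sum>h=1..N. correlation M (X t) (X (t + real h))) at_top sequentially)"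

end

theory Submission
  imports Defs "HOL-Real_Asymp.Real_Asymp"
begin

text \<open>For the diffusion, Ito integrals are martingales, so the covariance \<open>C(t)\<close> of \<open>X\<^sub>1(t)\<close> and
  \<open>X\<^sub>1(s)\<close> solves \<open>C' = a\<^sub>1 C\<close>; stationarity forces \<open>a\<^sub>1 < 0\<close>, and comparing leading coefficients of
  polynomial eigenfunctions gives \<open>\<theta> = - a\<^sub>1\<close>. Conditioning on the independent \<open>E\<close>, the correlation
  of \<open>X(t)\<close> and \<open>X(s)\<close> is the expectation of \<open>exp (- \<theta> (E(t) - E(s)))\<close>.

  The Laplace transform of \<open>\<Phi>\<close> is \<open>\<psi>(q) / (q (\<theta> + \<psi>(q)))\<close>, and Karamata's Tauberian theorem for
  monotone functions turns its behaviour at \<open>0\<close> into the asymptotics of \<open>\<Phi>\<close>. Writing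
  \<open>exp (- \<theta> (E(t) - E(s))) = exp (- \<theta> E(t)) + \<theta> \<integral> exp (- \<theta> (E(t) - u)) du\<close> over \<open>0 < u < E(s)\<close> and
  using independence of \<open>D(u)\<close> and \<open>D(u + w) - D(u)\<close>, the correlation lies between
  \<open>(1 + \<theta> U(s)) \<Phi>(t)\<close> and \<open>\<Phi>(t) + \<theta> U(s) \<Phi>(t - s)\<close>, where \<open>U\<close> is the potential of \<open>D\<close>. Since \<open>U\<close> and
  the measure with density \<open>h\<close> have the same Laplace transform \<open>1/\<psi>\<close>, \<open>U(s)\<close> is the integral of \<open>h\<close>.\<close>

section \<open>Laplace transforms: uniqueness and a Tauberian theorem\<close>

text \<open>The joint law of \<open>E(s)\<close> and \<open>E(t)\<close> is never computed.
  Integrating over deterministic times \<open>u\<close> and \<open>w\<close> turns both passage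
  times into the events \<open>D(u) \<le> s\<close> and \<open>D(u + w) > t\<close>. On the first
  event \<open>D(u)\<close> lies between \<open>0\<close> and \<open>s\<close>, so replacing
  \<open>D(u + w)\<close> by the independent increment moves the level \<open>t\<close> by at most
  \<open>s\<close>. A function decaying like a power of \<open>t\<close> does not feel this shift,
  hence both bounds share one leading term and the constant is exact:
  \<open>(1 + \<theta> U(s)) * c 1 / (\<theta> Gamma (1 - \<beta> 1))\<close> is the claimed one.
  Only the smallest exponent survives, because it dominates \<open>\<psi>\<close> near
  \<open>0\<close>, and near \<open>0\<close> is where the Tauberian theorem looks. Monotonicity of
  \<open>\<Phi>\<close> is what turns averaged asymptotics into pointwise ones. Long-range
  dependence follows as \<open>\<beta> 1 < 1\<close> makes the decay slower than
  \<open>1 / t\<close>. On the diffusion side the obstacle is that Ito integrals are only given as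
  \<open>L2\<close> limits, one version for each time; the whole theory is therefore reduced to
  testing increments against square-integrable variables known at the earlier time.\<close>

definition exp_integral :: "real measure \<Rightarrow> (real \<Rightarrow> real) \<Rightarrow> (real \<Rightarrow> real) \<Rightarrow> real" where
  "exp_integral N f g = (\<integral>y. g (exp (- y)) * (exp (- y) * f y) \<partial>N)"

text \<open>\<open>g\<close> is only controlled on the unit interval, which \<open>exp (- y)\<close>
  leaves for negative \<open>y\<close>; the indicator removes those points.\<close>

lemma continuous_on_unit_interval_exp_measurable:
  fixes g :: "real \<Rightarrow> real"
  assumes "continuous_on {0..1} g"
  shows "(\<lambda>y. indicator {0..} y * g (exp (- y))) \<in> borel_measurable borel"
proof -
  have "continuous_on {0..} (\<lambda>y::real. g (exp (- y)))"
    by (rule continuous_on_compose2[OF assms]) (auto intro!: continuous_intros)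
  then have "set_borel_measurable borel {0..} (\<lambda>y. g (exp (- y)))"
    by (intro borel_measurable_continuous_on_indicator[unfolded set_borel_measurable_def[symmetric]]) auto
  then show ?thesis by (simp add: set_borel_measurable_def)
qed

text \<open>The substitution \<open>x = exp (- y)\<close> maps the half line into the unit interval,
  where a continuous \<open>g\<close> is bounded. Since \<open>f\<close> vanishes on the negatives,
  no other values of \<open>g\<close> matter.\<close>

lemma integrable_exp_integral:
  fixes g :: "real \<Rightarrow> real"
  assumes N: "sets N = sets borel" and f: "integrable N (\<lambda>y. exp (- y) * f y)"
    and f0: "\<And>y. y < 0 \<Longrightarrow> f y = 0" and g: "continuous_on {0..1} g"
  shows "integrable N (\<lambda>y. g (exp (- y)) * (exp (- y) * f y))"
proof -
  have "bounded (g ` {0..1})"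
    by (rule compact_imp_bounded) (rule compact_continuous_image[OF g], simp)
  then obtain B where "\<forall>z\<in>g ` {0..1}. norm z \<le> B"
    unfolding bounded_iff by blast
  then have B: "\<bar>g x\<bar> \<le> B" if "x \<in> {0..1}" for x
    using that by simp
  have eq: "g (exp (- y)) * (exp (- y) * f y)
      = (indicator {0..} y * g (exp (- y))) * (exp (- y) * f y)" for y
    using f0[of y] by (auto simp: indicator_def not_le)
  have m: "(\<lambda>y. indicator {0..} y * g (exp (- y))) \<in> borel_measurable N"
    using continuous_on_unit_interval_exp_measurable[OF g] measurable_cong_sets[OF N refl] by blast
  show ?thesis
    unfolding eq
  proof (rule Bochner_Integration.integrable_bound)
    show "integrable N (\<lambda>y. B * (exp (- y) * f y))" using f by simp
    show "(\<lambda>y. indicator {0..} y * g (exp (- y)) * (exp (- y) * f y)) \<in> borel_measurable N"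
      by (rule borel_measurable_times[OF m borel_measurable_integrable[OF f]])
    show "AE y in N. norm (indicator {0..} y * g (exp (- y)) * (exp (- y) * f y)) \<le> norm (B * (exp (- y) * f y))"
    proof (rule AE_I2)
      fix y
      show "norm (indicator {0..} y * g (exp (- y)) * (exp (- y) * f y)) \<le> norm (B * (exp (- y) * f y))"
      proof (cases "0 \<le> y")
        case True
        have "\<bar>g (exp (- y))\<bar> \<le> \<bar>B\<bar>" using B[of "exp (- y)"] True by auto
        then show ?thesis using True by (auto simp: abs_mult intro!: mult_right_mono)
      qed (simp add: f0)
    qed
  qed
qed

lemma exp_integral_diff_le:
  fixes g g' :: "real \<Rightarrow> real"
  assumes N: "sets N = sets borel" and f: "integrable N (\<lambda>y. exp (- y) * f y)"
    and f0: "\<And>y. y < 0 \<Longrightarrow> f y = 0" and g: "continuous_on {0..1} g" and g': "continuous_on {0..1} g'"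
    and e: "\<And>x. x \<in> {0..1} \<Longrightarrow> \<bar>g x - g' x\<bar> \<le> e"
  shows "\<bar>exp_integral N f g - exp_integral N f g'\<bar> \<le> e * (\<integral>y. exp (- y) * \<bar>f y\<bar> \<partial>N)"
proof -
  note i = integrable_exp_integral[OF N f f0 g] integrable_exp_integral[OF N f f0 g']
  have f': "integrable N (\<lambda>y. exp (- y) * \<bar>f y\<bar>)"
    using integrable_abs[OF f] by (simp add: abs_mult)
  have "\<bar>exp_integral N f g - exp_integral N f g'\<bar>
      = \<bar>\<integral>y. g (exp (- y)) * (exp (- y) * f y) - g' (exp (- y)) * (exp (- y) * f y) \<partial>N\<bar>"
    unfolding exp_integral_def using i by simp
  also have "\<dots> \<le> (\<integral>y. \<bar>g (exp (- y)) * (exp (- y) * f y) - g' (exp (- y)) * (exp (- y) * f y)\<bar> \<partial>N)"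
    by (rule integral_abs_bound)
  also have "\<dots> \<le> (\<integral>y. e * (exp (- y) * \<bar>f y\<bar>) \<partial>N)"
  proof (rule integral_mono)
    show "integrable N (\<lambda>y. \<bar>g (exp (- y)) * (exp (- y) * f y) - g' (exp (- y)) * (exp (- y) * f y)\<bar>)"
      using i by (intro integrable_abs Bochner_Integration.integrable_diff)
    show "integrable N (\<lambda>y. e * (exp (- y) * \<bar>f y\<bar>))" using f' by simp
    fix y
    show "\<bar>g (exp (- y)) * (exp (- y) * f y) - g' (exp (- y)) * (exp (- y) * f y)\<bar> \<le> e * (exp (- y) * \<bar>f y\<bar>)"
    proof (cases "0 \<le> y")
      case True
      have "\<bar>g (exp (- y)) * (exp (- y) * f y) - g' (exp (- y)) * (exp (- y) * f y)\<bar>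
          = \<bar>g (exp (- y)) - g' (exp (- y))\<bar> * (exp (- y) * \<bar>f y\<bar>)"
        by (simp add: left_diff_distrib[symmetric] abs_mult)
      also have "\<dots> \<le> e * (exp (- y) * \<bar>f y\<bar>)" using e[of "exp (- y)"] True by (intro mult_right_mono) auto
      finally show ?thesis .
    qed (simp add: f0)
  qed
  finally show ?thesis by simp
qed

text \<open>The weight \<open>exp (- y)\<close> built into \<open>exp_integral\<close> raises each
  exponent by one: \<open>x ^ i\<close> yields the Laplace transform at \<open>Suc i\<close>, so the
  argument \<open>0\<close>, where integrals may diverge, never occurs.\<close>

lemma exp_integral_poly:
  fixes a :: "nat \<Rightarrow> real"
  assumes N: "sets N = sets borel" and f: "integrable N (\<lambda>y. exp (- y) * f y)"
    and f0: "\<And>y. y < 0 \<Longrightarrow> f y = 0"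
  shows "exp_integral N f (\<lambda>x. \<Sum>i\<le>k. a i * x ^ i)
    = (\<Sum>i\<le>k. a i * (\<integral>y. exp (- real (Suc i) * y) * f y \<partial>N))"
proof -
  have eq: "exp (- y) ^ i * (exp (- y) * f y) = exp (- real (Suc i) * y) * f y" for i y
    by (simp add: exp_of_nat_mult[symmetric] exp_add[symmetric] algebra_simps)
  have int: "integrable N (\<lambda>y. exp (- real (Suc i) * y) * f y)" for i
    using integrable_exp_integral[OF N f f0, of "\<lambda>x. x ^ i"]
    by (simp only: eq) (simp add: continuous_on_power continuous_on_id)
  have "exp_integral N f (\<lambda>x. \<Sum>i\<le>k. a i * x ^ i)
      = (\<integral>y. (\<Sum>i\<le>k. a i * (exp (- real (Suc i) * y) * f y)) \<partial>N)"
    unfolding exp_integral_def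
    by (simp only: sum_distrib_right eq[symmetric] mult.assoc)
  also have "\<dots> = (\<Sum>i\<le>k. a i * (\<integral>y. exp (- real (Suc i) * y) * f y \<partial>N))"
    using int by (subst Bochner_Integration.integral_sum) (auto simp del: of_nat_Suc)
  finally show ?thesis .
qed

text \<open>By Weierstrass approximation it suffices to treat polynomials in
  \<open>exp (- y)\<close>, that is, Laplace transforms at the positive integers. The common bound
  \<open>B\<close> on the weighted total mass makes the approximation error uniform along the
  filter. Both the measures and the integrands may vary.\<close>

lemma exp_integral_tendsto:
  fixes N :: "'b \<Rightarrow> real measure" and f :: "'b \<Rightarrow> real \<Rightarrow> real" and F :: "'b filter"
  assumes N: "\<forall>\<^sub>F r in F. sets (N r) = sets borel \<and> integrable (N r) (\<lambda>y. exp (- y) * f r y) \<and>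
      (\<forall>y<0. f r y = 0) \<and> (\<integral>y. exp (- y) * \<bar>f r y\<bar> \<partial>N r) \<le> B"
    and N0: "sets N0 = sets borel" and f0: "integrable N0 (\<lambda>y. exp (- y) * f0 y)"
    and f00: "\<And>y. y < 0 \<Longrightarrow> f0 y = 0"
    and lim: "\<And>i. ((\<lambda>r. \<integral>y. exp (- real (Suc i) * y) * f r y \<partial>N r)
        \<longlongrightarrow> (\<integral>y. exp (- real (Suc i) * y) * f0 y \<partial>N0)) F"
    and g: "continuous_on {0..1} g"
  shows "((\<lambda>r. exp_integral (N r) (f r) g) \<longlongrightarrow> exp_integral N0 f0 g) F"
proof (rule tendstoI)
  fix e :: real assume e: "0 < e"
  \<comment> \<open>\<open>C\<close> dominates the weighted masses of all members and of the limit;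
    the summand 1 keeps it positive, so that \<open>d = e / (3 * C)\<close> makes each of the two
    approximation errors at most \<open>e / 3\<close>.\<close>
  define C where "C = max B 0 + (\<integral>y. exp (- y) * \<bar>f0 y\<bar> \<partial>N0) + 1"
  have C0: "0 \<le> (\<integral>y. exp (- y) * \<bar>f0 y\<bar> \<partial>N0)" by simp
  then have C: "0 < C" "B \<le> C" "(\<integral>y. exp (- y) * \<bar>f0 y\<bar> \<partial>N0) \<le> C" unfolding C_def by linarith+
  define d where "d = e / (3 * C)"
  have d: "0 < d" "d * C = e / 3" using e C by (auto simp: d_def)
  obtain p where p: "real_polynomial_function p" "\<And>x. x \<in> {0..1} \<Longrightarrow> \<bar>g x - p x\<bar> < d"
    using Stone_Weierstrass_real_polynomial_function[OF _ g d(1)] by (auto simp: compact_Icc)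
  obtain a k where ak: "p = (\<lambda>x. \<Sum>i\<le>k. a i * x ^ i)"
    using p(1) by (auto simp: real_polynomial_function_iff_sum)
  have pc: "continuous_on {0..1} p" unfolding ak by (intro continuous_intros)
  have pd: "\<bar>g x - p x\<bar> \<le> d" if "x \<in> {0..1}" for x using p(2)[OF that] by simp
  have lim_poly: "((\<lambda>r. \<Sum>i\<le>k. a i * (\<integral>y. exp (- real (Suc i) * y) * f r y \<partial>N r))
      \<longlongrightarrow> (\<Sum>i\<le>k. a i * (\<integral>y. exp (- real (Suc i) * y) * f0 y \<partial>N0))) F"
    by (intro tendsto_intros lim)
  have "\<bar>exp_integral N0 f0 g - exp_integral N0 f0 p\<bar> \<le> d * (\<integral>y. exp (- y) * \<bar>f0 y\<bar> \<partial>N0)"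
    by (rule exp_integral_diff_le[OF N0 f0 f00 g pc pd])
  also have "\<dots> \<le> d * C" using d C by (intro mult_left_mono) auto
  finally have 0: "\<bar>exp_integral N0 f0 g - exp_integral N0 f0 p\<bar> \<le> e / 3" using d by simp
  have "\<forall>\<^sub>F r in F. dist (\<Sum>i\<le>k. a i * (\<integral>y. exp (- real (Suc i) * y) * f r y \<partial>N r))
      (\<Sum>i\<le>k. a i * (\<integral>y. exp (- real (Suc i) * y) * f0 y \<partial>N0)) < e / 3"
    using lim_poly e by (intro tendstoD) auto
  with N show "\<forall>\<^sub>F r in F. dist (exp_integral (N r) (f r) g) (exp_integral N0 f0 g) < e"
  proof eventually_elim
    case (elim r)
    then have r: "sets (N r) = sets borel" "integrable (N r) (\<lambda>y. exp (- y) * f r y)"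
      "\<And>y. y < 0 \<Longrightarrow> f r y = 0" "(\<integral>y. exp (- y) * \<bar>f r y\<bar> \<partial>N r) \<le> C" using C by auto
    have "\<bar>exp_integral (N r) (f r) g - exp_integral (N r) (f r) p\<bar>
        \<le> d * (\<integral>y. exp (- y) * \<bar>f r y\<bar> \<partial>N r)"
      by (rule exp_integral_diff_le[OF r(1,2,3) g pc pd])
    also have "\<dots> \<le> d * C" using d r(4) by (intro mult_left_mono) auto
    finally have "\<bar>exp_integral (N r) (f r) g - exp_integral (N r) (f r) p\<bar> \<le> e / 3" using d by simp
    moreover have "\<bar>exp_integral (N r) (f r) p - exp_integral N0 f0 p\<bar> < e / 3"
      using elim(2) exp_integral_poly[OF r(1,2,3), of a k] exp_integral_poly[OF N0 f0 f00, of a k]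
      by (simp add: ak dist_real_def)
    ultimately show ?case using 0 unfolding dist_real_def by linarith
  qed
qed

text \<open>Uniqueness is the convergence statement for a constant sequence.\<close>

lemma exp_integral_unique:
  assumes N: "sets N = sets borel" and f: "integrable N (\<lambda>y. exp (- y) * f y)"
    and f0: "\<And>y. y < 0 \<Longrightarrow> f y = 0"
    and N': "sets N' = sets borel" and f': "integrable N' (\<lambda>y. exp (- y) * f' y)"
    and f0': "\<And>y. y < 0 \<Longrightarrow> f' y = 0"
    and eq: "\<And>i. (\<integral>y. exp (- real (Suc i) * y) * f y \<partial>N) = (\<integral>y. exp (- real (Suc i) * y) * f' y \<partial>N')"
    and g: "continuous_on {0..1} g"
  shows "exp_integral N f g = exp_integral N' f' g"
proof -
  have "((\<lambda>_::nat. exp_integral N f g) \<longlonglongrightarrow> exp_integral N' f' g)"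
    by (rule exp_integral_tendsto[OF _ N' f' f0' _ g, where B = "\<integral>y. exp (- y) * \<bar>f y\<bar> \<partial>N"])
       (use N f f0 eq in auto)
  then show ?thesis by (simp add: LIMSEQ_const_iff)
qed

text \<open>The indicator of \<open>y \<le> s\<close>, divided by the weight \<open>exp (- y)\<close>, is a bounded pointwise limit of
  continuous functions of \<open>exp (- y)\<close>.\<close>

lemma laplace_transform_unique_integral:
  assumes N: "sets N = sets borel" and f: "integrable N (\<lambda>y. exp (- y) * f y)"
    and f0: "\<And>y. y < 0 \<Longrightarrow> f y = 0"
    and N': "sets N' = sets borel" and f': "integrable N' (\<lambda>y. exp (- y) * f' y)"
    and f0': "\<And>y. y < 0 \<Longrightarrow> f' y = 0"
    and eq: "\<And>i. (\<integral>y. exp (- real (Suc i) * y) * f y \<partial>N) = (\<integral>y. exp (- real (Suc i) * y) * f' y \<partial>N')"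
  shows "(\<integral>y. indicator {..s} y * f y \<partial>N) = (\<integral>y. indicator {..s} y * f' y \<partial>N')"
proof -
  define a where "a = exp (- s)"
  have a: "0 < a" by (simp add: a_def)
  \<comment> \<open>The numerator is a ramp of slope \<open>k\<close> that rises from 0 to 1 just
    below \<open>a\<close>. For \<open>x \<ge> a\<close> the denominator is \<open>x\<close> and
    cancels the weight \<open>exp (- y)\<close>; the floor \<open>a / 2\<close> keeps everything
    below \<open>2 / a\<close>.\<close>
  define g where "g k x = max 0 (min 1 (1 - real k * (a - x))) / max x (a / 2)" for k :: nat and x :: real
  have gc: "continuous_on {0..1} (g k)" for k
    unfolding g_def using a by (intro continuous_intros) auto
  have lim: "(\<lambda>k. g k (exp (- y)) * (exp (- y) * f y)) \<longlonglongrightarrow> indicator {..s} y * f y" for y and f :: "real \<Rightarrow> real"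
  proof (cases "y \<le> s")
    case True
    then have ya: "a \<le> exp (- y)" by (simp add: a_def)
    have "g k (exp (- y)) = 1 / exp (- y)" for k
    proof -
      have "real k * (a - exp (- y)) \<le> 0" using ya by (simp add: mult_nonneg_nonpos)
      then have "max 0 (min 1 (1 - real k * (a - exp (- y)))) = 1" by simp
      moreover have "max (exp (- y)) (a / 2) = exp (- y)" using ya a by (simp add: max_def)
      ultimately show ?thesis by (simp add: g_def)
    qed
    then show ?thesis using True by simp
  next
    case False
    then have ya: "exp (- y) < a" by (simp add: a_def)
    obtain K :: nat where K: "1 / (a - exp (- y)) < real K" using reals_Archimedean2 by blast
    have "g k (exp (- y)) = 0" if "K \<le> k" for k
    proof -
      have "1 / (a - exp (- y)) < real k" using K that by (meson less_le_trans of_nat_le_iff)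
      then have "1 < real k * (a - exp (- y))" using ya by (simp add: field_simps)
      then show ?thesis by (simp add: g_def)
    qed
    then have "\<forall>\<^sub>F k in sequentially. g k (exp (- y)) * (exp (- y) * f y) = indicator {..s} y * f y"
      using False by (intro eventually_sequentiallyI[of K]) simp
    then show ?thesis by (rule tendsto_eventually)
  qed
  have bound: "\<bar>g k x\<bar> \<le> 2 / a" for k x
  proof -
    have "\<bar>g k x\<bar> = max 0 (min 1 (1 - real k * (a - x))) / max x (a / 2)"
      using a by (simp add: g_def)
    also have "\<dots> \<le> 1 / (a / 2)" using a by (intro frac_le) auto
    finally show ?thesis by simp
  qed
  have *: "(\<lambda>k. exp_integral N f (g k)) \<longlonglongrightarrow> (\<integral>y. indicator {..s} y * f y \<partial>N)"
    if N: "sets N = sets borel" and f: "integrable N (\<lambda>y. exp (- y) * f y)"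
    and f0: "\<And>y. y < 0 \<Longrightarrow> f y = 0" for N f
    unfolding exp_integral_def
  proof (rule integral_dominated_convergence)
    note [measurable_cong] = N
    have [measurable]: "f \<in> borel_measurable N"
    proof -
      have "(\<lambda>y. exp y * (exp (- y) * f y)) \<in> borel_measurable N"
        using borel_measurable_integrable[OF f] by measurable
      then show ?thesis by (simp add: mult.assoc[symmetric] exp_add[symmetric])
    qed
    show "(\<lambda>y. indicator {..s} y * f y) \<in> borel_measurable N" by measurable
    show "(\<lambda>y. g k (exp (- y)) * (exp (- y) * f y)) \<in> borel_measurable N" for k
      by (rule borel_measurable_integrable[OF integrable_exp_integral[OF N f f0 gc]])
    show "integrable N (\<lambda>y. 2 / a * \<bar>exp (- y) * f y\<bar>)" using f by simp
    show "AE y in N. (\<lambda>k. g k (exp (- y)) * (exp (- y) * f y)) \<longlonglongrightarrow> indicator {..s} y * f y"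
      using lim by simp
    show "AE y in N. norm (g k (exp (- y)) * (exp (- y) * f y)) \<le> 2 / a * \<bar>exp (- y) * f y\<bar>" for k
      unfolding norm_mult real_norm_def abs_mult using bound[of k] by (intro AE_I2 mult_right_mono) auto
  qed
  show ?thesis
    using *[OF N f f0] *[OF N' f' f0'] exp_integral_unique[OF N f f0 N' f' f0' eq gc]
    by (simp add: LIMSEQ_unique)
qed


section \<open>Gamma integrals and the monotone Tauberian theorem\<close>

lemma has_bochner_integral_exp_powr:
  fixes q b :: real
  assumes b: "b < 1" and q: "0 < q"
  shows "has_bochner_integral lborel (\<lambda>t. indicator {0<..} t * (exp (- q * t) * t powr - b))
    (Gamma (1 - b) * q powr (b - 1))"
proof -
  have "(\<integral>\<^sup>+t. ennreal (indicator {0<..} t * (exp (- t) * t powr - b)) \<partial>lborel)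
      = (\<integral>\<^sup>+t. ennreal (indicator {0..} t * t powr (1 - b - 1) / exp t) \<partial>lborel)"
    by (rule nn_integral_cong) (auto simp: indicator_def exp_minus field_simps)
  also have "\<dots> = ennreal (Gamma (1 - b))"
    using b by (subst Gamma_conv_nn_integral_real) auto
  finally have "has_bochner_integral lborel (\<lambda>t. indicator {0<..} t * (exp (- t) * t powr - b)) (Gamma (1 - b))"
    using b by (intro has_bochner_integral_nn_integral) (auto intro!: less_imp_le[OF Gamma_real_pos])
  \<comment> \<open>The case \<open>q = 1\<close> is the Gamma integral; the general case follows by
    the scaling \<open>t\<close> to \<open>q * t\<close>.\<close>
  then have "has_bochner_integral lborel (\<lambda>t. indicator {0<..} (0 + q * t) * (exp (- (0 + q * t)) * (0 + q * t) powr - b))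
      (Gamma (1 - b) /\<^sub>R \<bar>q\<bar>)"
    using q by (subst (asm) lborel_has_bochner_integral_real_affine_iff[of q _ _ 0]) auto
  then have A: "has_bochner_integral lborel
      (\<lambda>t. q powr b * (indicator {0<..} (0 + q * t) * (exp (- (0 + q * t)) * (0 + q * t) powr - b)))
      (q powr b * (Gamma (1 - b) /\<^sub>R \<bar>q\<bar>))"
    by (rule has_bochner_integral_mult_right[rotated])
  have B: "q powr b * (indicator {0<..} (0 + q * t) * (exp (- (0 + q * t)) * (0 + q * t) powr - b))
      = indicator {0<..} t * (exp (- q * t) * t powr - b)" for t
    using q by (auto simp: indicator_def powr_mult powr_minus field_simps zero_less_mult_iff)
  have C: "q powr b * (Gamma (1 - b) /\<^sub>R \<bar>q\<bar>) = Gamma (1 - b) * q powr (b - 1)"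
    using q by (simp add: powr_diff field_simps)
  show ?thesis using A unfolding B C .
qed

text \<open>After \<open>x = exp (- t)\<close> the bump is positive exactly on the interval from
  \<open>a\<close> to \<open>b\<close>. Its mass \<open>S\<close> is positive, so integrals against
  it act as averages over that interval and inherit one-sided bounds that hold there.\<close>

lemma bump_integral_bounds:
  fixes a b :: real
  assumes ab: "0 < a" "a < b"
  defines "g \<equiv> \<lambda>x::real. max 0 ((x - exp (- b)) * (exp (- a) - x))"
  defines "S \<equiv> exp_integral lborel (indicator {0<..}) g"
  shows "0 < S"
    and "\<And>f. integrable lborel (\<lambda>t. exp (- t) * (indicator {0<..} t * f t)) \<Longrightarrow>
      (\<And>t. a < t \<Longrightarrow> t < b \<Longrightarrow> f t \<le> c) \<Longrightarrow>
      exp_integral lborel (\<lambda>t. indicator {0<..} t * f t) g \<le> c * S"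
    and "\<And>f. integrable lborel (\<lambda>t. exp (- t) * (indicator {0<..} t * f t)) \<Longrightarrow>
      (\<And>t. a < t \<Longrightarrow> t < b \<Longrightarrow> c \<le> f t) \<Longrightarrow>
      c * S \<le> exp_integral lborel (\<lambda>t. indicator {0<..} t * f t) g"
proof -
  have gc: "continuous_on {0..1} g" unfolding g_def by (intro continuous_intros)
  have g0: "0 \<le> g x" for x by (simp add: g_def)
  have gsupp: "a < t \<and> t < b" if "g (exp (- t)) \<noteq> 0" for t
  proof (rule ccontr)
    assume "\<not> (a < t \<and> t < b)"
    then have "(exp (- t) - exp (- b)) * (exp (- a) - exp (- t)) \<le> 0"
      using ab by (auto simp: not_less mult_le_0_iff)
    then show False using that by (simp add: g_def)
  qed
  have gpos: "0 < g (exp (- t))" if "a < t" "t < b" for t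
    using that unfolding g_def by (auto simp: max_def zero_less_mult_iff not_le mult_le_0_iff)
  \<comment> \<open>The exponent \<open>0\<close> in the Gamma integral gives the plain
    exponential.\<close>
  have int1: "integrable lborel (\<lambda>t. exp (- t) * indicator {0<..} t :: real)"
  proof -
    have "integrable lborel (\<lambda>t. indicator {0<..} t * (exp (- 1 * t) * t powr - 0) :: real)"
      by (rule integrable.intros[OF has_bochner_integral_exp_powr]) auto
    also have "(\<lambda>t. indicator {0<..} t * (exp (- 1 * t) * t powr - 0)) = (\<lambda>t. exp (- t) * indicator {0<..} t :: real)"
      by (auto simp: indicator_def)
    finally show ?thesis .
  qed
  note gi = integrable_exp_integral[OF sets_lborel _ _ gc]
  have i1: "integrable lborel (\<lambda>t. g (exp (- t)) * (exp (- t) * indicator {0<..} t))"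
    by (rule gi[OF int1]) auto
  have nn: "0 \<le> g (exp (- t)) * (exp (- t) * indicator {0<..} t)" for t
    using g0 by simp
  \<comment> \<open>With zero mass the bump would vanish almost everywhere, although it is positive
    on an interval of positive length.\<close>
  have "S \<noteq> 0"
  proof
    assume "S = 0"
    then have "AE t in lborel. g (exp (- t)) * (exp (- t) * indicator {0<..} t) = 0"
      unfolding S_def exp_integral_def using integral_nonneg_eq_0_iff_AE[OF i1] nn by simp
    then have "AE t in lborel. t \<notin> {a<..<b}"
      by eventually_elim (use gpos ab in \<open>force simp: less_le\<close>)
    then have "emeasure lborel {a<..<b} = 0"
      by (subst (asm) AE_iff_measurable[of "{a<..<b}"]) auto
    then show False using ab by simp
  qed
  moreover have "0 \<le> S" unfolding S_def exp_integral_def by (rule integral_nonneg_AE) (simp add: nn)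
  ultimately show "0 < S" by simp
  fix f :: "real \<Rightarrow> real"
  assume f: "integrable lborel (\<lambda>t. exp (- t) * (indicator {0<..} t * f t))"
  have i2: "integrable lborel (\<lambda>t. g (exp (- t)) * (exp (- t) * (indicator {0<..} t * f t)))"
    by (rule gi[OF f]) auto
  have S: "c * S = (\<integral>t. c * (g (exp (- t)) * (exp (- t) * indicator {0<..} t)) \<partial>lborel)"
    by (simp add: S_def exp_integral_def)
  {
    assume *: "\<And>t. a < t \<Longrightarrow> t < b \<Longrightarrow> f t \<le> c"
    have "g (exp (- t)) * (exp (- t) * (indicator {0<..} t * f t)) \<le> c * (g (exp (- t)) * (exp (- t) * indicator {0<..} t))" for t
      using mult_left_mono[OF *[of t] nn[of t]] gsupp[of t] by (cases "g (exp (- t)) = 0") (auto simp: mult_ac)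
    then show "exp_integral lborel (\<lambda>t. indicator {0<..} t * f t) g \<le> c * S"
      unfolding S unfolding exp_integral_def using i1 i2 by (intro integral_mono) auto
  }
  {
    assume *: "\<And>t. a < t \<Longrightarrow> t < b \<Longrightarrow> c \<le> f t"
    have "c * (g (exp (- t)) * (exp (- t) * indicator {0<..} t)) \<le> g (exp (- t)) * (exp (- t) * (indicator {0<..} t * f t))" for t
      using mult_left_mono[OF *[of t] nn[of t]] gsupp[of t] by (cases "g (exp (- t)) = 0") (auto simp: mult_ac)
    then show "c * S \<le> exp_integral lborel (\<lambda>t. indicator {0<..} t * f t) g"
      unfolding S unfolding exp_integral_def using i1 i2 by (intro integral_mono) auto
  }
qed

text \<open>The rescaled functions \<open>r\<^sup>b f(r t)\<close> have Laplace transforms converging to that of \<open>K t\<^sup>-\<^sup>b\<close>.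
  Testing against a bump supported to the left (right) of \<open>t = 1\<close> and using monotonicity bounds
  \<open>r\<^sup>b f(r)\<close> from above (below).\<close>

theorem karamata_tauberian_monotone:
  fixes f :: "real \<Rightarrow> real"
  assumes f_nonneg: "\<And>t. 0 < t \<Longrightarrow> 0 \<le> f t"
    and f_mono: "\<And>s t. 0 < s \<Longrightarrow> s \<le> t \<Longrightarrow> f t \<le> f s"
    and b: "b < 1"
    and int: "\<And>q. 0 < q \<Longrightarrow> set_integrable lborel {0<..} (\<lambda>t. exp (- q * t) * f t)"
    and lim: "((\<lambda>q. q powr (1 - b) * (LINT t:{0<..}|lborel. exp (- q * t) * f t)) \<longlongrightarrow> C) (at_right 0)"
  shows "((\<lambda>t. t powr b * f t) \<longlongrightarrow> C / Gamma (1 - b)) at_top"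
proof -
  define L where "L q = (LINT t:{0<..}|lborel. exp (- q * t) * f t)" for q
  define K where "K = C / Gamma (1 - b)"
  define fr where "fr r t = indicator {0<..} t * (r powr b * f (r * t))" for r t :: real
  define f0 where "f0 t = indicator {0<..} t * (K * t powr - b)" for t :: real
  have G: "0 < Gamma (1 - b)" using b by simp
  have L_eq: "L q = (\<integral>t. indicator {0<..} t * (exp (- q * t) * f t) \<partial>lborel)" for q
    by (simp add: L_def set_lebesgue_integral_def)
  have int': "integrable lborel (\<lambda>t. indicator {0<..} t * (exp (- q * t) * f t))" if "0 < q" for q
    using int[OF that] by (simp add: set_integrable_def)
  \<comment> \<open>The transform of the rescaled function is expressed through
    \<open>L (q / r)\<close>: for fixed \<open>q\<close> and growing \<open>r\<close> the argument
    tends to \<open>0\<close> from the right, which is where \<open>lim\<close> speaks.\<close>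
  have fr_int: "integrable lborel (\<lambda>t. exp (- q * t) * fr r t)"
    and fr_val: "(\<integral>t. exp (- q * t) * fr r t \<partial>lborel) = q powr (b - 1) * ((q / r) powr (1 - b) * L (q / r))"
    if "0 < q" "0 < r" for q r
  proof -
    have qr: "0 < q / r" using that by simp
    have eq: "exp (- q * t) * fr r t = r powr b * (indicator {0<..} (0 + r * t) * (exp (- (q / r) * (0 + r * t)) * f (0 + r * t)))" for t
      using that by (auto simp: fr_def indicator_def zero_less_mult_iff)
    show "integrable lborel (\<lambda>t. exp (- q * t) * fr r t)"
      unfolding eq using that
      by (intro integrable_mult_right lborel_integrable_real_affine[OF int'[OF qr], of r 0]) auto
    have "L (q / r) = r * (\<integral>t. indicator {0<..} (0 + r * t) * (exp (- (q / r) * (0 + r * t)) * f (0 + r * t)) \<partial>lborel)"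
      unfolding L_eq using that by (subst lborel_integral_real_affine[of r _ 0]) auto
    then have "(\<integral>t. exp (- q * t) * fr r t \<partial>lborel) = r powr b * (L (q / r) / r)"
      unfolding eq using that by simp
    also have "\<dots> = q powr (b - 1) * ((q / r) powr (1 - b) * L (q / r))"
      using that by (simp add: powr_divide powr_diff field_simps)
    finally show "(\<integral>t. exp (- q * t) * fr r t \<partial>lborel) = q powr (b - 1) * ((q / r) powr (1 - b) * L (q / r))" .
  qed
  have f0_hbi: "has_bochner_integral lborel (\<lambda>t. exp (- q * t) * f0 t) (C * q powr (b - 1))" if "0 < q" for q
    using has_bochner_integral_mult_right[OF has_bochner_integral_exp_powr[OF b that], of K] G
    by (simp add: f0_def K_def mult_ac)
  have lim_q: "((\<lambda>r. \<integral>t. exp (- q * t) * fr r t \<partial>lborel) \<longlongrightarrow> (\<integral>t. exp (- q * t) * f0 t \<partial>lborel)) at_top"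
    if q: "0 < q" for q
  proof -
    have "filterlim (\<lambda>r. q / r) (at_right 0) at_top"
    proof (rule tendsto_imp_filterlim_at_right)
      show "((\<lambda>r. q / r) \<longlongrightarrow> 0) at_top" by real_asymp
      show "\<forall>\<^sub>F r in at_top. 0 < q / r" using eventually_gt_at_top[of 0] by eventually_elim (use q in simp)
    qed
    from filterlim_compose[OF lim[folded L_def] this]
    have "((\<lambda>r. q powr (b - 1) * ((q / r) powr (1 - b) * L (q / r))) \<longlongrightarrow> q powr (b - 1) * C) at_top"
      by (intro tendsto_mult_left)
    moreover have "\<forall>\<^sub>F r in at_top. q powr (b - 1) * ((q / r) powr (1 - b) * L (q / r)) = (\<integral>t. exp (- q * t) * fr r t \<partial>lborel)"
      using eventually_gt_at_top[of 0] by eventually_elim (use q fr_val in simp)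
    ultimately show ?thesis
      using has_bochner_integral_integral_eq[OF f0_hbi[OF q]]
      by (simp add: filterlim_cong mult.commute Lim_transform_eventually)
  qed
  have lim_g: "((\<lambda>r. exp_integral lborel (fr r) g) \<longlongrightarrow> exp_integral lborel f0 g) at_top"
    if g: "continuous_on {0..1} g" for g
  \<comment> \<open>The uniform mass bound comes from the convergence at \<open>q = 1\<close>:
    eventually the masses stay below their limit plus one.\<close>
  proof (rule exp_integral_tendsto[OF _ sets_lborel _ _ _ g])
    have "\<forall>\<^sub>F r in at_top. (\<integral>t. exp (- 1 * t) * fr r t \<partial>lborel) < (\<integral>t. exp (- 1 * t) * f0 t \<partial>lborel) + 1"
      using lim_q[of 1] by (intro order_tendstoD) auto
    with eventually_gt_at_top[of 0]
    show "\<forall>\<^sub>F r in at_top. sets lborel = sets borel \<and> integrable lborel (\<lambda>y. exp (- y) * fr r y) \<and>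
        (\<forall>y<0. fr r y = 0) \<and> (\<integral>y. exp (- y) * \<bar>fr r y\<bar> \<partial>lborel) \<le> (\<integral>t. exp (- t) * f0 t \<partial>lborel) + 1"
    proof eventually_elim
      case (elim r)
      have "\<bar>fr r t\<bar> = fr r t" for t
        using elim f_nonneg[of "r * t"] by (auto simp: fr_def indicator_def)
      then show ?case using elim fr_int[of 1 r] by (auto simp: fr_def)
    qed
    show "integrable lborel (\<lambda>y. exp (- y) * f0 y)" using f0_hbi[of 1] by (auto simp: integrable.simps)
    show "f0 y = 0" if "y < 0" for y using that by (simp add: f0_def)
    show "((\<lambda>r. \<integral>y. exp (- real (Suc i) * y) * fr r y \<partial>lborel) \<longlongrightarrow> (\<integral>y. exp (- real (Suc i) * y) * f0 y \<partial>lborel)) at_top" for i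
      by (rule lim_q) simp
  qed
  have f0_int: "integrable lborel (\<lambda>y. exp (- y) * (indicator {0<..} y * (K * y powr - b)))"
    using f0_hbi[of 1] unfolding f0_def by (auto simp: integrable.simps)
  have fr_int1: "integrable lborel (\<lambda>y. exp (- y) * (indicator {0<..} y * (r powr b * f (r * y))))" if "0 < r" for r
    using fr_int[of 1 r] that unfolding fr_def by simp
  have gc: "continuous_on {0..1} (\<lambda>x::real. max 0 ((x - exp (- v)) * (exp (- u) - x)))" for u v
    by (intro continuous_intros)
  have K_cont: "((\<lambda>t. K * t powr - b) \<longlongrightarrow> K) (at 1)"
    by (rule tendsto_eq_intros refl | simp)+
  have near: "\<exists>d>0. d < 1 \<and> (\<forall>t. \<bar>t - 1\<bar> \<le> d \<longrightarrow> \<bar>K * t powr - b - K\<bar> < e)" if e: "0 < e" for e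
  proof -
    obtain d where d: "0 < d" "\<And>t. t \<noteq> 1 \<Longrightarrow> dist t 1 < d \<Longrightarrow> dist (K * t powr - b) K < e"
      using tendstoD[OF K_cont e] by (auto simp: eventually_at)
    show ?thesis
    proof (intro exI[of _ "min (d / 2) (1 / 2)"] conjI allI impI)
      fix t assume "\<bar>t - 1\<bar> \<le> min (d / 2) (1 / 2)"
      then show "\<bar>K * t powr - b - K\<bar> < e" using d e by (cases "t = 1") (auto simp: dist_real_def)
    qed (use d in auto)
  qed
  have fr1: "r powr b * f (r * t) \<ge> r powr b * f r" if "0 < r" "0 < t" "t \<le> 1" for r t
    using that f_mono[of "r * t" r] by (intro mult_left_mono) (auto intro: mult_left_le)
  have fr2: "r powr b * f (r * t) \<le> r powr b * f r" if "0 < r" "1 \<le> t" for r t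
    using that f_mono[of r "r * t"] by (intro mult_left_mono) auto
  show ?thesis
    unfolding K_def[symmetric]
  proof (rule tendstoI)
    fix e :: real assume e: "0 < e"
    \<comment> \<open>Half of \<open>e\<close> pays for the variation of the limit function near 1;
      the other half leaves strict inequalities, which persist for the approximating
      integrals.\<close>
    obtain d where d: "0 < d" "d < 1" "\<And>t. \<bar>t - 1\<bar> \<le> d \<Longrightarrow> \<bar>K * t powr - b - K\<bar> < e / 2"
      using near[of "e / 2"] e by auto
    define g where "g u v = (\<lambda>x::real. max 0 ((x - exp (- v)) * (exp (- u) - x)))" for u v
    define S where "S u v = exp_integral lborel (indicator {0<..}) (g u v)" for u v
    have ab1: "0 < 1 - d" "1 - d < 1" and ab2: "0 < (1::real)" "1 < 1 + d" using d by auto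
    note B1 = bump_integral_bounds[OF ab1, folded g_def, folded S_def]
    note B2 = bump_integral_bounds[OF ab2, folded g_def, folded S_def]
    have u1: "exp_integral lborel f0 (g (1 - d) 1) \<le> (K + e / 2) * S (1 - d) 1"
      unfolding f0_def
    proof (rule B1(2)[OF f0_int])
      fix t assume "1 - d < t" "t < 1"
      then have "\<bar>K * t powr - b - K\<bar> < e / 2" by (intro d) auto
      then show "K * t powr - b \<le> K + e / 2" by linarith
    qed
    have u2: "(K - e / 2) * S 1 (1 + d) \<le> exp_integral lborel f0 (g 1 (1 + d))"
      unfolding f0_def
    proof (rule B2(3)[OF f0_int])
      fix t assume "1 < t" "t < 1 + d"
      then have "\<bar>K * t powr - b - K\<bar> < e / 2" by (intro d) auto
      then show "K - e / 2 \<le> K * t powr - b" by linarith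
    qed
    have "(K + e / 2) * S (1 - d) 1 < (K + e) * S (1 - d) 1"
      using B1(1) e by (intro mult_strict_right_mono) auto
    then have ev1: "\<forall>\<^sub>F r in at_top. exp_integral lborel (fr r) (g (1 - d) 1) < (K + e) * S (1 - d) 1"
      using u1 by (intro order_tendstoD(2)[OF lim_g[OF gc, folded g_def]]) auto
    have "(K - e) * S 1 (1 + d) < (K - e / 2) * S 1 (1 + d)"
      using B2(1) e by (intro mult_strict_right_mono) auto
    then have ev2: "\<forall>\<^sub>F r in at_top. (K - e) * S 1 (1 + d) < exp_integral lborel (fr r) (g 1 (1 + d))"
      using u2 by (intro order_tendstoD(1)[OF lim_g[OF gc, folded g_def]]) auto
    from ev1 ev2 eventually_gt_at_top[of 0]
    show "\<forall>\<^sub>F r in at_top. dist (r powr b * f r) K < e"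
    proof eventually_elim
      case (elim r)
      have "(r powr b * f r) * S (1 - d) 1 \<le> exp_integral lborel (fr r) (g (1 - d) 1)"
        unfolding fr_def using elim(3) d fr1 by (intro B1(3)[OF fr_int1]) auto
      then have "(r powr b * f r) * S (1 - d) 1 < (K + e) * S (1 - d) 1" using elim(1) by linarith
      then have 1: "r powr b * f r < K + e" using B1(1) by (simp add: mult_less_cancel_right)
      have "exp_integral lborel (fr r) (g 1 (1 + d)) \<le> (r powr b * f r) * S 1 (1 + d)"
        unfolding fr_def using elim(3) d fr2 by (intro B2(2)[OF fr_int1]) auto
      then have "(K - e) * S 1 (1 + d) < (r powr b * f r) * S 1 (1 + d)" using elim(2) by linarith
      then have "K - e < r powr b * f r" using B2(1) by (simp add: mult_less_cancel_right)
      with 1 show ?case by (simp add: dist_real_def abs_less_iff)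
    qed
  qed
qed

section \<open>The Ito isometry and orthogonality of Ito integrals\<close>

lemma square_integrable_mult:
  fixes X Y :: "'a \<Rightarrow> real"
  assumes [measurable]: "X \<in> borel_measurable M" "Y \<in> borel_measurable M"
    and "integrable M (\<lambda>\<omega>. (X \<omega>)\<^sup>2)" "integrable M (\<lambda>\<omega>. (Y \<omega>)\<^sup>2)"
  shows "integrable M (\<lambda>\<omega>. X \<omega> * Y \<omega>)"
proof (rule Bochner_Integration.integrable_bound)
  show "integrable M (\<lambda>\<omega>. (X \<omega>)\<^sup>2 + (Y \<omega>)\<^sup>2)" using assms by simp
  have "\<bar>x * y\<bar> \<le> x\<^sup>2 + y\<^sup>2" for x y :: real
    using sum_squares_bound[of "\<bar>x\<bar>" "\<bar>y\<bar>"] mult_nonneg_nonneg[OF abs_ge_zero[of x] abs_ge_zero[of y]]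
    unfolding power2_abs abs_mult by linarith
  then show "AE \<omega> in M. norm (X \<omega> * Y \<omega>) \<le> norm ((X \<omega>)\<^sup>2 + (Y \<omega>)\<^sup>2)"
    by (intro AE_I2) (smt (verit) real_norm_def)
qed measurable

lemma square_integrable_lincomb:
  fixes X Y :: "'a \<Rightarrow> real"
  assumes [measurable]: "X \<in> borel_measurable M" "Y \<in> borel_measurable M"
    and i: "integrable M (\<lambda>\<omega>. (X \<omega>)\<^sup>2)" "integrable M (\<lambda>\<omega>. (Y \<omega>)\<^sup>2)"
  shows "integrable M (\<lambda>\<omega>. (X \<omega> + r * Y \<omega>)\<^sup>2)"
    and "(\<integral>\<omega>. (X \<omega> + r * Y \<omega>)\<^sup>2 \<partial>M)
      = (\<integral>\<omega>. (X \<omega>)\<^sup>2 \<partial>M) + 2 * r * (\<integral>\<omega>. X \<omega> * Y \<omega> \<partial>M) + r\<^sup>2 * (\<integral>\<omega>. (Y \<omega>)\<^sup>2 \<partial>M)"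
proof -
  have eq: "(X \<omega> + r * Y \<omega>)\<^sup>2 = (X \<omega>)\<^sup>2 + 2 * r * (X \<omega> * Y \<omega>) + r\<^sup>2 * (Y \<omega>)\<^sup>2" for \<omega>
    by (simp add: power2_eq_square algebra_simps)
  note m = square_integrable_mult[OF assms]
  show "integrable M (\<lambda>\<omega>. (X \<omega> + r * Y \<omega>)\<^sup>2)" unfolding eq using i m by simp
  show "(\<integral>\<omega>. (X \<omega> + r * Y \<omega>)\<^sup>2 \<partial>M)
      = (\<integral>\<omega>. (X \<omega>)\<^sup>2 \<partial>M) + 2 * r * (\<integral>\<omega>. X \<omega> * Y \<omega> \<partial>M) + r\<^sup>2 * (\<integral>\<omega>. (Y \<omega>)\<^sup>2 \<partial>M)"
    unfolding eq using i m by simp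
qed

text \<open>\<open>A + 2 * r * B + r\<^sup>2 * C\<close> is the second moment of
  \<open>X + r * Y\<close>, hence nonnegative for every \<open>r\<close>.\<close>

lemma Cauchy_Schwarz_integral:
  fixes X Y :: "'a \<Rightarrow> real"
  assumes XY: "X \<in> borel_measurable M" "Y \<in> borel_measurable M"
    and i: "integrable M (\<lambda>\<omega>. (X \<omega>)\<^sup>2)" "integrable M (\<lambda>\<omega>. (Y \<omega>)\<^sup>2)"
  shows "(\<integral>\<omega>. X \<omega> * Y \<omega> \<partial>M)\<^sup>2 \<le> (\<integral>\<omega>. (X \<omega>)\<^sup>2 \<partial>M) * (\<integral>\<omega>. (Y \<omega>)\<^sup>2 \<partial>M)"
proof -
  define A B C where "A = (\<integral>\<omega>. (X \<omega>)\<^sup>2 \<partial>M)" and "B = (\<integral>\<omega>. X \<omega> * Y \<omega> \<partial>M)" and "C = (\<integral>\<omega>. (Y \<omega>)\<^sup>2 \<partial>M)"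
  have q: "0 \<le> A + 2 * r * B + r\<^sup>2 * C" for r
    unfolding A_def B_def C_def square_integrable_lincomb(2)[OF XY i, symmetric] by simp
  have "0 \<le> C" by (simp add: C_def)
  have "B\<^sup>2 \<le> A * C"
  proof (cases "C = 0")
    case True
    have "B = 0"
    proof (rule ccontr)
      assume "B \<noteq> 0"
      \<comment> \<open>For \<open>C = 0\<close> the polynomial is linear in \<open>r\<close>; this
        choice makes its value -1.\<close>
      then show False using q[of "- (A + 1) / (2 * B)"] True by (simp add: field_simps)
    qed
    then show ?thesis using True by simp
  next
    case False
    then show ?thesis using q[of "- B / C"] \<open>0 \<le> C\<close> by (simp add: power2_eq_square field_simps)
  qed
  then show ?thesis by (simp add: A_def B_def C_def)
qed

lemma nn_integral_square_finite:
  fixes X :: "'a \<Rightarrow> real"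
  assumes "X \<in> borel_measurable M" "(\<integral>\<^sup>+\<omega>. ennreal ((X \<omega>)\<^sup>2) \<partial>M) < \<infinity>"
  shows "integrable M (\<lambda>\<omega>. (X \<omega>)\<^sup>2)"
  using assms by (intro integrableI_bounded) auto

text \<open>Interface between the \<open>L2\<close> limits in the definition of the Ito integral,
  which are nonnegative integrals and may be infinite for some \<open>j\<close>, and ordinary
  expectations: an \<open>L2\<close> null sequence is eventually square-integrable and, by
  Cauchy-Schwarz, vanishes when tested against a fixed \<open>Z\<close>.\<close>

lemma nn_integral_square_tendsto_0:
  fixes X :: "nat \<Rightarrow> 'a \<Rightarrow> real"
  assumes X: "\<And>j. X j \<in> borel_measurable M"
    and lim: "(\<lambda>j. \<integral>\<^sup>+\<omega>. ennreal ((X j \<omega>)\<^sup>2) \<partial>M) \<longlonglongrightarrow> 0"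
    and Z: "Z \<in> borel_measurable M" "integrable M (\<lambda>\<omega>. (Z \<omega>)\<^sup>2)"
  shows "\<forall>\<^sub>F j in sequentially. integrable M (\<lambda>\<omega>. (X j \<omega>)\<^sup>2)"
    and "(\<lambda>j. \<integral>\<omega>. X j \<omega> * Z \<omega> \<partial>M) \<longlonglongrightarrow> 0"
proof -
  have "\<forall>\<^sub>F j in sequentially. (\<integral>\<^sup>+\<omega>. ennreal ((X j \<omega>)\<^sup>2) \<partial>M) < \<infinity>"
    using order_tendstoD(2)[OF lim, of \<infinity>] by simp
  then show ev: "\<forall>\<^sub>F j in sequentially. integrable M (\<lambda>\<omega>. (X j \<omega>)\<^sup>2)"
    by eventually_elim (rule nn_integral_square_finite[OF X])
  have "(\<lambda>j. enn2real (\<integral>\<^sup>+\<omega>. ennreal ((X j \<omega>)\<^sup>2) \<partial>M)) \<longlonglongrightarrow> 0"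
    using lim by (intro tendsto_enn2real) simp_all
  moreover have eq: "enn2real (\<integral>\<^sup>+\<omega>. ennreal ((X j \<omega>)\<^sup>2) \<partial>M) = (\<integral>\<omega>. (X j \<omega>)\<^sup>2 \<partial>M)" for j
    by (subst integral_eq_nn_integral) (use X in auto)
  ultimately have "(\<lambda>j. (\<integral>\<omega>. (X j \<omega>)\<^sup>2 \<partial>M)) \<longlonglongrightarrow> 0" by simp
  then have lim1: "(\<lambda>j. (\<integral>\<omega>. (X j \<omega>)\<^sup>2 \<partial>M) * (\<integral>\<omega>. (Z \<omega>)\<^sup>2 \<partial>M)) \<longlonglongrightarrow> 0"
    by (rule tendsto_mult_left_zero)
  have "\<forall>\<^sub>F j in sequentially. (\<integral>\<omega>. X j \<omega> * Z \<omega> \<partial>M)\<^sup>2 \<le> (\<integral>\<omega>. (X j \<omega>)\<^sup>2 \<partial>M) * (\<integral>\<omega>. (Z \<omega>)\<^sup>2 \<partial>M)"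
    using ev by eventually_elim (rule Cauchy_Schwarz_integral[OF X Z(1) _ Z(2)])
  then have "(\<lambda>j. (\<integral>\<omega>. X j \<omega> * Z \<omega> \<partial>M)\<^sup>2) \<longlonglongrightarrow> 0"
    by (rule tendsto_sandwich[OF _ _ tendsto_const lim1, rotated]) simp
  then have "(\<lambda>j. sqrt ((\<integral>\<omega>. X j \<omega> * Z \<omega> \<partial>M)\<^sup>2)) \<longlonglongrightarrow> sqrt 0"
    by (rule tendsto_real_sqrt)
  then have "(\<lambda>j. \<bar>\<integral>\<omega>. X j \<omega> * Z \<omega> \<partial>M\<bar>) \<longlonglongrightarrow> 0" by simp
  then show "(\<lambda>j. \<integral>\<omega>. X j \<omega> * Z \<omega> \<partial>M) \<longlonglongrightarrow> 0" by (rule tendsto_rabs_zero_cancel)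
qed

section \<open>Products of Brownian increments with adapted bounded factors\<close>

locale brownian = prob_space M for M :: "'a measure" +
  fixes F :: "real \<Rightarrow> 'a measure" and W :: "real \<Rightarrow> 'a \<Rightarrow> real"
  assumes brownian: "brownian_motion M F W"
begin

lemma filtration_F: "filtration (space M) F" using brownian by (simp add: brownian_motion_def)

lemma space_F [simp]: "space (F t) = space M"
  using filtration.space_F[OF filtration_F] .

lemma measurable_F_mono: "s \<le> t \<Longrightarrow> f \<in> measurable (F s) N \<Longrightarrow> f \<in> measurable (F t) N"
  using filtration.sets_F_mono[OF filtration_F, of s t] by (auto simp: measurable_def)

lemma sets_F: "sets (F t) \<subseteq> sets M" using brownian by (simp add: brownian_motion_def)

lemma measurable_F: "f \<in> measurable (F t) N \<Longrightarrow> f \<in> measurable M N"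
  using sets_F[of t] by (auto simp: measurable_def)

lemma W_F: "0 \<le> t \<Longrightarrow> t \<le> s \<Longrightarrow> W t \<in> borel_measurable (F s)"
  using measurable_F_mono[of t s "W t"] brownian unfolding brownian_motion_def by blast

lemma W_M [measurable]: "0 \<le> t \<Longrightarrow> W t \<in> borel_measurable M"
  using W_F[of t t] measurable_F by auto

lemma increment_distributed:
  "0 \<le> s \<Longrightarrow> s < t \<Longrightarrow> distributed M lborel (\<lambda>\<omega>. W t \<omega> - W s \<omega>) (\<lambda>x. ennreal (normal_density 0 (sqrt (t - s)) x))"
  using brownian by (simp add: brownian_motion_def)

lemma increment_moments:
  assumes "0 \<le> s" "s \<le> t"
  shows "integrable M (\<lambda>\<omega>. W t \<omega> - W s \<omega>)" "expectation (\<lambda>\<omega>. W t \<omega> - W s \<omega>) = 0"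
    "integrable M (\<lambda>\<omega>. (W t \<omega> - W s \<omega>)\<^sup>2)" "expectation (\<lambda>\<omega>. (W t \<omega> - W s \<omega>)\<^sup>2) = t - s"
proof -
  have "integrable M (\<lambda>\<omega>. W t \<omega> - W s \<omega>) \<and> expectation (\<lambda>\<omega>. W t \<omega> - W s \<omega>) = 0 \<and>
    integrable M (\<lambda>\<omega>. (W t \<omega> - W s \<omega>)\<^sup>2) \<and> expectation (\<lambda>\<omega>. (W t \<omega> - W s \<omega>)\<^sup>2) = t - s"
  proof (cases "s = t")
    case False
    then have st: "0 < sqrt (t - s)" using assms by simp
    have d: "distributed M lborel (\<lambda>\<omega>. W t \<omega> - W s \<omega>) (\<lambda>x. ennreal (normal_density 0 (sqrt (t - s)) x))"
      using increment_distributed[OF assms(1), of t] False assms by simp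
    have e: "expectation (\<lambda>\<omega>. W t \<omega> - W s \<omega>) = 0" by (rule normal_distributed_expectation[OF st d])
    have v: "variance (\<lambda>\<omega>. W t \<omega> - W s \<omega>) = (sqrt (t - s))\<^sup>2" by (rule normal_distributed_variance[OF st d])
    have "integrable M (\<lambda>\<omega>. (W t \<omega> - W s \<omega>) ^ k)" for k
      using distributed_integrable[OF d, of "\<lambda>x. x ^ k"] integrable_normal_moment[OF st, of 0 k] by simp
    from this[of 1] this[of 2] e v show ?thesis using assms by simp
  qed simp
  then show "integrable M (\<lambda>\<omega>. W t \<omega> - W s \<omega>)" "expectation (\<lambda>\<omega>. W t \<omega> - W s \<omega>) = 0"
    "integrable M (\<lambda>\<omega>. (W t \<omega> - W s \<omega>)\<^sup>2)" "expectation (\<lambda>\<omega>. (W t \<omega> - W s \<omega>)\<^sup>2) = t - s" by auto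
qed

text \<open>The definition gives independence from the whole of \<open>F s\<close>; the algebra
  generated by \<open>Y\<close> is contained in it.\<close>

lemma increment_indep:
  assumes "0 \<le> s" "s < t" and Y: "Y \<in> borel_measurable (F s)"
  shows "indep_var borel Y borel (\<lambda>\<omega>. W t \<omega> - W s \<omega>)"
  unfolding indep_var_eq
proof (intro conjI)
  show "random_variable borel Y" using Y by (rule measurable_F)
  show "random_variable borel (\<lambda>\<omega>. W t \<omega> - W s \<omega>)"
    using assms by (intro borel_measurable_diff W_M) auto
  have "indep_set (sets (F s)) (sets (vimage_algebra (space M) (\<lambda>\<omega>. W t \<omega> - W s \<omega>) borel))"
    using brownian assms by (simp add: brownian_motion_def)
  then show "indep_set (sigma_sets (space M) {Y -` A \<inter> space M |A. A \<in> sets borel})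
     (sigma_sets (space M) {(\<lambda>\<omega>. W t \<omega> - W s \<omega>) -` A \<inter> space M |A. A \<in> sets borel})"
    unfolding indep_set_def
  proof (rule indep_sets_mono_sets)
    have "sigma_sets (space (F s)) {Y -` A \<inter> space M |A. A \<in> sets borel} \<subseteq> sets (F s)"
      using measurable_sets[OF Y] by (intro sets.sigma_sets_subset) auto
    then show "case_bool (sigma_sets (space M) {Y -` A \<inter> space M |A. A \<in> sets borel})
       (sigma_sets (space M) {(\<lambda>\<omega>. W t \<omega> - W s \<omega>) -` A \<inter> space M |A. A \<in> sets borel}) i
      \<subseteq> case_bool (sets (F s)) (sets (vimage_algebra (space M) (\<lambda>\<omega>. W t \<omega> - W s \<omega>) borel)) i" for i
      by (cases i) (auto simp: sets_vimage_algebra)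
  qed
qed

text \<open>Independence factors the expectations. The degenerate case \<open>s = t\<close>, which
  the definition of Brownian motion does not cover, is trivial because the increment is
  zero.\<close>

lemma mult_increment:
  assumes st: "0 \<le> s" "s \<le> t" and Y: "Y \<in> borel_measurable (F s)" "integrable M Y"
  shows "integrable M (\<lambda>\<omega>. Y \<omega> * (W t \<omega> - W s \<omega>))" "expectation (\<lambda>\<omega>. Y \<omega> * (W t \<omega> - W s \<omega>)) = 0"
    "integrable M (\<lambda>\<omega>. Y \<omega> * (W t \<omega> - W s \<omega>)\<^sup>2)"
    "expectation (\<lambda>\<omega>. Y \<omega> * (W t \<omega> - W s \<omega>)\<^sup>2) = expectation Y * (t - s)"
proof -
  have "integrable M (\<lambda>\<omega>. Y \<omega> * (W t \<omega> - W s \<omega>)) \<and> expectation (\<lambda>\<omega>. Y \<omega> * (W t \<omega> - W s \<omega>)) = 0 \<and>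
    integrable M (\<lambda>\<omega>. Y \<omega> * (W t \<omega> - W s \<omega>)\<^sup>2) \<and>
    expectation (\<lambda>\<omega>. Y \<omega> * (W t \<omega> - W s \<omega>)\<^sup>2) = expectation Y * (t - s)"
  proof (cases "s = t")
    case False
    then have ind: "indep_var borel Y borel (\<lambda>\<omega>. W t \<omega> - W s \<omega>)"
      using st by (intro increment_indep Y) auto
    have ind2: "indep_var borel Y borel (\<lambda>\<omega>. (W t \<omega> - W s \<omega>)\<^sup>2)"
      using indep_var_compose[OF ind, of "\<lambda>x. x" borel "\<lambda>x. x\<^sup>2" borel] by (simp add: comp_def)
    note m = increment_moments[OF st]
    show ?thesis
      using indep_var_integrable[OF ind Y(2) m(1)] indep_var_lebesgue_integral[OF ind Y(2) m(1)]
        indep_var_integrable[OF ind2 Y(2) m(3)] indep_var_lebesgue_integral[OF ind2 Y(2) m(3)] m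
      by simp
  qed simp
  then show "integrable M (\<lambda>\<omega>. Y \<omega> * (W t \<omega> - W s \<omega>))" "expectation (\<lambda>\<omega>. Y \<omega> * (W t \<omega> - W s \<omega>)) = 0"
    "integrable M (\<lambda>\<omega>. Y \<omega> * (W t \<omega> - W s \<omega>)\<^sup>2)"
    "expectation (\<lambda>\<omega>. Y \<omega> * (W t \<omega> - W s \<omega>)\<^sup>2) = expectation Y * (t - s)" by auto
qed

text \<open>Cutting both intervals at \<open>c\<close> and at the end of their overlap splits the
  product into terms in which the latest increment is independent of the rest and has mean zero,
  plus the square of the increment over the overlap, which alone contributes.\<close>

lemma increment_product_aux:
  assumes ab: "0 \<le> a" "a \<le> b" and cd: "c \<le> d" and ac: "a \<le> c"
    and \<xi>: "\<xi> \<in> borel_measurable (F a)" "\<And>\<omega>. \<omega> \<in> space M \<Longrightarrow> \<bar>\<xi> \<omega>\<bar> \<le> B"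
    and \<eta>: "\<eta> \<in> borel_measurable (F c)" "\<And>\<omega>. \<omega> \<in> space M \<Longrightarrow> \<bar>\<eta> \<omega>\<bar> \<le> B'"
  shows "integrable M (\<lambda>\<omega>. (\<xi> \<omega> * (W b \<omega> - W a \<omega>)) * (\<eta> \<omega> * (W d \<omega> - W c \<omega>)))"
    and "expectation (\<lambda>\<omega>. (\<xi> \<omega> * (W b \<omega> - W a \<omega>)) * (\<eta> \<omega> * (W d \<omega> - W c \<omega>)))
      = expectation (\<lambda>\<omega>. \<xi> \<omega> * \<eta> \<omega>) * max 0 (min b d - c)"
proof -
  \<comment> \<open>Right end of the overlap of the two intervals, pushed up to \<open>c\<close>
    when they do not overlap.\<close>
  define e where "e = max c (min b d)"
  have c0: "0 \<le> c" using ab ac by simp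
  have ce: "c \<le> e" by (simp add: e_def)
  define \<zeta> where "\<zeta> \<omega> = \<xi> \<omega> * \<eta> \<omega>" for \<omega>
  have \<zeta>m [measurable]: "\<zeta> \<in> borel_measurable (F c)"
    unfolding \<zeta>_def using measurable_F_mono[OF ac \<xi>(1)] \<eta>(1) by measurable
  have \<zeta>b: "\<bar>\<zeta> \<omega>\<bar> \<le> B * B'" if "\<omega> \<in> space M" for \<omega>
    unfolding \<zeta>_def abs_mult using \<xi>(2)[OF that] \<eta>(2)[OF that] by (intro mult_mono) auto
  have \<zeta>M [measurable]: "\<zeta> \<in> borel_measurable M" by (rule measurable_F[OF \<zeta>m])
  have bounded: "integrable M (\<lambda>\<omega>. \<zeta> \<omega> * f \<omega>)" if "integrable M f" for f
  proof (rule Bochner_Integration.integrable_bound)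
    show "integrable M (\<lambda>\<omega>. (B * B') * f \<omega>)" using that by simp
    show "(\<lambda>\<omega>. \<zeta> \<omega> * f \<omega>) \<in> borel_measurable M" using borel_measurable_integrable[OF that] by measurable
    have "\<bar>\<zeta> \<omega>\<bar> \<le> \<bar>B * B'\<bar>" if "\<omega> \<in> space M" for \<omega>
      using \<zeta>b[OF that] by linarith
    then show "AE \<omega> in M. norm (\<zeta> \<omega> * f \<omega>) \<le> norm (B * B' * f \<omega>)"
      unfolding norm_mult real_norm_def[of "\<zeta> _"] by (intro AE_I2 mult_right_mono) (auto simp: abs_mult)
  qed
  have \<zeta>i: "integrable M \<zeta>" using bounded[of "\<lambda>_. 1"] by simp
  have inc: "integrable M (\<lambda>\<omega>. \<zeta> \<omega> * (W v \<omega> - W u \<omega>))" if "0 \<le> u" "u \<le> v" for u v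
    by (rule bounded[OF increment_moments(1)[OF that]])
  have M1: "(\<lambda>\<omega>. \<zeta> \<omega> * (W c \<omega> - W a \<omega>)) \<in> borel_measurable (F c)"
    using ab ac by (intro borel_measurable_times borel_measurable_diff \<zeta>m W_F) auto
  note T1 = mult_increment[OF c0 cd M1 inc[OF ab(1) ac]]
  note T2 = mult_increment[OF c0 ce \<zeta>m \<zeta>i]
  have M3: "(\<lambda>\<omega>. \<zeta> \<omega> * (W e \<omega> - W c \<omega>)) \<in> borel_measurable (F e)"
    using ce c0 by (intro borel_measurable_times borel_measurable_diff measurable_F_mono[OF ce \<zeta>m] W_F) auto
  have M0: "(\<lambda>\<omega>. \<zeta> \<omega> * (W b \<omega> - W a \<omega>)) \<in> borel_measurable (F c)" if "b \<le> c"
    using ab ac that by (intro borel_measurable_times borel_measurable_diff \<zeta>m W_F) auto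
  note T0 = mult_increment[OF c0 cd M0 inc[OF ab]]
  have M4: "(\<lambda>\<omega>. \<zeta> \<omega> * (W d \<omega> - W c \<omega>)) \<in> borel_measurable (F d)"
    using cd c0 by (intro borel_measurable_times borel_measurable_diff measurable_F_mono[OF cd \<zeta>m] W_F) auto
  have prod: "(\<xi> \<omega> * (W b \<omega> - W a \<omega>)) * (\<eta> \<omega> * (W d \<omega> - W c \<omega>)) = (\<zeta> \<omega> * (W b \<omega> - W a \<omega>)) * (W d \<omega> - W c \<omega>)" for \<omega>
    by (simp add: \<zeta>_def)
  have "integrable M (\<lambda>\<omega>. (\<zeta> \<omega> * (W b \<omega> - W a \<omega>)) * (W d \<omega> - W c \<omega>)) \<and>
      expectation (\<lambda>\<omega>. (\<zeta> \<omega> * (W b \<omega> - W a \<omega>)) * (W d \<omega> - W c \<omega>)) = expectation \<zeta> * max 0 (min b d - c)"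
  proof (cases "b \<le> c")
    case True
    then show ?thesis using T0 by simp
  next
    case False
    then have e: "e = min b d" using cd by (simp add: e_def)
    have T3: "integrable M (\<lambda>\<omega>. (\<zeta> \<omega> * (W e \<omega> - W c \<omega>)) * (W d \<omega> - W e \<omega>))"
      "expectation (\<lambda>\<omega>. (\<zeta> \<omega> * (W e \<omega> - W c \<omega>)) * (W d \<omega> - W e \<omega>)) = 0"
      using mult_increment(1,2)[OF _ _ M3 inc[OF c0 ce], of d] c0 ce e by auto
    have T4: "integrable M (\<lambda>\<omega>. (\<zeta> \<omega> * (W d \<omega> - W c \<omega>)) * (W b \<omega> - W e \<omega>)) \<and>
      expectation (\<lambda>\<omega>. (\<zeta> \<omega> * (W d \<omega> - W c \<omega>)) * (W b \<omega> - W e \<omega>)) = 0"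
    proof (cases "b \<le> d")
      case False
      then show ?thesis
        using mult_increment(1,2)[OF _ _ M4 inc[OF c0 cd], of b] c0 cd e by auto
    qed (use e in simp)
    \<comment> \<open>With \<open>e = min b d\<close>, each of the last two terms either has an
      empty last increment or one that starts after everything else in the term; so both have mean
      zero.\<close>
    have eq: "(\<zeta> \<omega> * (W b \<omega> - W a \<omega>)) * (W d \<omega> - W c \<omega>) =
        (\<zeta> \<omega> * (W c \<omega> - W a \<omega>)) * (W d \<omega> - W c \<omega>) + \<zeta> \<omega> * (W e \<omega> - W c \<omega>)\<^sup>2
        + (\<zeta> \<omega> * (W e \<omega> - W c \<omega>)) * (W d \<omega> - W e \<omega>) + (\<zeta> \<omega> * (W d \<omega> - W c \<omega>)) * (W b \<omega> - W e \<omega>)" for \<omega>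
      by (simp add: power2_eq_square algebra_simps)
    show ?thesis unfolding eq using T1 T2 T3 T4 e ce by simp
  qed
  then show "integrable M (\<lambda>\<omega>. (\<xi> \<omega> * (W b \<omega> - W a \<omega>)) * (\<eta> \<omega> * (W d \<omega> - W c \<omega>)))"
    and "expectation (\<lambda>\<omega>. (\<xi> \<omega> * (W b \<omega> - W a \<omega>)) * (\<eta> \<omega> * (W d \<omega> - W c \<omega>)))
      = expectation (\<lambda>\<omega>. \<xi> \<omega> * \<eta> \<omega>) * max 0 (min b d - c)"
    unfolding prod by (simp_all add: \<zeta>_def[abs_def])
qed

lemma increment_product:
  assumes ab: "0 \<le> a" "a \<le> b" and cd: "0 \<le> c" "c \<le> d"
    and \<xi>: "\<xi> \<in> borel_measurable (F a)" "\<And>\<omega>. \<omega> \<in> space M \<Longrightarrow> \<bar>\<xi> \<omega>\<bar> \<le> B"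
    and \<eta>: "\<eta> \<in> borel_measurable (F c)" "\<And>\<omega>. \<omega> \<in> space M \<Longrightarrow> \<bar>\<eta> \<omega>\<bar> \<le> B'"
  shows "integrable M (\<lambda>\<omega>. (\<xi> \<omega> * (W b \<omega> - W a \<omega>)) * (\<eta> \<omega> * (W d \<omega> - W c \<omega>)))"
    and "expectation (\<lambda>\<omega>. (\<xi> \<omega> * (W b \<omega> - W a \<omega>)) * (\<eta> \<omega> * (W d \<omega> - W c \<omega>)))
      = expectation (\<lambda>\<omega>. \<xi> \<omega> * \<eta> \<omega>) * max 0 (min b d - max a c)"
proof -
  have "integrable M (\<lambda>\<omega>. (\<xi> \<omega> * (W b \<omega> - W a \<omega>)) * (\<eta> \<omega> * (W d \<omega> - W c \<omega>))) \<and>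
    expectation (\<lambda>\<omega>. (\<xi> \<omega> * (W b \<omega> - W a \<omega>)) * (\<eta> \<omega> * (W d \<omega> - W c \<omega>)))
      = expectation (\<lambda>\<omega>. \<xi> \<omega> * \<eta> \<omega>) * max 0 (min b d - max a c)"
  proof (cases "a \<le> c")
    case True
    then show ?thesis using increment_product_aux[OF ab cd(2) True \<xi> \<eta>] by (simp add: max_def)
  next
    case False
    then have "c \<le> a" by simp
    then show ?thesis
      using increment_product_aux[OF cd ab(2) \<open>c \<le> a\<close> \<eta> \<xi>] by (simp add: max_def min.commute mult_ac)
  qed
  then show "integrable M (\<lambda>\<omega>. (\<xi> \<omega> * (W b \<omega> - W a \<omega>)) * (\<eta> \<omega> * (W d \<omega> - W c \<omega>)))"
    and "expectation (\<lambda>\<omega>. (\<xi> \<omega> * (W b \<omega> - W a \<omega>)) * (\<eta> \<omega> * (W d \<omega> - W c \<omega>)))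
      = expectation (\<lambda>\<omega>. \<xi> \<omega> * \<eta> \<omega>) * max 0 (min b d - max a c)" by auto
qed

end

text \<open>The steps are right-open and the window \<open>{0..t}\<close> is closed, so a cut at
  \<open>t\<close> leaves a closed end, which has measure zero. The clipped endpoints match those in
  \<open>elementary_integral\<close>.\<close>

lemma measure_step_overlap:
  fixes a b c d t :: real
  assumes "0 \<le> a" "0 \<le> c"
  shows "measure lborel ({0..t} \<inter> {a..<b} \<inter> {c..<d})
    = max 0 (min (min t b) (min t d) - max (min t a) (min t c))"
proof (cases "min b d \<le> t")
  case True
  then have "{0..t} \<inter> {a..<b} \<inter> {c..<d} = {max a c..<min b d}" using assms by auto
  then show ?thesis using True by (auto simp: max_def min_def measure_lborel_Ico)
next
  case False
  then have "{0..t} \<inter> {a..<b} \<inter> {c..<d} = {max a c..t}" using assms by auto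
  moreover have "min t b = t" "min t d = t" using False by auto
  moreover have "measure lborel {max a c..t} = max 0 (t - max a c)"
    by (cases "max a c \<le> t") (auto simp: max_absorb1 max_absorb2)
  moreover have "max 0 (t - max a c) = max 0 (t - max (min t a) (min t c))" by (auto simp: max_def min_def)
  ultimately show ?thesis by (simp only: min.idem)
qed

lemma integral_double_sum:
  fixes f :: "'i \<Rightarrow> 'j \<Rightarrow> 'a \<Rightarrow> real"
  assumes "\<And>i j. i \<in> I \<Longrightarrow> j \<in> J \<Longrightarrow> integrable M (f i j)"
  shows "(\<integral>\<omega>. (\<Sum>i\<in>I. \<Sum>j\<in>J. f i j \<omega>) \<partial>M) = (\<Sum>i\<in>I. \<Sum>j\<in>J. \<integral>\<omega>. f i j \<omega> \<partial>M)"
proof -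
  have "(\<integral>\<omega>. (\<Sum>i\<in>I. \<Sum>j\<in>J. f i j \<omega>) \<partial>M) = (\<Sum>i\<in>I. \<integral>\<omega>. (\<Sum>j\<in>J. f i j \<omega>) \<partial>M)"
    using assms by (intro Bochner_Integration.integral_sum Bochner_Integration.integrable_sum)
  also have "\<dots> = (\<Sum>i\<in>I. \<Sum>j\<in>J. \<integral>\<omega>. f i j \<omega> \<partial>M)"
    using assms by (intro sum.cong refl Bochner_Integration.integral_sum)
  finally show ?thesis .
qed

section \<open>Elementary integrals: isometry and martingale property\<close>

context brownian
begin

text \<open>The intervals form an arbitrary finite family that may overlap. This lets two elementary
  processes on different grids be subtracted without a common refinement. Both sides expand into the
  same double sum over pairs, weighted by overlap lengths.\<close>

lemma ito_isometry_sum: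
  fixes I :: "'i set" and a b :: "'i \<Rightarrow> real" and \<xi> :: "'i \<Rightarrow> 'a \<Rightarrow> real"
  assumes fin: "finite I" and t: "0 \<le> t"
    and ab: "\<And>i. i \<in> I \<Longrightarrow> 0 \<le> a i" "\<And>i. i \<in> I \<Longrightarrow> a i \<le> b i"
    and \<xi>: "\<And>i. i \<in> I \<Longrightarrow> \<xi> i \<in> borel_measurable (F (a i))"
    and B: "\<And>i \<omega>. i \<in> I \<Longrightarrow> \<omega> \<in> space M \<Longrightarrow> \<bar>\<xi> i \<omega>\<bar> \<le> B i"
  defines "S \<equiv> \<lambda>\<omega>. \<Sum>i\<in>I. \<xi> i \<omega> * (W (min t (b i)) \<omega> - W (min t (a i)) \<omega>)"
    and "V \<equiv> \<lambda>s \<omega>. \<Sum>i\<in>I. indicator {a i..<b i} s * \<xi> i \<omega>"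
  shows "integrable M (\<lambda>\<omega>. (S \<omega>)\<^sup>2)"
    and "(\<integral>\<^sup>+\<omega>. ennreal ((S \<omega>)\<^sup>2) \<partial>M) = (\<integral>\<^sup>+\<omega>. (\<integral>\<^sup>+s\<in>{0..t}. ennreal ((V s \<omega>)\<^sup>2) \<partial>lborel) \<partial>M)"
proof -
  define l where "l i j = max 0 (min (min t (b i)) (min t (b j)) - max (min t (a i)) (min t (a j)))" for i j
  define P where "P i j \<omega> = (\<xi> i \<omega> * (W (min t (b i)) \<omega> - W (min t (a i)) \<omega>))
      * (\<xi> j \<omega> * (W (min t (b j)) \<omega> - W (min t (a j)) \<omega>))" for i j \<omega>
  have \<xi>M: "\<xi> i \<in> borel_measurable M" if "i \<in> I" for i using \<xi>[OF that] by (rule measurable_F)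
  have pair: "integrable M (P i j) \<and> expectation (P i j) = expectation (\<lambda>\<omega>. \<xi> i \<omega> * \<xi> j \<omega>) * l i j"
    if ij: "i \<in> I" "j \<in> I" for i j
  proof (cases "a i \<le> t \<and> a j \<le> t")
    case True
    then have m: "min t (a i) = a i" "min t (a j) = a j" by auto
    have le: "a i \<le> min t (b i)" "a j \<le> min t (b j)" using True ab ij by auto
    show ?thesis
      unfolding P_def[abs_def] l_def m
      using increment_product[OF ab(1)[OF ij(1)] le(1) ab(1)[OF ij(2)] le(2) \<xi>[OF ij(1)] B[OF ij(1)] \<xi>[OF ij(2)] B[OF ij(2)]]
      by blast
  next
    case False
    \<comment> \<open>A step that begins after \<open>t\<close> is clipped to the single point
      \<open>t\<close>, so its increment and its overlaps vanish.\<close>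
    then have "P i j = (\<lambda>\<omega>. 0)" "l i j = 0"
      using ab[OF ij(1)] ab[OF ij(2)] unfolding P_def[abs_def] l_def by (auto simp: min_def max_def)
    then show ?thesis by simp
  qed
  have \<xi>\<xi>: "integrable M (\<lambda>\<omega>. \<xi> i \<omega> * \<xi> j \<omega>)" if ij: "i \<in> I" "j \<in> I" for i j
  proof (rule integrable_const_bound[of _ "B i * B j"])
    show "AE \<omega> in M. norm (\<xi> i \<omega> * \<xi> j \<omega>) \<le> B i * B j"
    proof (rule AE_I2)
      fix \<omega> assume "\<omega> \<in> space M"
      then show "norm (\<xi> i \<omega> * \<xi> j \<omega>) \<le> B i * B j"
        unfolding real_norm_def abs_mult using B[OF ij(1), of \<omega>] B[OF ij(2), of \<omega>] by (intro mult_mono) auto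
    qed
  qed (intro borel_measurable_times \<xi>M ij)
  have S2: "(S \<omega>)\<^sup>2 = (\<Sum>i\<in>I. \<Sum>j\<in>I. P i j \<omega>)" for \<omega>
    by (simp add: S_def P_def power2_eq_square sum_product)
  show S_int: "integrable M (\<lambda>\<omega>. (S \<omega>)\<^sup>2)" unfolding S2 using pair by (intro Bochner_Integration.integrable_sum) auto
  \<comment> \<open>\<open>Q \<omega>\<close> is the integral of the squared step function over
    \<open>{0..t}\<close> along the path \<open>\<omega>\<close>, which is what \<open>inner\<close>
    establishes.\<close>
  define Q where "Q \<omega> = (\<Sum>i\<in>I. \<Sum>j\<in>I. \<xi> i \<omega> * \<xi> j \<omega> * l i j)" for \<omega>
  have Q_int: "integrable M Q"
    unfolding Q_def[abs_def] using \<xi>\<xi> by (intro Bochner_Integration.integrable_sum integrable_mult_left) auto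
  have ES: "expectation (\<lambda>\<omega>. (S \<omega>)\<^sup>2) = expectation Q"
  proof -
    have "expectation (\<lambda>\<omega>. (S \<omega>)\<^sup>2) = (\<Sum>i\<in>I. \<Sum>j\<in>I. expectation (P i j))"
      unfolding S2 using pair by (intro integral_double_sum) blast
    also have "\<dots> = (\<Sum>i\<in>I. \<Sum>j\<in>I. expectation (\<lambda>\<omega>. \<xi> i \<omega> * \<xi> j \<omega> * l i j))"
      using pair by (intro sum.cong refl) simp
    also have "\<dots> = expectation Q"
      unfolding Q_def[abs_def] using \<xi>\<xi> by (intro integral_double_sum[symmetric] integrable_mult_left) blast
    finally show ?thesis .
  qed
  have inner: "(\<integral>\<^sup>+s\<in>{0..t}. ennreal ((V s \<omega>)\<^sup>2) \<partial>lborel) = ennreal (Q \<omega>) \<and> 0 \<le> Q \<omega>" for \<omega>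
  proof -
    define A where "A i j = {0..t} \<inter> {a i..<b i} \<inter> {a j..<b j}" for i j
    have fA: "emeasure lborel (A i j) < \<infinity>" for i j
    proof -
      have "emeasure lborel (A i j) \<le> emeasure lborel {0..t}" by (rule emeasure_mono) (auto simp: A_def)
      also have "\<dots> < \<infinity>" using t by simp
      finally show ?thesis .
    qed
    have V2: "indicator {0..t} s * (V s \<omega>)\<^sup>2 = (\<Sum>i\<in>I. \<Sum>j\<in>I. \<xi> i \<omega> * \<xi> j \<omega> * indicator (A i j) s)" for s
    proof -
      have "(V s \<omega>)\<^sup>2 = (\<Sum>i\<in>I. \<Sum>j\<in>I. (indicator {a i..<b i} s * \<xi> i \<omega>) * (indicator {a j..<b j} s * \<xi> j \<omega>))"
        by (simp only: V_def power2_eq_square sum_product)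
      then show ?thesis
        unfolding A_def by (simp only: sum_distrib_left) (intro sum.cong refl, auto simp: indicator_def)
    qed
    have i: "integrable lborel (\<lambda>s. indicator {0..t} s * (V s \<omega>)\<^sup>2)"
      unfolding V2 using fA by (intro Bochner_Integration.integrable_sum integrable_mult_right) (auto simp: A_def)
    have "(\<integral>s. indicator {0..t} s * (V s \<omega>)\<^sup>2 \<partial>lborel) = (\<Sum>i\<in>I. \<Sum>j\<in>I. \<xi> i \<omega> * \<xi> j \<omega> * measure lborel (A i j))"
      unfolding V2 using fA
      by (subst integral_double_sum) (auto simp: A_def intro!: integrable_mult_right)
    also have "\<dots> = Q \<omega>"
      unfolding Q_def l_def A_def using ab by (intro sum.cong refl) (simp add: measure_step_overlap)
    finally have v: "(\<integral>s. indicator {0..t} s * (V s \<omega>)\<^sup>2 \<partial>lborel) = Q \<omega>" .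
    have "(\<integral>\<^sup>+s\<in>{0..t}. ennreal ((V s \<omega>)\<^sup>2) \<partial>lborel) = (\<integral>\<^sup>+s. ennreal (indicator {0..t} s * (V s \<omega>)\<^sup>2) \<partial>lborel)"
      by (intro nn_integral_cong) (auto simp: indicator_def)
    also have "\<dots> = ennreal (Q \<omega>)"
      unfolding v[symmetric] by (rule nn_integral_eq_integral[OF i]) (simp add: zero_le_mult_iff)
    finally show ?thesis unfolding v[symmetric] by (auto intro!: integral_nonneg_AE simp: zero_le_mult_iff)
  qed
  have "(\<integral>\<^sup>+\<omega>. ennreal ((S \<omega>)\<^sup>2) \<partial>M) = ennreal (expectation (\<lambda>\<omega>. (S \<omega>)\<^sup>2))"
    by (rule nn_integral_eq_integral[OF S_int]) simp
  also have "\<dots> = (\<integral>\<^sup>+\<omega>. ennreal (Q \<omega>) \<partial>M)"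
    unfolding ES using inner by (intro nn_integral_eq_integral[symmetric] Q_int) auto
  also have "\<dots> = (\<integral>\<^sup>+\<omega>. (\<integral>\<^sup>+s\<in>{0..t}. ennreal ((V s \<omega>)\<^sup>2) \<partial>lborel) \<partial>M)"
    using inner by simp
  finally show "(\<integral>\<^sup>+\<omega>. ennreal ((S \<omega>)\<^sup>2) \<partial>M) = (\<integral>\<^sup>+\<omega>. (\<integral>\<^sup>+s\<in>{0..t}. ennreal ((V s \<omega>)\<^sup>2) \<partial>lborel) \<partial>M)" .
qed

lemma elementary_grid:
  assumes "elementary_process F k \<tau> e" "i \<le> k"
  shows "0 \<le> \<tau> i"
  using assms(2)
proof (induction i)
  case (Suc i)
  then show ?case using assms(1) unfolding elementary_process_def
    by (meson Suc_le_lessD less_imp_le order_trans)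
qed (use assms(1) in \<open>simp add: elementary_process_def\<close>)

lemma elementary_bound:
  assumes "elementary_process F k \<tau> e"
  obtains B where "\<And>i \<omega>. i < k \<Longrightarrow> \<omega> \<in> space M \<Longrightarrow> \<bar>e i \<omega>\<bar> \<le> B i"
  using assms unfolding elementary_process_def space_F by metis

lemma elementary_measurable:
  assumes "elementary_process F k \<tau> e" "i < k"
  shows "e i \<in> borel_measurable M"
  using assms unfolding elementary_process_def by (blast intro: measurable_F)

lemma elementary_integral_measurable [measurable]:
  assumes "elementary_process F k \<tau> e" "0 \<le> t"
  shows "elementary_integral W k \<tau> e t \<in> borel_measurable M"
  unfolding elementary_integral_def[abs_def]
  using elementary_measurable[OF assms(1)] elementary_grid[OF assms(1)] assms(2)
  by (intro borel_measurable_sum borel_measurable_times borel_measurable_diff W_M) auto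

lemma elementary_value_measurable:
  assumes "elementary_process F k \<tau> e"
  shows "(\<lambda>(s, \<omega>). elementary_value k \<tau> e s \<omega>) \<in> borel_measurable (lborel \<Otimes>\<^sub>M M)"
proof -
  have "(\<lambda>p. \<Sum>i<k. indicator {\<tau> i..<\<tau> (Suc i)} (fst p) * e i (snd p)) \<in> borel_measurable (lborel \<Otimes>\<^sub>M M)"
  proof (intro borel_measurable_sum borel_measurable_times)
    fix i assume "i \<in> {..<k}"
    then have [measurable]: "e i \<in> borel_measurable M" using elementary_measurable[OF assms] by simp
    show "(\<lambda>p. e i (snd p)) \<in> borel_measurable (lborel \<Otimes>\<^sub>M M)" by measurable
  qed measurable
  then show ?thesis by (simp add: elementary_value_def case_prod_beta)
qed

text \<open>The difference is one step sum over the disjoint union of the two index sets, with the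
  heights of the second process negated.\<close>

lemma elementary_isometry_diff:
  assumes e: "elementary_process F k \<tau> e" and e': "elementary_process F k' \<tau>' e'" and t: "0 \<le> t"
  shows "(\<integral>\<^sup>+\<omega>. ennreal ((elementary_integral W k \<tau> e t \<omega> - elementary_integral W k' \<tau>' e' t \<omega>)\<^sup>2) \<partial>M)
    = (\<integral>\<^sup>+\<omega>. (\<integral>\<^sup>+s\<in>{0..t}. ennreal ((elementary_value k \<tau> e s \<omega> - elementary_value k' \<tau>' e' s \<omega>)\<^sup>2) \<partial>lborel) \<partial>M)"
proof -
  obtain B where B: "\<And>i \<omega>. i < k \<Longrightarrow> \<omega> \<in> space M \<Longrightarrow> \<bar>e i \<omega>\<bar> \<le> B i" using elementary_bound[OF e] by blast
  obtain B' where B': "\<And>i \<omega>. i < k' \<Longrightarrow> \<omega> \<in> space M \<Longrightarrow> \<bar>e' i \<omega>\<bar> \<le> B' i" using elementary_bound[OF e'] by blast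
  define a where "a = case_sum \<tau> \<tau>'"
  define b where "b = case_sum (\<lambda>i. \<tau> (Suc i)) (\<lambda>i. \<tau>' (Suc i))"
  define \<xi> where "\<xi> = case_sum e (\<lambda>i \<omega>. - e' i \<omega>)"
  define B2 where "B2 = case_sum B B'"
  have "(\<integral>\<^sup>+\<omega>. ennreal ((\<Sum>i\<in>{..<k} <+> {..<k'}. \<xi> i \<omega> * (W (min t (b i)) \<omega> - W (min t (a i)) \<omega>))\<^sup>2) \<partial>M)
    = (\<integral>\<^sup>+\<omega>. (\<integral>\<^sup>+s\<in>{0..t}. ennreal ((\<Sum>i\<in>{..<k} <+> {..<k'}. indicator {a i..<b i} s * \<xi> i \<omega>)\<^sup>2) \<partial>lborel) \<partial>M)"
  proof (rule ito_isometry_sum(2)[where B = B2])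
    fix i assume i: "i \<in> {..<k} <+> {..<k'}"
    show "0 \<le> a i" using i elementary_grid[OF e] elementary_grid[OF e'] by (auto simp: a_def)
    show "a i \<le> b i" using i e e' by (auto simp: a_def b_def elementary_process_def)
    show "\<xi> i \<in> borel_measurable (F (a i))"
      using i e e' by (auto simp: a_def \<xi>_def elementary_process_def intro!: borel_measurable_uminus)
    show "\<bar>\<xi> i \<omega>\<bar> \<le> B2 i" if "\<omega> \<in> space M" for \<omega>
      using i B B' that by (auto simp: \<xi>_def B2_def)
  qed (use t in auto)
  then show ?thesis
    by (simp only: sum.Plus finite_lessThan o_def a_def b_def \<xi>_def sum.case elementary_integral_def
        elementary_value_def mult_minus_right mult_minus_left sum_negf diff_conv_add_uminus)
qed

text \<open>Isometry for the difference with the elementary process that has no steps.\<close>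

lemma elementary_isometry:
  assumes e: "elementary_process F k \<tau> e" and t: "0 \<le> t"
  shows "(\<integral>\<^sup>+\<omega>. ennreal ((elementary_integral W k \<tau> e t \<omega>)\<^sup>2) \<partial>M)
    = (\<integral>\<^sup>+\<omega>. (\<integral>\<^sup>+s\<in>{0..t}. ennreal ((elementary_value k \<tau> e s \<omega>)\<^sup>2) \<partial>lborel) \<partial>M)"
  using elementary_isometry_diff[OF e, of 0 "\<lambda>_. 0" "\<lambda>_ _. 0" t] t
  by (simp add: elementary_process_def elementary_integral_def elementary_value_def)

lemma elementary_integral_square_integrable:
  assumes e: "elementary_process F k \<tau> e" and t: "0 \<le> t"
  shows "integrable M (\<lambda>\<omega>. (elementary_integral W k \<tau> e t \<omega>)\<^sup>2)"
proof -
  obtain B where B: "\<And>i \<omega>. i < k \<Longrightarrow> \<omega> \<in> space M \<Longrightarrow> \<bar>e i \<omega>\<bar> \<le> B i" using elementary_bound[OF e] by blast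
  show ?thesis
    unfolding elementary_integral_def
    by (rule ito_isometry_sum(1)[where B = B])
       (use e t B elementary_grid[OF e] in \<open>auto simp: elementary_process_def\<close>)
qed

text \<open>The martingale property, tested against square-integrable variables known at time
  \<open>s\<close>: each step contributes an increment after \<open>s\<close> times a factor known
  when that increment begins.\<close>

lemma elementary_integral_increment_orthogonal:
  assumes e: "elementary_process F k \<tau> e" and st: "0 \<le> s" "s \<le> t"
    and Z: "Z \<in> borel_measurable (F s)" "integrable M (\<lambda>\<omega>. (Z \<omega>)\<^sup>2)"
  shows "expectation (\<lambda>\<omega>. (elementary_integral W k \<tau> e t \<omega> - elementary_integral W k \<tau> e s \<omega>) * Z \<omega>) = 0"
proof -
  obtain B where B: "\<And>i \<omega>. i < k \<Longrightarrow> \<omega> \<in> space M \<Longrightarrow> \<bar>e i \<omega>\<bar> \<le> B i" using elementary_bound[OF e] by blast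
  have ZM: "Z \<in> borel_measurable M" using Z(1) by (rule measurable_F)
  have Zi: "integrable M Z"
    using square_integrable_mult[OF ZM _ Z(2), of "\<lambda>_. 1"] by simp
  define T where "T i \<omega> = e i \<omega> * ((W (min t (\<tau> (Suc i))) \<omega> - W (min t (\<tau> i)) \<omega>)
      - (W (min s (\<tau> (Suc i))) \<omega> - W (min s (\<tau> i)) \<omega>)) * Z \<omega>" for i \<omega>
  have T: "integrable M (T i) \<and> expectation (T i) = 0" if i: "i < k" for i
  proof -
    \<comment> \<open>The part of step \<open>i\<close> that lies between \<open>s\<close> and
      \<open>t\<close>; it is the single point \<open>s\<close> or \<open>t\<close> when the step
      lies outside.\<close>
    define u v where "u = max s (min t (\<tau> i))" and "v = max s (min t (\<tau> (Suc i)))"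
    have \<tau>: "0 \<le> \<tau> i" "\<tau> i \<le> \<tau> (Suc i)" using e i elementary_grid[OF e, of i] by (auto simp: elementary_process_def)
    have uv: "0 \<le> u" "u \<le> v" "s \<le> u" using st \<tau> by (auto simp: u_def v_def)
    have Teq: "T i \<omega> = (e i \<omega> * Z \<omega>) * (W v \<omega> - W u \<omega>)" for \<omega>
      using st \<tau> by (auto simp: T_def u_def v_def min_def max_def algebra_simps)
    show ?thesis
    proof (cases "\<tau> i \<le> t")
      case True
      then have "\<tau> i \<le> u" using st by (auto simp: u_def)
      then have em: "e i \<in> borel_measurable (F u)"
        using e i measurable_F_mono[of "\<tau> i" u] unfolding elementary_process_def by blast
      have m: "(\<lambda>\<omega>. e i \<omega> * Z \<omega>) \<in> borel_measurable (F u)"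
        using em measurable_F_mono[OF uv(3) Z(1)] by measurable
      have "integrable M (\<lambda>\<omega>. e i \<omega> * Z \<omega>)"
      proof (rule Bochner_Integration.integrable_bound)
        show "integrable M (\<lambda>\<omega>. B i * Z \<omega>)" using Zi by simp
        have "\<bar>e i \<omega>\<bar> \<le> \<bar>B i\<bar>" if "\<omega> \<in> space M" for \<omega> using B[OF i that] by linarith
        then show "AE \<omega> in M. norm (e i \<omega> * Z \<omega>) \<le> norm (B i * Z \<omega>)"
          unfolding real_norm_def abs_mult by (intro AE_I2 mult_right_mono) auto
      qed (rule measurable_F[OF m])
      then show ?thesis
        unfolding Teq[abs_def] using mult_increment(1,2)[OF uv(1,2) m] by simp
    next
      case False
      then have "u = v" using \<tau> by (simp add: u_def v_def)
      then show ?thesis unfolding Teq[abs_def] by simp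
    qed
  qed
  have "(\<lambda>\<omega>. (elementary_integral W k \<tau> e t \<omega> - elementary_integral W k \<tau> e s \<omega>) * Z \<omega>) = (\<lambda>\<omega>. \<Sum>i<k. T i \<omega>)"
    by (simp add: elementary_integral_def T_def sum_subtractf[symmetric] sum_distrib_right right_diff_distrib)
  then show ?thesis using T by (simp add: Bochner_Integration.integral_sum)
qed

end

text \<open>This is \<open>(x - y)\<^sup>2 \<le> 2 * x\<^sup>2 + 2 * y\<^sup>2\<close> applied to
  the distances from \<open>h\<close>. Measurability is asked for after multiplication by the
  indicator, because the definition of the Ito integral controls the integrand on the time window
  only.\<close>

lemma (in prob_space) nn_integral_square_triangle:
  fixes f g h :: "real \<Rightarrow> 'a \<Rightarrow> real"
  assumes f: "(\<lambda>(u, \<omega>). indicator {0..s} u * (h u \<omega> - f u \<omega>)) \<in> borel_measurable (lborel \<Otimes>\<^sub>M M)"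
    and g: "(\<lambda>(u, \<omega>). indicator {0..s} u * (h u \<omega> - g u \<omega>)) \<in> borel_measurable (lborel \<Otimes>\<^sub>M M)"
  shows "(\<integral>\<^sup>+\<omega>. (\<integral>\<^sup>+u\<in>{0..s}. ennreal ((f u \<omega> - g u \<omega>)\<^sup>2) \<partial>lborel) \<partial>M)
    \<le> 2 * (\<integral>\<^sup>+\<omega>. (\<integral>\<^sup>+u\<in>{0..s}. ennreal ((h u \<omega> - f u \<omega>)\<^sup>2) \<partial>lborel) \<partial>M)
      + 2 * (\<integral>\<^sup>+\<omega>. (\<integral>\<^sup>+u\<in>{0..s}. ennreal ((h u \<omega> - g u \<omega>)\<^sup>2) \<partial>lborel) \<partial>M)"
proof -
  define P where "P k u \<omega> = ennreal ((h u \<omega> - k u \<omega>)\<^sup>2) * indicator {0..s} u" for k :: "real \<Rightarrow> 'a \<Rightarrow> real" and u \<omega>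
  have P: "(\<lambda>(\<omega>, u). P k u \<omega>) \<in> borel_measurable (M \<Otimes>\<^sub>M lborel)"
    if "(\<lambda>(u, \<omega>). indicator {0..s} u * (h u \<omega> - k u \<omega>)) \<in> borel_measurable (lborel \<Otimes>\<^sub>M M)" for k
  proof -
    have "(\<lambda>(\<omega>, u). indicator {0..s} u * (h u \<omega> - k u \<omega>)) \<in> borel_measurable (M \<Otimes>\<^sub>M lborel)"
      using measurable_pair_swap[OF that] by simp
    then have "(\<lambda>x. ennreal ((case x of (\<omega>, u) \<Rightarrow> indicator {0..s} u * (h u \<omega> - k u \<omega>))\<^sup>2)) \<in> borel_measurable (M \<Otimes>\<^sub>M lborel)"
      by measurable
    also have "(\<lambda>x. ennreal ((case x of (\<omega>, u) \<Rightarrow> indicator {0..s} u * (h u \<omega> - k u \<omega>))\<^sup>2)) = (\<lambda>(\<omega>, u). P k u \<omega>)"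
      by (auto simp: P_def indicator_def)
    finally show ?thesis .
  qed
  have [measurable]: "(\<lambda>(\<omega>, u). P f u \<omega>) \<in> borel_measurable (M \<Otimes>\<^sub>M lborel)"
    "(\<lambda>(\<omega>, u). P g u \<omega>) \<in> borel_measurable (M \<Otimes>\<^sub>M lborel)" using P f g by auto
  have sec: "(\<lambda>u. P f u \<omega>) \<in> borel_measurable lborel" "(\<lambda>u. P g u \<omega>) \<in> borel_measurable lborel"
    if "\<omega> \<in> space M" for \<omega>
    using that by measurable
  have "ennreal ((f u \<omega> - g u \<omega>)\<^sup>2) * indicator {0..s} u \<le> 2 * P f u \<omega> + 2 * P g u \<omega>" for u \<omega>
  proof -
    have "(f u \<omega> - g u \<omega>)\<^sup>2 \<le> 2 * (h u \<omega> - f u \<omega>)\<^sup>2 + 2 * (h u \<omega> - g u \<omega>)\<^sup>2"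
      using zero_le_power2[of "(h u \<omega> - f u \<omega>) + (h u \<omega> - g u \<omega>)"] by (simp add: power2_eq_square algebra_simps)
    then have "ennreal ((f u \<omega> - g u \<omega>)\<^sup>2) \<le> ennreal (2 * (h u \<omega> - f u \<omega>)\<^sup>2 + 2 * (h u \<omega> - g u \<omega>)\<^sup>2)"
      by (rule ennreal_leI)
    also have "\<dots> = 2 * ennreal ((h u \<omega> - f u \<omega>)\<^sup>2) + 2 * ennreal ((h u \<omega> - g u \<omega>)\<^sup>2)"
      by (simp add: ennreal_plus ennreal_mult)
    finally show ?thesis by (auto simp: P_def indicator_def)
  qed
  then have "(\<integral>\<^sup>+\<omega>. (\<integral>\<^sup>+u\<in>{0..s}. ennreal ((f u \<omega> - g u \<omega>)\<^sup>2) \<partial>lborel) \<partial>M)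
      \<le> (\<integral>\<^sup>+\<omega>. (\<integral>\<^sup>+u. 2 * P f u \<omega> + 2 * P g u \<omega> \<partial>lborel) \<partial>M)"
    by (intro nn_integral_mono) auto
  also have "\<dots> = (\<integral>\<^sup>+\<omega>. 2 * (\<integral>\<^sup>+u. P f u \<omega> \<partial>lborel) + 2 * (\<integral>\<^sup>+u. P g u \<omega> \<partial>lborel) \<partial>M)"
    using sec by (intro nn_integral_cong) (simp add: nn_integral_add nn_integral_cmult)
  also have "\<dots> = 2 * (\<integral>\<^sup>+\<omega>. (\<integral>\<^sup>+u. P f u \<omega> \<partial>lborel) \<partial>M) + 2 * (\<integral>\<^sup>+\<omega>. (\<integral>\<^sup>+u. P g u \<omega> \<partial>lborel) \<partial>M)"
    by (subst nn_integral_add) (auto simp: nn_integral_cmult)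
  finally show ?thesis by (simp add: P_def)
qed

section \<open>Passage to the limit: Ito integrals\<close>

context brownian
begin

lemma ito_gap_measurable:
  assumes H: "(\<lambda>(s, \<omega>). indicator {0..t} s * H s \<omega>) \<in> borel_measurable (lborel \<Otimes>\<^sub>M M)"
    and e: "elementary_process F k \<tau> e" and st: "s \<le> t"
  shows "(\<lambda>(u, \<omega>). indicator {0..s} u * (H u \<omega> - elementary_value k \<tau> e u \<omega>)) \<in> borel_measurable (lborel \<Otimes>\<^sub>M M)"
proof -
  note [measurable] = H elementary_value_measurable[OF e]
  have "(\<lambda>p. indicator {0..s} (fst p) * ((case p of (u, \<omega>) \<Rightarrow> indicator {0..t} u * H u \<omega>)
      - (case p of (u, \<omega>) \<Rightarrow> elementary_value k \<tau> e u \<omega>))) \<in> borel_measurable (lborel \<Otimes>\<^sub>M M)"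
    by measurable
  also have "(\<lambda>p. indicator {0..s} (fst p) * ((case p of (u, \<omega>) \<Rightarrow> indicator {0..t} u * H u \<omega>)
      - (case p of (u, \<omega>) \<Rightarrow> elementary_value k \<tau> e u \<omega>)))
      = (\<lambda>(u, \<omega>). indicator {0..s} u * (H u \<omega> - elementary_value k \<tau> e u \<omega>))"
    using st by (auto simp: indicator_def fun_eq_iff)
  finally show ?thesis .
qed

text \<open>\<open>I\<close> is an elementary integral plus an error that is square-integrable for
  some late index.\<close>

lemma ito_square_integrable:
  assumes "has_ito_integral M F W H t I" "0 \<le> t"
  shows "integrable M (\<lambda>\<omega>. (I \<omega>)\<^sup>2)"
proof -
  obtain k \<tau> e where e: "\<And>j. elementary_process F (k j) (\<tau> j) (e j)"
    and lim: "(\<lambda>j. \<integral>\<^sup>+\<omega>. ennreal ((I \<omega> - elementary_integral W (k j) (\<tau> j) (e j) t \<omega>)\<^sup>2) \<partial>M) \<longlonglongrightarrow> 0"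
    using assms unfolding has_ito_integral_def by blast
  have I [measurable]: "I \<in> borel_measurable M" using assms by (simp add: has_ito_integral_def)
  have m: "(\<lambda>\<omega>. I \<omega> - elementary_integral W (k j) (\<tau> j) (e j) t \<omega>) \<in> borel_measurable M" for j
    using elementary_integral_measurable[OF e assms(2)] by measurable
  obtain j where j: "integrable M (\<lambda>\<omega>. (I \<omega> - elementary_integral W (k j) (\<tau> j) (e j) t \<omega>)\<^sup>2)"
    using eventually_happens[OF nn_integral_square_tendsto_0(1)[OF m lim, of "\<lambda>_. 0"]] by auto
  show ?thesis
    using square_integrable_lincomb(1)[OF m elementary_integral_measurable[OF e assms(2)] j
        elementary_integral_square_integrable[OF e assms(2), of j], where r = 1] by simp
qed

text \<open>\<open>I\<close> and \<open>J\<close> come with unrelated approximating sequences.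
  Stopped at time \<open>s\<close>, the sequence for \<open>I\<close> also approximates
  \<open>J\<close>, since on \<open>{0..s}\<close> both sequences approach the same integrand and
  the isometry carries this over to the integrals.\<close>

lemma ito_increment_orthogonal:
  assumes I: "has_ito_integral M F W H t I" and J: "has_ito_integral M F W H s J" and st: "0 \<le> s" "s \<le> t"
    and Z: "Z \<in> borel_measurable (F s)" "integrable M (\<lambda>\<omega>. (Z \<omega>)\<^sup>2)"
  shows "expectation (\<lambda>\<omega>. (I \<omega> - J \<omega>) * Z \<omega>) = 0"
proof -
  have t: "0 \<le> t" using st by simp
  obtain k \<tau> e where e: "\<And>j. elementary_process F (k j) (\<tau> j) (e j)"
    and gap: "(\<lambda>j. \<integral>\<^sup>+\<omega>. (\<integral>\<^sup>+u\<in>{0..t}. ennreal ((H u \<omega> - elementary_value (k j) (\<tau> j) (e j) u \<omega>)\<^sup>2) \<partial>lborel) \<partial>M) \<longlonglongrightarrow> 0"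
    and lim: "(\<lambda>j. \<integral>\<^sup>+\<omega>. ennreal ((I \<omega> - elementary_integral W (k j) (\<tau> j) (e j) t \<omega>)\<^sup>2) \<partial>M) \<longlonglongrightarrow> 0"
    using I unfolding has_ito_integral_def by blast
  obtain k' \<tau>' e' where e': "\<And>j. elementary_process F (k' j) (\<tau>' j) (e' j)"
    and gap': "(\<lambda>j. \<integral>\<^sup>+\<omega>. (\<integral>\<^sup>+u\<in>{0..s}. ennreal ((H u \<omega> - elementary_value (k' j) (\<tau>' j) (e' j) u \<omega>)\<^sup>2) \<partial>lborel) \<partial>M) \<longlonglongrightarrow> 0"
    and lim': "(\<lambda>j. \<integral>\<^sup>+\<omega>. ennreal ((J \<omega> - elementary_integral W (k' j) (\<tau>' j) (e' j) s \<omega>)\<^sup>2) \<partial>M) \<longlonglongrightarrow> 0"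
    using J unfolding has_ito_integral_def by blast
  have [measurable]: "I \<in> borel_measurable M" "J \<in> borel_measurable M"
    and H: "(\<lambda>(s, \<omega>). indicator {0..t} s * H s \<omega>) \<in> borel_measurable (lborel \<Otimes>\<^sub>M M)"
    and H': "(\<lambda>(u, \<omega>). indicator {0..s} u * H u \<omega>) \<in> borel_measurable (lborel \<Otimes>\<^sub>M M)"
    using I J by (auto simp: has_ito_integral_def)
  have ZM [measurable]: "Z \<in> borel_measurable M" using Z(1) by (rule measurable_F)
  define S where "S j v = elementary_integral W (k j) (\<tau> j) (e j) v" for j v
  define S' where "S' j = elementary_integral W (k' j) (\<tau>' j) (e' j) s" for j
  have S [measurable]: "S j v \<in> borel_measurable M" if "0 \<le> v" for j v
    unfolding S_def by (rule elementary_integral_measurable[OF e that])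
  have S' [measurable]: "S' j \<in> borel_measurable M" for j
    unfolding S'_def by (rule elementary_integral_measurable[OF e' st(1)])
  have S2: "integrable M (\<lambda>\<omega>. (S j v \<omega>)\<^sup>2)" if "0 \<le> v" for j v
    unfolding S_def by (rule elementary_integral_square_integrable[OF e that])
  have S2': "integrable M (\<lambda>\<omega>. (S' j \<omega>)\<^sup>2)" for j
    unfolding S'_def by (rule elementary_integral_square_integrable[OF e' st(1)])
  \<comment> \<open>The isometry on \<open>{0..s}\<close> and the triangle inequality through
    \<open>H\<close>; the first window is then enlarged to \<open>{0..t}\<close>.\<close>
  have le: "(\<integral>\<^sup>+\<omega>. ennreal ((S j s \<omega> - S' j \<omega>)\<^sup>2) \<partial>M)
    \<le> 2 * (\<integral>\<^sup>+\<omega>. (\<integral>\<^sup>+u\<in>{0..t}. ennreal ((H u \<omega> - elementary_value (k j) (\<tau> j) (e j) u \<omega>)\<^sup>2) \<partial>lborel) \<partial>M)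
     + 2 * (\<integral>\<^sup>+\<omega>. (\<integral>\<^sup>+u\<in>{0..s}. ennreal ((H u \<omega> - elementary_value (k' j) (\<tau>' j) (e' j) u \<omega>)\<^sup>2) \<partial>lborel) \<partial>M)" for j
  proof -
    have "(\<integral>\<^sup>+\<omega>. ennreal ((S j s \<omega> - S' j \<omega>)\<^sup>2) \<partial>M)
      \<le> 2 * (\<integral>\<^sup>+\<omega>. (\<integral>\<^sup>+u\<in>{0..s}. ennreal ((H u \<omega> - elementary_value (k j) (\<tau> j) (e j) u \<omega>)\<^sup>2) \<partial>lborel) \<partial>M)
      + 2 * (\<integral>\<^sup>+\<omega>. (\<integral>\<^sup>+u\<in>{0..s}. ennreal ((H u \<omega> - elementary_value (k' j) (\<tau>' j) (e' j) u \<omega>)\<^sup>2) \<partial>lborel) \<partial>M)"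
      unfolding S_def S'_def elementary_isometry_diff[OF e e' st(1)]
      by (rule nn_integral_square_triangle[OF ito_gap_measurable[OF H e st(2)] ito_gap_measurable[OF H' e' order_refl]])
    also have "(\<integral>\<^sup>+\<omega>. (\<integral>\<^sup>+u\<in>{0..s}. ennreal ((H u \<omega> - elementary_value (k j) (\<tau> j) (e j) u \<omega>)\<^sup>2) \<partial>lborel) \<partial>M)
      \<le> (\<integral>\<^sup>+\<omega>. (\<integral>\<^sup>+u\<in>{0..t}. ennreal ((H u \<omega> - elementary_value (k j) (\<tau> j) (e j) u \<omega>)\<^sup>2) \<partial>lborel) \<partial>M)"
      using st by (intro nn_integral_mono mult_left_mono) (auto simp: indicator_def)
    finally show ?thesis by (simp add: add_right_mono mult_left_mono)
  qed
  have "(\<lambda>j. 2 * (\<integral>\<^sup>+\<omega>. (\<integral>\<^sup>+u\<in>{0..t}. ennreal ((H u \<omega> - elementary_value (k j) (\<tau> j) (e j) u \<omega>)\<^sup>2) \<partial>lborel) \<partial>M)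
     + 2 * (\<integral>\<^sup>+\<omega>. (\<integral>\<^sup>+u\<in>{0..s}. ennreal ((H u \<omega> - elementary_value (k' j) (\<tau>' j) (e' j) u \<omega>)\<^sup>2) \<partial>lborel) \<partial>M))
     \<longlonglongrightarrow> 2 * 0 + 2 * 0"
    by (intro tendsto_add ennreal_tendsto_cmult gap gap') auto
  note gaps = this[unfolded mult_zero_right add_0_left]
  have lim2: "(\<lambda>j. \<integral>\<^sup>+\<omega>. ennreal ((S j s \<omega> - S' j \<omega>)\<^sup>2) \<partial>M) \<longlonglongrightarrow> 0"
    by (rule tendsto_sandwich[OF always_eventually[OF allI] always_eventually[OF allI] tendsto_const gaps])
       (rule zero_le, rule le)
  have 1: "(\<lambda>j. expectation (\<lambda>\<omega>. (I \<omega> - S j t \<omega>) * Z \<omega>)) \<longlonglongrightarrow> 0"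
    by (rule nn_integral_square_tendsto_0(2)[OF _ _ ZM Z(2)]) (use lim t in \<open>auto simp: S_def[symmetric]\<close>)
  have 2: "(\<lambda>j. expectation (\<lambda>\<omega>. (S j s \<omega> - S' j \<omega>) * Z \<omega>)) \<longlonglongrightarrow> 0"
    by (rule nn_integral_square_tendsto_0(2)[OF _ lim2 ZM Z(2)]) (use st in auto)
  have 3: "(\<lambda>j. expectation (\<lambda>\<omega>. (J \<omega> - S' j \<omega>) * Z \<omega>)) \<longlonglongrightarrow> 0"
    by (rule nn_integral_square_tendsto_0(2)[OF _ _ ZM Z(2)]) (use lim' st in \<open>auto simp: S'_def[symmetric]\<close>)
  have lim3: "(\<lambda>j. expectation (\<lambda>\<omega>. (I \<omega> - S j t \<omega>) * Z \<omega>) + expectation (\<lambda>\<omega>. (S j s \<omega> - S' j \<omega>) * Z \<omega>)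
      - expectation (\<lambda>\<omega>. (J \<omega> - S' j \<omega>) * Z \<omega>)) \<longlonglongrightarrow> 0"
    using tendsto_diff[OF tendsto_add[OF 1 2] 3] by simp
  have mI: "integrable M (\<lambda>\<omega>. X \<omega> * Z \<omega>)" if "X \<in> borel_measurable M" "integrable M (\<lambda>\<omega>. (X \<omega>)\<^sup>2)" for X
    by (rule square_integrable_mult[OF that(1) ZM that(2) Z(2)])
  \<comment> \<open>The combination differs from the target by the elementary increment between
    \<open>s\<close> and \<open>t\<close>, which is orthogonal to \<open>Z\<close>. So a constant
    sequence tends to 0.\<close>
  have "expectation (\<lambda>\<omega>. (I \<omega> - S j t \<omega>) * Z \<omega>) + expectation (\<lambda>\<omega>. (S j s \<omega> - S' j \<omega>) * Z \<omega>)
      - expectation (\<lambda>\<omega>. (J \<omega> - S' j \<omega>) * Z \<omega>) = expectation (\<lambda>\<omega>. (I \<omega> - J \<omega>) * Z \<omega>)" for j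
  proof -
    have z: "expectation (\<lambda>\<omega>. (S j t \<omega> - S j s \<omega>) * Z \<omega>) = 0"
      unfolding S_def by (rule elementary_integral_increment_orthogonal[OF e st Z])
    show ?thesis
      using z mI[of I] mI[of J] mI[of "S j t"] mI[of "S j s"] mI[of "S' j"]
        ito_square_integrable[OF I t] ito_square_integrable[OF J st(1)] S2 S2' st t
      by (simp add: left_diff_distrib)
  qed
  then show ?thesis using lim3 by (simp add: LIMSEQ_const_iff)
qed

text \<open>If \<open>I\<close> vanishes, the elementary integrals tend to 0; by the isometry so do
  the elementary processes, whose limit is \<open>H\<close>.\<close>

lemma ito_integral_zero:
  assumes I: "has_ito_integral M F W H t I" and t: "0 \<le> t" and z: "AE \<omega> in M. I \<omega> = 0"
  shows "(\<integral>\<^sup>+\<omega>. (\<integral>\<^sup>+u\<in>{0..t}. ennreal ((H u \<omega>)\<^sup>2) \<partial>lborel) \<partial>M) = 0"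
proof -
  obtain k \<tau> e where e: "\<And>j. elementary_process F (k j) (\<tau> j) (e j)"
    and gap: "(\<lambda>j. \<integral>\<^sup>+\<omega>. (\<integral>\<^sup>+u\<in>{0..t}. ennreal ((H u \<omega> - elementary_value (k j) (\<tau> j) (e j) u \<omega>)\<^sup>2) \<partial>lborel) \<partial>M) \<longlonglongrightarrow> 0"
    and lim: "(\<lambda>j. \<integral>\<^sup>+\<omega>. ennreal ((I \<omega> - elementary_integral W (k j) (\<tau> j) (e j) t \<omega>)\<^sup>2) \<partial>M) \<longlonglongrightarrow> 0"
    using I unfolding has_ito_integral_def by blast
  have H: "(\<lambda>(s, \<omega>). indicator {0..t} s * H s \<omega>) \<in> borel_measurable (lborel \<Otimes>\<^sub>M M)"
    using I by (auto simp: has_ito_integral_def)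
  define v where "v j = elementary_value (k j) (\<tau> j) (e j)" for j
  have "(\<integral>\<^sup>+\<omega>. ennreal ((I \<omega> - elementary_integral W (k j) (\<tau> j) (e j) t \<omega>)\<^sup>2) \<partial>M)
      = (\<integral>\<^sup>+\<omega>. ennreal ((elementary_integral W (k j) (\<tau> j) (e j) t \<omega>)\<^sup>2) \<partial>M)" for j
    by (rule nn_integral_cong_AE) (use z in eventually_elim, simp)
  then have lim': "(\<lambda>j. \<integral>\<^sup>+\<omega>. (\<integral>\<^sup>+u\<in>{0..t}. ennreal ((v j u \<omega>)\<^sup>2) \<partial>lborel) \<partial>M) \<longlonglongrightarrow> 0"
    using lim by (simp add: elementary_isometry[OF e t] v_def)
  have le: "(\<integral>\<^sup>+\<omega>. (\<integral>\<^sup>+u\<in>{0..t}. ennreal ((H u \<omega>)\<^sup>2) \<partial>lborel) \<partial>M)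
      \<le> 2 * (\<integral>\<^sup>+\<omega>. (\<integral>\<^sup>+u\<in>{0..t}. ennreal ((H u \<omega> - v j u \<omega>)\<^sup>2) \<partial>lborel) \<partial>M)
        + 2 * (\<integral>\<^sup>+\<omega>. (\<integral>\<^sup>+u\<in>{0..t}. ennreal ((v j u \<omega>)\<^sup>2) \<partial>lborel) \<partial>M)" for j
  proof -
    have "(\<lambda>p. - (case p of (u, \<omega>) \<Rightarrow> indicator {0..t} u * (H u \<omega> - v j u \<omega>))) \<in> borel_measurable (lborel \<Otimes>\<^sub>M M)"
      unfolding v_def by (intro borel_measurable_uminus ito_gap_measurable[OF H e order_refl])
    also have "(\<lambda>p. - (case p of (u, \<omega>) \<Rightarrow> indicator {0..t} u * (H u \<omega> - v j u \<omega>)))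
        = (\<lambda>(u, \<omega>). indicator {0..t} u * (v j u \<omega> - H u \<omega>))"
      by (auto simp: fun_eq_iff algebra_simps)
    finally have m1: "(\<lambda>(u, \<omega>). indicator {0..t} u * (v j u \<omega> - H u \<omega>)) \<in> borel_measurable (lborel \<Otimes>\<^sub>M M)" .
    have "(\<lambda>p. indicator {0..t} (fst p) * (case p of (u, \<omega>) \<Rightarrow> v j u \<omega>)) \<in> borel_measurable (lborel \<Otimes>\<^sub>M M)"
      unfolding v_def using elementary_value_measurable[OF e, of j] by measurable
    also have "(\<lambda>p. indicator {0..t} (fst p) * (case p of (u, \<omega>) \<Rightarrow> v j u \<omega>)) = (\<lambda>(u, \<omega>). indicator {0..t} u * (v j u \<omega> - 0))"
      by auto
    finally have m2: "(\<lambda>(u, \<omega>). indicator {0..t} u * (v j u \<omega> - 0)) \<in> borel_measurable (lborel \<Otimes>\<^sub>M M)" .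
    \<comment> \<open>The intermediate function is \<open>v j\<close>; the endpoints are
      \<open>H\<close> and the zero process, hence the explicit \<open>- 0\<close> above.\<close>
    show ?thesis using nn_integral_square_triangle[OF m1 m2] by (simp add: power2_commute[of "v j _ _"])
  qed
  have "(\<lambda>j. 2 * (\<integral>\<^sup>+\<omega>. (\<integral>\<^sup>+u\<in>{0..t}. ennreal ((H u \<omega> - v j u \<omega>)\<^sup>2) \<partial>lborel) \<partial>M)
        + 2 * (\<integral>\<^sup>+\<omega>. (\<integral>\<^sup>+u\<in>{0..t}. ennreal ((v j u \<omega>)\<^sup>2) \<partial>lborel) \<partial>M)) \<longlonglongrightarrow> 2 * 0 + 2 * 0"
    by (intro tendsto_add ennreal_tendsto_cmult gap[folded v_def] lim') auto
  from LIMSEQ_le_const[OF this] le show ?thesis by simp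
qed

end

section \<open>Evaluation of a process at a random time\<close>

text \<open>The least multiple of \<open>1 / (n + 1)\<close> strictly above \<open>max 0 t\<close>.
  Being strictly above, it approaches from the right, so right-continuity is the only path property
  used.\<close>

definition right_grid :: "nat \<Rightarrow> real \<Rightarrow> real" where
  "right_grid n t = (real_of_int \<lfloor>real (Suc n) * max 0 t\<rfloor> + 1) / real (Suc n)"

lemma right_grid_gt: "max 0 t < right_grid n t"
proof -
  have "real (Suc n) * max 0 t < real_of_int \<lfloor>real (Suc n) * max 0 t\<rfloor> + 1" by linarith
  then have "max 0 t * real (Suc n) < real_of_int \<lfloor>real (Suc n) * max 0 t\<rfloor> + 1" by (simp only: mult.commute)
  then show ?thesis unfolding right_grid_def by (simp only: pos_less_divide_eq of_nat_0_less_iff zero_less_Suc)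
qed

lemma right_grid_le: "right_grid n t \<le> max 0 t + 1 / real (Suc n)"
proof -
  have "real_of_int \<lfloor>real (Suc n) * max 0 t\<rfloor> + 1 \<le> real (Suc n) * max 0 t + 1" by linarith
  then show ?thesis by (simp add: right_grid_def field_simps del: of_nat_Suc)
qed

lemma right_grid_tendsto: "filterlim (\<lambda>n. right_grid n t) (at_right (max 0 t)) sequentially"
proof (rule tendsto_imp_filterlim_at_right)
  have "(\<lambda>n. max 0 t + 1 / real (Suc n)) \<longlonglongrightarrow> max 0 t + 0"
    by (intro tendsto_add tendsto_const LIMSEQ_Suc[OF lim_1_over_n])
  then have l: "(\<lambda>n. max 0 t + 1 / real (Suc n)) \<longlonglongrightarrow> max 0 t" by simp
  show "(\<lambda>n. right_grid n t) \<longlonglongrightarrow> max 0 t"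
    by (rule tendsto_sandwich[OF always_eventually[OF allI] always_eventually[OF allI] tendsto_const l])
       (rule less_imp_le[OF right_grid_gt], rule right_grid_le)
qed (intro always_eventually allI right_grid_gt)

text \<open>The grid takes countably many values, so the random evaluation is glued from countably
  many fixed times.\<close>

lemma right_grid_process_measurable:
  fixes X :: "real \<Rightarrow> 'a \<Rightarrow> real"
  assumes X: "\<And>t. 0 \<le> t \<Longrightarrow> X t \<in> borel_measurable M"
  shows "(\<lambda>p. X (right_grid n (fst p)) (snd p)) \<in> borel_measurable (borel \<Otimes>\<^sub>M M)"
proof -
  \<comment> \<open>Gluing demands measurability for every integer index, including negative ones;
    the outer \<open>max 0\<close> keeps all times in the range where \<open>X\<close> is measurable
    and changes no actual value.\<close>
  have "(\<lambda>p. X (max 0 ((real_of_int \<lfloor>real (Suc n) * max 0 (fst p)\<rfloor> + 1) / real (Suc n))) (snd p)) \<in> borel_measurable (borel \<Otimes>\<^sub>M M)"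
  proof (rule measurable_compose_countable[where f = "\<lambda>i p. X (max 0 ((real_of_int i + 1) / real (Suc n))) (snd p)"
        and g = "\<lambda>p. \<lfloor>real (Suc n) * max 0 (fst p)\<rfloor>"])
    show "(\<lambda>p. X (max 0 ((real_of_int i + 1) / real (Suc n))) (snd p)) \<in> borel_measurable (borel \<Otimes>\<^sub>M M)" for i
      using X[of "max 0 ((real_of_int i + 1) / real (Suc n))"] by measurable
    show "(\<lambda>p. \<lfloor>real (Suc n) * max 0 (fst p)\<rfloor>) \<in> borel \<Otimes>\<^sub>M M \<rightarrow>\<^sub>M count_space UNIV"
      by measurable
  qed
  moreover have "max 0 ((real_of_int \<lfloor>real (Suc n) * max 0 t\<rfloor> + 1) / real (Suc n)) = right_grid n t" for t
    using right_grid_gt[of t n] unfolding right_grid_def by linarith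
  ultimately show ?thesis by simp
qed

lemma right_grid_process_tendsto:
  fixes f :: "real \<Rightarrow> real"
  assumes "continuous (at_right (max 0 t)) f"
  shows "(\<lambda>n. f (right_grid n t)) \<longlonglongrightarrow> f (max 0 t)"
  using assms by (intro filterlim_compose[OF _ right_grid_tendsto]) (simp add: continuous_within)

text \<open>Joint measurability, the entry ticket to Fubini for the diffusion and for the
  subordinator. \<open>max 0 t\<close> extends paths to negative times.\<close>

lemma right_continuous_process_measurable:
  fixes X :: "real \<Rightarrow> 'a \<Rightarrow> real"
  assumes X: "\<And>t. 0 \<le> t \<Longrightarrow> X t \<in> borel_measurable M"
    and rc: "\<And>t \<omega>. 0 \<le> t \<Longrightarrow> \<omega> \<in> space M \<Longrightarrow> continuous (at_right t) (\<lambda>t. X t \<omega>)"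
  shows "(\<lambda>(t, \<omega>). X (max 0 t) \<omega>) \<in> borel_measurable (borel \<Otimes>\<^sub>M M)"
proof (rule borel_measurable_LIMSEQ_real)
  show "(\<lambda>p. X (right_grid n (fst p)) (snd p)) \<in> borel_measurable (borel \<Otimes>\<^sub>M M)" for n
    by (rule right_grid_process_measurable[OF X])
  show "(\<lambda>n. X (right_grid n (fst p)) (snd p)) \<longlonglongrightarrow> (case p of (t, \<omega>) \<Rightarrow> X (max 0 t) \<omega>)"
    if "p \<in> space (borel \<Otimes>\<^sub>M M)" for p
    using right_grid_process_tendsto[OF rc[of "max 0 (fst p)" "snd p"]] that by (auto simp: space_pair_measure)
qed

lemma continuous_on_at_right:
  assumes "continuous_on {0..} f" "0 \<le> (t::real)"
  shows "continuous (at_right t) f"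
  using assms continuous_within_subset[of t "{0..}" f "{t<..}"] by (force simp: continuous_on_eq_continuous_within)

text \<open>Evaluation of a path at a random time is not measurable on the product space over
  \<open>{0..}\<close>; the limit along \<open>right_grid\<close> only looks at countably many coordinates and agrees with
  evaluation on right-continuous paths.\<close>

definition path_eval :: "real \<Rightarrow> (real \<Rightarrow> real) \<Rightarrow> real" where
  "path_eval t x = lim (\<lambda>n. x (right_grid n t))"

lemma path_eval_measurable:
  "(\<lambda>(t, x). path_eval t x) \<in> borel_measurable (borel \<Otimes>\<^sub>M (\<Pi>\<^sub>M t\<in>{0..}. borel))"
proof -
  \<comment> \<open>The coordinate process on path space. The product has only nonnegative indices,
    hence the default 0 elsewhere.\<close>
  have "(\<lambda>p. (\<lambda>t x. if 0 \<le> t then x t else 0) (right_grid n (fst p)) (snd p))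
      \<in> borel_measurable (borel \<Otimes>\<^sub>M (\<Pi>\<^sub>M t\<in>{0..}. borel :: real measure))" for n
    by (rule right_grid_process_measurable) (auto intro!: measurable_component_singleton)
  moreover have "0 \<le> right_grid n t" for n t using right_grid_gt[of t n] by simp
  ultimately have [measurable]: "(\<lambda>p. snd p (right_grid n (fst p))) \<in> borel_measurable (borel \<Otimes>\<^sub>M (\<Pi>\<^sub>M t\<in>{0..}. borel :: real measure))" for n
    by simp
  show ?thesis unfolding path_eval_def case_prod_beta by measurable
qed

lemma path_eval_eq:
  assumes "continuous_on {0..} (x :: real \<Rightarrow> real)" "0 \<le> t"
  shows "path_eval t (\<lambda>t\<in>{0..}. x t) = x t"
proof -
  have "(\<lambda>n. x (right_grid n t)) \<longlonglongrightarrow> x (max 0 t)"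
    using assms by (intro right_grid_process_tendsto continuous_on_at_right) auto
  moreover have "0 \<le> right_grid n t" for n t using right_grid_gt[of t n] by simp
  ultimately show ?thesis using assms(2) unfolding path_eval_def by (auto intro: limI)
qed

text \<open>The substitute for conditioning on \<open>E\<close>: independence makes the law of the
  two path maps a product, and Fubini lets the diffusion run on an independent copy
  \<open>\<omega>'\<close> with the times frozen at \<open>\<omega>\<close>.\<close>

lemma (in prob_space) time_change_expectation:
  fixes X E :: "real \<Rightarrow> 'a \<Rightarrow> real" and g :: "real \<times> real \<Rightarrow> real"
  assumes ind: "indep_processes M E X"
    and cont: "\<And>\<omega>. \<omega> \<in> space M \<Longrightarrow> continuous_on {0..} (\<lambda>t. X t \<omega>)"
    and E: "\<And>t \<omega>. 0 \<le> t \<Longrightarrow> \<omega> \<in> space M \<Longrightarrow> 0 \<le> E t \<omega>"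
    and g [measurable]: "g \<in> borel_measurable borel"
    and bound: "\<And>u v. 0 \<le> u \<Longrightarrow> 0 \<le> v \<Longrightarrow> (\<integral>\<^sup>+\<omega>. ennreal \<bar>g (X u \<omega>, X v \<omega>)\<bar> \<partial>M) \<le> B" and B: "B < \<infinity>"
    and t: "0 \<le> t" "0 \<le> s"
  shows "integrable M (\<lambda>\<omega>. g (X (E t \<omega>) \<omega>, X (E s \<omega>) \<omega>))"
    and "expectation (\<lambda>\<omega>. g (X (E t \<omega>) \<omega>, X (E s \<omega>) \<omega>))
      = expectation (\<lambda>\<omega>. expectation (\<lambda>\<omega>'. g (X (E t \<omega>) \<omega>', X (E s \<omega>) \<omega>')))"
proof -
  define P :: "(real \<Rightarrow> real) measure" where "P = (\<Pi>\<^sub>M t\<in>{0..}. borel :: real measure)"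
  define Y Z where "Y \<omega> = (\<lambda>t\<in>{0..}. E t \<omega>)" and "Z \<omega> = (\<lambda>t\<in>{0..}. X t \<omega>)" for \<omega>
  have iv: "indep_var P Y P Z" using ind by (simp add: indep_processes_def P_def Y_def[abs_def] Z_def[abs_def])
  note [measurable] = indep_var_rv1[OF iv] indep_var_rv2[OF iv]
  have prod: "distr M P Y \<Otimes>\<^sub>M distr M P Z = distr M (P \<Otimes>\<^sub>M P) (\<lambda>\<omega>. (Y \<omega>, Z \<omega>))"
    using iv by (simp add: indep_var_distribution_eq)
  interpret Y: prob_space "distr M P Y" by (rule prob_space_distr) measurable
  interpret Z: prob_space "distr M P Z" by (rule prob_space_distr) measurable
  interpret YZ: pair_prob_space "distr M P Y" "distr M P Z" ..
  have comp [measurable]: "(\<lambda>y. y r) \<in> borel_measurable P" if "0 \<le> r" for r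
    unfolding P_def using that by (intro measurable_component_singleton) auto
  have ev [measurable]: "(\<lambda>p. path_eval (fst p) (snd p)) \<in> borel_measurable (borel \<Otimes>\<^sub>M P)"
    using path_eval_measurable by (simp add: P_def case_prod_beta)
  \<comment> \<open>\<open>path_eval\<close> makes this a measurable function of the pair of paths;
    along the actual paths it is ordinary evaluation by continuity.\<close>
  define G where "G p = g (path_eval (fst p t) (snd p), path_eval (fst p s) (snd p))" for p
  have evr: "(\<lambda>p. path_eval (fst p r) (snd p)) \<in> borel_measurable (P \<Otimes>\<^sub>M P)" if "0 \<le> r" for r
  proof -
    have "(\<lambda>p. (fst p r, snd p)) \<in> P \<Otimes>\<^sub>M P \<rightarrow>\<^sub>M borel \<Otimes>\<^sub>M P" using comp[OF that] by measurable
    from measurable_compose[OF this ev] show ?thesis by simp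
  qed
  have G [measurable]: "G \<in> borel_measurable (P \<Otimes>\<^sub>M P)"
  proof -
    have "(\<lambda>p. (path_eval (fst p t) (snd p), path_eval (fst p s) (snd p))) \<in> borel_measurable (P \<Otimes>\<^sub>M P)"
      using evr[OF t(1)] evr[OF t(2)] by (rule borel_measurable_Pair)
    from measurable_compose[OF this g] show ?thesis by (simp add: G_def[abs_def])
  qed
  have sec: "(\<lambda>z. G (y, z)) \<in> borel_measurable P" if "y \<in> space P" for y
    using that by measurable
  have GYZ: "G (Y \<omega>, Z \<omega>') = g (X (E t \<omega>) \<omega>', X (E s \<omega>) \<omega>')" if "\<omega> \<in> space M" "\<omega>' \<in> space M" for \<omega> \<omega>'
    using that t E cont by (simp add: G_def Y_def Z_def path_eval_eq)
  have YP: "Y \<omega> \<in> space P" if "\<omega> \<in> space M" for \<omega> using measurable_space[OF indep_var_rv1[OF iv] that] .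
  \<comment> \<open>The bound is uniform over deterministic times, so it survives averaging over the
    law of \<open>E\<close>.\<close>
  have "(\<integral>\<^sup>+p. ennreal \<bar>G p\<bar> \<partial>(distr M P Y \<Otimes>\<^sub>M distr M P Z))
      = (\<integral>\<^sup>+y. (\<integral>\<^sup>+z. ennreal \<bar>G (y, z)\<bar> \<partial>distr M P Z) \<partial>distr M P Y)"
    by (subst Z.nn_integral_fst[symmetric]) (auto simp: measurable_cong_sets[OF sets_pair_measure_cong[OF sets_distr sets_distr]])
  also have "\<dots> \<le> (\<integral>\<^sup>+y. B \<partial>distr M P Y)"
    unfolding nn_integral_distr[OF indep_var_rv1[OF iv] borel_measurable_const] 
  proof (subst nn_integral_distr)
    show "(\<lambda>y. \<integral>\<^sup>+z. ennreal \<bar>G (y, z)\<bar> \<partial>distr M P Z) \<in> borel_measurable (distr M P Y)"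
      by (intro Z.borel_measurable_nn_integral_fst[where f = "\<lambda>p. ennreal \<bar>G p\<bar>", simplified])
         (auto simp: measurable_cong_sets[OF sets_pair_measure_cong[OF sets_distr sets_distr]])
    show "(\<integral>\<^sup>+\<omega>. (\<integral>\<^sup>+z. ennreal \<bar>G (Y \<omega>, z)\<bar> \<partial>distr M P Z) \<partial>M) \<le> (\<integral>\<^sup>+\<omega>. B \<partial>M)"
    proof (rule nn_integral_mono)
      fix \<omega> assume \<omega>: "\<omega> \<in> space M"
      have "(\<integral>\<^sup>+z. ennreal \<bar>G (Y \<omega>, z)\<bar> \<partial>distr M P Z) = (\<integral>\<^sup>+\<omega>'. ennreal \<bar>G (Y \<omega>, Z \<omega>')\<bar> \<partial>M)"
        using sec[OF YP[OF \<omega>]] by (subst nn_integral_distr) auto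
      also have "\<dots> = (\<integral>\<^sup>+\<omega>'. ennreal \<bar>g (X (E t \<omega>) \<omega>', X (E s \<omega>) \<omega>')\<bar> \<partial>M)"
        using GYZ[OF \<omega>] by (intro nn_integral_cong) simp
      also have "\<dots> \<le> B" using E t \<omega> by (intro bound) auto
      finally show "(\<integral>\<^sup>+z. ennreal \<bar>G (Y \<omega>, z)\<bar> \<partial>distr M P Z) \<le> B" .
    qed
  qed (use indep_var_rv1[OF iv] in auto)
  also have "\<dots> < \<infinity>" using B Y.emeasure_space_1 by simp
  finally have int: "integrable (distr M P Y \<Otimes>\<^sub>M distr M P Z) G"
    by (intro integrableI_bounded) (auto simp: measurable_cong_sets[OF sets_pair_measure_cong[OF sets_distr sets_distr]])
  have YZm: "(\<lambda>\<omega>. (Y \<omega>, Z \<omega>)) \<in> M \<rightarrow>\<^sub>M P \<Otimes>\<^sub>M P" by measurable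
  have int': "integrable M (\<lambda>\<omega>. G (Y \<omega>, Z \<omega>))"
    using int unfolding prod by (subst (asm) integrable_distr_eq[OF YZm]) auto
  then show "integrable M (\<lambda>\<omega>. g (X (E t \<omega>) \<omega>, X (E s \<omega>) \<omega>))"
    by (rule Bochner_Integration.integrable_cong[THEN iffD1, rotated -1]) (auto simp: GYZ)
  have "expectation (\<lambda>\<omega>. g (X (E t \<omega>) \<omega>, X (E s \<omega>) \<omega>)) = expectation (\<lambda>\<omega>. G (Y \<omega>, Z \<omega>))"
    by (rule Bochner_Integration.integral_cong) (auto simp: GYZ)
  also have "\<dots> = (\<integral>p. G p \<partial>(distr M P Y \<Otimes>\<^sub>M distr M P Z))"
    unfolding prod by (subst integral_distr[OF YZm]) auto
  also have "\<dots> = (\<integral>y. (\<integral>z. G (y, z) \<partial>distr M P Z) \<partial>distr M P Y)"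
    by (rule YZ.integral_fst'[OF int, symmetric])
  also have "\<dots> = expectation (\<lambda>\<omega>. (\<integral>z. G (Y \<omega>, z) \<partial>distr M P Z))"
  proof (rule integral_distr)
    show "(\<lambda>y. \<integral>z. G (y, z) \<partial>distr M P Z) \<in> borel_measurable P"
      using borel_measurable_integrable[OF YZ.integrable_fst'[OF int]] by simp
  qed measurable
  also have "\<dots> = expectation (\<lambda>\<omega>. expectation (\<lambda>\<omega>'. g (X (E t \<omega>) \<omega>', X (E s \<omega>) \<omega>')))"
  proof (rule Bochner_Integration.integral_cong[OF refl])
    fix \<omega> assume \<omega>: "\<omega> \<in> space M"
    have "(\<integral>z. G (Y \<omega>, z) \<partial>distr M P Z) = expectation (\<lambda>\<omega>'. G (Y \<omega>, Z \<omega>'))"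
      using sec[OF YP[OF \<omega>]] by (subst integral_distr) auto
    also have "\<dots> = expectation (\<lambda>\<omega>'. g (X (E t \<omega>) \<omega>', X (E s \<omega>) \<omega>'))"
      using GYZ[OF \<omega>] by (intro Bochner_Integration.integral_cong) auto
    finally show "(\<integral>z. G (Y \<omega>, z) \<partial>distr M P Z) = expectation (\<lambda>\<omega>'. g (X (E t \<omega>) \<omega>', X (E s \<omega>) \<omega>'))" .
  qed
  finally show "expectation (\<lambda>\<omega>. g (X (E t \<omega>) \<omega>, X (E s \<omega>) \<omega>))
      = expectation (\<lambda>\<omega>. expectation (\<lambda>\<omega>'. g (X (E t \<omega>) \<omega>', X (E s \<omega>) \<omega>')))" .
qed

section \<open>Covariance of a stationary Pearson diffusion\<close>

text \<open>The integral equation first gives continuity of \<open>f\<close>, then differentiability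
  with \<open>f' = a * f\<close>; the factor \<open>exp (- a * (u - s))\<close> makes the product
  constant.\<close>

lemma linear_integral_equation:
  fixes f :: "real \<Rightarrow> real"
  assumes int: "\<And>t. s \<le> t \<Longrightarrow> set_integrable lborel {s..t} (\<lambda>u. a * f u)"
    and eq: "\<And>t. s \<le> t \<Longrightarrow> f t = f s + (LINT u:{s..t}|lborel. a * f u)"
    and t: "s \<le> t"
  shows "f t = f s * exp (a * (t - s))"
proof -
  have eq': "f u = f s + integral {s..u} (\<lambda>u. a * f u)" if "u \<in> {s..t}" for u
    using eq[of u] set_borel_integral_eq_integral(2)[OF int[of u]] that by simp
  have "continuous_on {s..t} (\<lambda>u. f s + integral {s..u} (\<lambda>u. a * f u))"
    using set_borel_integral_eq_integral(1)[OF int[OF t]]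
    by (intro continuous_intros indefinite_integral_continuous_1)
  then have c: "continuous_on {s..t} f"
    by (rule continuous_on_eq) (rule eq'[symmetric])
  have der: "(f has_real_derivative a * f x) (at x within {s..t})" if x: "x \<in> {s..t}" for x
  proof -
    have "((\<lambda>u. integral {s..u} (\<lambda>u. a * f u)) has_real_derivative a * f x) (at x within {s..t})"
      unfolding has_real_derivative_iff_has_vector_derivative
      using c x by (intro integral_has_vector_derivative continuous_intros)
    from DERIV_add[OF DERIV_const[of "f s"] this]
    have "((\<lambda>u. f s + integral {s..u} (\<lambda>u. a * f u)) has_real_derivative a * f x) (at x within {s..t})"
      by (simp only: add_0_left)
    then show ?thesis
      by (rule has_field_derivative_transform_within[OF _ zero_less_one x]) (rule eq'[symmetric])
  qed
  have "((\<lambda>u. f u * exp (- a * (u - s))) has_real_derivative 0) (at x within {s..t})" if x: "x \<in> {s..t}" for x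
  proof -
    have "((\<lambda>u. exp (- a * (u - s))) has_real_derivative - a * exp (- a * (x - s))) (at x within {s..t})"
      by (auto intro!: derivative_eq_intros)
    from DERIV_mult[OF der[OF x] this] show ?thesis by (simp add: mult_ac)
  qed
  then have "\<exists>k. \<forall>x\<in>{s..t}. f x * exp (- a * (x - s)) = k"
    by (intro has_field_derivative_zero_constant) (rule convex_real_interval)
  then obtain k where k: "\<And>x. x \<in> {s..t} \<Longrightarrow> f x * exp (- a * (x - s)) = k" by blast
  from k[of s] k[of t] t have "f t * exp (- a * (t - s)) = f s" by simp
  then have "f t * (exp (- a * (t - s)) * exp (a * (t - s))) = f s * exp (a * (t - s))" by (simp only: mult.assoc[symmetric])
  then show ?thesis by (simp add: exp_add[symmetric])
qed

section \<open>First and second moments of stationary solutions with affine drift\<close>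

context brownian
begin

text \<open>Stationarity enters as constancy of moments: the second moment \<open>S2\<close> here,
  the mean in the inner context.\<close>

context
  fixes a0 a1 :: real and \<sigma> :: "real \<Rightarrow> real" and X :: "real \<Rightarrow> 'a \<Rightarrow> real" and S2 :: real
  assumes sol: "sde_solution M F W (\<lambda>x. a0 + a1 * x) \<sigma> X"
    and sq: "\<And>t. 0 \<le> t \<Longrightarrow> integrable M (\<lambda>\<omega>. (X t \<omega>)\<^sup>2)"
    and S2: "\<And>t. 0 \<le> t \<Longrightarrow> expectation (\<lambda>\<omega>. (X t \<omega>)\<^sup>2) = S2"
begin

lemma solution_F: "0 \<le> t \<Longrightarrow> X t \<in> borel_measurable (F t)"
  using sol by (simp add: sde_solution_def)

lemma solution_M: "0 \<le> t \<Longrightarrow> X t \<in> borel_measurable M"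
  using solution_F measurable_F by blast

lemma solution_continuous: "\<omega> \<in> space M \<Longrightarrow> continuous_on {0..} (\<lambda>t. X t \<omega>)"
  using sol by (simp add: sde_solution_def)

lemma solution_joint: "(\<lambda>(t, \<omega>). X (max 0 t) \<omega>) \<in> borel_measurable (borel \<Otimes>\<^sub>M M)"
  by (rule right_continuous_process_measurable)
     (auto intro: solution_M continuous_on_at_right solution_continuous)

text \<open>One version of the stochastic integral is chosen for each time separately. No path
  regularity in \<open>t\<close> is claimed; the orthogonality result compares two times
  only.\<close>

lemma solution_ito:
  obtains I where "\<And>t. 0 \<le> t \<Longrightarrow> has_ito_integral M F W (\<lambda>s \<omega>. \<sigma> (X s \<omega>)) t (I t)"
    "\<And>t. 0 \<le> t \<Longrightarrow> AE \<omega> in M. X t \<omega> = X 0 \<omega> + (LINT s:{0..t}|lborel. a0 + a1 * X s \<omega>) + I t \<omega>"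
proof -
  have "\<forall>t. \<exists>I. 0 \<le> t \<longrightarrow> has_ito_integral M F W (\<lambda>s \<omega>. \<sigma> (X s \<omega>)) t I \<and>
      (AE \<omega> in M. X t \<omega> = X 0 \<omega> + (LINT s:{0..t}|lborel. a0 + a1 * X s \<omega>) + I \<omega>)"
    using sol unfolding sde_solution_def by blast
  from choice[OF this] show ?thesis using that by blast
qed

lemma drift_increment:
  assumes \<omega>: "\<omega> \<in> space M" and st: "0 \<le> s" "s \<le> t"
  shows "(LINT u:{0..t}|lborel. a0 + a1 * X u \<omega>) - (LINT u:{0..s}|lborel. a0 + a1 * X u \<omega>)
    = (LINT u:{s..t}|lborel. a0 + a1 * X u \<omega>)"
proof -
  have c: "continuous_on {u..v} (\<lambda>u. a0 + a1 * X u \<omega>)" if "0 \<le> u" for u v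
    using that by (intro continuous_intros continuous_on_subset[OF solution_continuous[OF \<omega>]]) auto
  have "integral {0..s} (\<lambda>u. a0 + a1 * X u \<omega>) + integral {s..t} (\<lambda>u. a0 + a1 * X u \<omega>)
      = integral {0..t} (\<lambda>u. a0 + a1 * X u \<omega>)"
    using st c by (intro Henstock_Kurzweil_Integration.integral_combine integrable_continuous_real) auto
  then show ?thesis
    using st c by (simp add: set_borel_integral_eq_integral(2)[OF borel_integrable_atLeastAtMost'])
qed

text \<open>The bound comes from \<open>|x * z| \<le> x\<^sup>2 + z\<^sup>2\<close> and a squared
  sum. It does not depend on \<open>u\<close>, which is what Fubini over a bounded time interval
  requires.\<close>

lemma drift_product_bound:
  assumes u: "0 \<le> u" and Z [measurable]: "Z \<in> borel_measurable M" and Z2: "integrable M (\<lambda>\<omega>. (Z \<omega>)\<^sup>2)"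
  shows "integrable M (\<lambda>\<omega>. (a0 + a1 * X u \<omega>) * Z \<omega>)"
    and "expectation (\<lambda>\<omega>. \<bar>(a0 + a1 * X u \<omega>) * Z \<omega>\<bar>)
      \<le> 2 * a0\<^sup>2 + 2 * a1\<^sup>2 * S2 + expectation (\<lambda>\<omega>. (Z \<omega>)\<^sup>2)"
proof -
  note [measurable] = solution_M[OF u]
  have Zi: "integrable M Z" using square_integrable_mult[OF Z _ Z2, of "\<lambda>_. 1"] by simp
  have "integrable M (\<lambda>\<omega>. a0 * Z \<omega> + a1 * (X u \<omega> * Z \<omega>))"
    using Zi square_integrable_mult[OF solution_M[OF u] Z sq[OF u] Z2] by simp
  also have "(\<lambda>\<omega>. a0 * Z \<omega> + a1 * (X u \<omega> * Z \<omega>)) = (\<lambda>\<omega>. (a0 + a1 * X u \<omega>) * Z \<omega>)"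
    by (simp add: algebra_simps)
  finally show i: "integrable M (\<lambda>\<omega>. (a0 + a1 * X u \<omega>) * Z \<omega>)" .
  have "\<bar>(a0 + a1 * x) * z\<bar> \<le> 2 * a0\<^sup>2 + 2 * a1\<^sup>2 * x\<^sup>2 + z\<^sup>2" for x z
  proof -
    have "\<bar>(a0 + a1 * x) * z\<bar> \<le> (a0 + a1 * x)\<^sup>2 + z\<^sup>2"
      using sum_squares_bound[of "\<bar>a0 + a1 * x\<bar>" "\<bar>z\<bar>"] mult_nonneg_nonneg[OF abs_ge_zero[of "a0 + a1 * x"] abs_ge_zero[of z]]
      unfolding power2_abs abs_mult by linarith
    also have "(a0 + a1 * x)\<^sup>2 \<le> 2 * a0\<^sup>2 + 2 * a1\<^sup>2 * x\<^sup>2"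
      using zero_le_power2[of "a0 - a1 * x"] by (simp add: power2_eq_square algebra_simps)
    finally show ?thesis by simp
  qed
  then have "expectation (\<lambda>\<omega>. \<bar>(a0 + a1 * X u \<omega>) * Z \<omega>\<bar>)
      \<le> expectation (\<lambda>\<omega>. 2 * a0\<^sup>2 + 2 * a1\<^sup>2 * (X u \<omega>)\<^sup>2 + (Z \<omega>)\<^sup>2)"
    using i sq[OF u] Z2 by (intro integral_mono integrable_abs Bochner_Integration.integrable_add integrable_mult_right) auto
  also have "\<dots> = 2 * a0\<^sup>2 + 2 * a1\<^sup>2 * S2 + expectation (\<lambda>\<omega>. (Z \<omega>)\<^sup>2)"
    using sq[OF u] Z2 S2[OF u] by (simp add: prob_space)
  finally show "expectation (\<lambda>\<omega>. \<bar>(a0 + a1 * X u \<omega>) * Z \<omega>\<bar>)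
      \<le> 2 * a0\<^sup>2 + 2 * a1\<^sup>2 * S2 + expectation (\<lambda>\<omega>. (Z \<omega>)\<^sup>2)" .
qed

lemma expectation_drift_integral:
  assumes st: "0 \<le> s" "s \<le> t" and Z [measurable]: "Z \<in> borel_measurable M" and Z2: "integrable M (\<lambda>\<omega>. (Z \<omega>)\<^sup>2)"
  shows "set_integrable lborel {s..t} (\<lambda>u. expectation (\<lambda>\<omega>. (a0 + a1 * X u \<omega>) * Z \<omega>))"
    and "integrable M (\<lambda>\<omega>. (LINT u:{s..t}|lborel. a0 + a1 * X u \<omega>) * Z \<omega>)"
    and "expectation (\<lambda>\<omega>. (LINT u:{s..t}|lborel. a0 + a1 * X u \<omega>) * Z \<omega>)
      = (LINT u:{s..t}|lborel. expectation (\<lambda>\<omega>. (a0 + a1 * X u \<omega>) * Z \<omega>))"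
proof -
  interpret L: pair_sigma_finite lborel M ..
  define f where "f p = indicator {s..t} (fst p) * ((a0 + a1 * X (max 0 (fst p)) (snd p)) * Z (snd p))" for p :: "real \<times> 'a"
  have f_eq: "f (u, \<omega>) = indicator {s..t} u * ((a0 + a1 * X u \<omega>) * Z \<omega>)" for u \<omega>
    using st by (auto simp: f_def indicator_def)
  have [measurable]: "f \<in> borel_measurable (lborel \<Otimes>\<^sub>M M)"
  proof -
    have [measurable]: "(\<lambda>p. X (max 0 (fst p)) (snd p)) \<in> borel_measurable (lborel \<Otimes>\<^sub>M M)"
      using solution_joint by (simp add: case_prod_beta measurable_cong_sets[OF sets_pair_measure_cong[OF sets_lborel refl]])
    show ?thesis unfolding f_def[abs_def] by measurable
  qed
  define K where "K = 2 * a0\<^sup>2 + 2 * a1\<^sup>2 * S2 + expectation (\<lambda>\<omega>. (Z \<omega>)\<^sup>2)"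
  have int2: "integrable M (\<lambda>\<omega>. f (u, \<omega>))" for u
    unfolding f_eq using drift_product_bound(1)[OF _ Z Z2, of u] st by (cases "u \<in> {s..t}") auto
  have int: "integrable (lborel \<Otimes>\<^sub>M M) f"
  proof (rule L.Fubini_integrable)
    show "integrable lborel (\<lambda>u. expectation (\<lambda>\<omega>. norm (f (u, \<omega>))))"
    proof (rule Bochner_Integration.integrable_bound)
      show "integrable lborel (\<lambda>u. indicator {s..t} u * K)"
        using st by (intro integrable_mult_left integrable_real_indicator) auto
      have "norm (expectation (\<lambda>\<omega>. norm (f (u, \<omega>)))) \<le> norm (indicator {s..t} u * K)" for u
      proof (cases "u \<in> {s..t}")
        case True
        then have "expectation (\<lambda>\<omega>. norm (f (u, \<omega>))) \<le> K"
          using drift_product_bound(2)[OF _ Z Z2, of u] st by (simp add: f_eq K_def)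
        moreover have "0 \<le> expectation (\<lambda>\<omega>. norm (f (u, \<omega>)))" by simp
        ultimately show ?thesis using True by simp
      qed (simp add: f_eq)
      then show "AE u in lborel. norm (expectation (\<lambda>\<omega>. norm (f (u, \<omega>)))) \<le> norm (indicator {s..t} u * K)" by simp
    qed measurable
  qed (use int2 in auto)
  have "integrable lborel (\<lambda>u. expectation (\<lambda>\<omega>. f (u, \<omega>)))" by (rule L.integrable_fst'[OF int])
  then show "set_integrable lborel {s..t} (\<lambda>u. expectation (\<lambda>\<omega>. (a0 + a1 * X u \<omega>) * Z \<omega>))"
    by (simp add: f_eq set_integrable_def)
  have sec: "(\<integral>u. f (u, \<omega>) \<partial>lborel) = (LINT u:{s..t}|lborel. a0 + a1 * X u \<omega>) * Z \<omega>" for \<omega>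
    by (simp add: f_eq set_lebesgue_integral_def mult.assoc[symmetric])
  have "integrable M (\<lambda>\<omega>. \<integral>u. f (u, \<omega>) \<partial>lborel)"
    using L.integrable_snd[of "\<lambda>u \<omega>. f (u, \<omega>)"] int by simp
  then show "integrable M (\<lambda>\<omega>. (LINT u:{s..t}|lborel. a0 + a1 * X u \<omega>) * Z \<omega>)" by (simp add: sec)
  have "expectation (\<lambda>\<omega>. \<integral>u. f (u, \<omega>) \<partial>lborel) = (\<integral>u. expectation (\<lambda>\<omega>. f (u, \<omega>)) \<partial>lborel)"
    using L.Fubini_integral[of "\<lambda>u \<omega>. f (u, \<omega>)"] int by simp
  then show "expectation (\<lambda>\<omega>. (LINT u:{s..t}|lborel. a0 + a1 * X u \<omega>) * Z \<omega>)
      = (LINT u:{s..t}|lborel. expectation (\<lambda>\<omega>. (a0 + a1 * X u \<omega>) * Z \<omega>))"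
    by (simp add: sec) (simp add: f_eq set_lebesgue_integral_def)
qed

text \<open>The stochastic integral is orthogonal to \<open>Z\<close>, so only the drift remains;
  affine drift then makes the equation for moments against \<open>Z\<close> a closed one.\<close>

lemma solution_increment:
  assumes st: "0 \<le> s" "s \<le> t" and Z: "Z \<in> borel_measurable (F s)" "integrable M (\<lambda>\<omega>. (Z \<omega>)\<^sup>2)"
  shows "expectation (\<lambda>\<omega>. (X t \<omega> - X s \<omega>) * Z \<omega>)
    = (LINT u:{s..t}|lborel. expectation (\<lambda>\<omega>. (a0 + a1 * X u \<omega>) * Z \<omega>))"
proof -
  obtain I where I: "\<And>t. 0 \<le> t \<Longrightarrow> has_ito_integral M F W (\<lambda>s \<omega>. \<sigma> (X s \<omega>)) t (I t)"
    "\<And>t. 0 \<le> t \<Longrightarrow> AE \<omega> in M. X t \<omega> = X 0 \<omega> + (LINT s:{0..t}|lborel. a0 + a1 * X s \<omega>) + I t \<omega>"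
    using solution_ito by blast
  have t: "0 \<le> t" using st by simp
  have ZM: "Z \<in> borel_measurable M" using Z(1) by (rule measurable_F)
  note d = expectation_drift_integral[OF st ZM Z(2)]
  have Im: "I r \<in> borel_measurable M" if "0 \<le> r" for r
    using I(1)[OF that] by (simp add: has_ito_integral_def)
  have IZ: "integrable M (\<lambda>\<omega>. I r \<omega> * Z \<omega>)" if "0 \<le> r" for r
    by (rule square_integrable_mult[OF Im[OF that] ZM ito_square_integrable[OF I(1)[OF that] that] Z(2)])
  have IZ': "integrable M (\<lambda>\<omega>. (I t \<omega> - I s \<omega>) * Z \<omega>)"
    using IZ[OF t] IZ[OF st(1)] by (simp add: left_diff_distrib)
  have "expectation (\<lambda>\<omega>. (X t \<omega> - X s \<omega>) * Z \<omega>)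
      = expectation (\<lambda>\<omega>. (LINT u:{s..t}|lborel. a0 + a1 * X u \<omega>) * Z \<omega> + (I t \<omega> - I s \<omega>) * Z \<omega>)"
  proof (rule integral_cong_AE)
    show "AE \<omega> in M. (X t \<omega> - X s \<omega>) * Z \<omega>
        = (LINT u:{s..t}|lborel. a0 + a1 * X u \<omega>) * Z \<omega> + (I t \<omega> - I s \<omega>) * Z \<omega>"
      using I(2)[OF t] I(2)[OF st(1)] AE_space
    proof eventually_elim
      case (elim \<omega>)
      then have "X t \<omega> - X s \<omega> = (LINT u:{s..t}|lborel. a0 + a1 * X u \<omega>) + (I t \<omega> - I s \<omega>)"
        using drift_increment[OF elim(3) st] by linarith
      then show ?case by (simp only: distrib_right)
    qed
    show "(\<lambda>\<omega>. (X t \<omega> - X s \<omega>) * Z \<omega>) \<in> borel_measurable M"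
      using solution_M[OF t] solution_M[OF st(1)] ZM by measurable
    show "(\<lambda>\<omega>. (LINT u:{s..t}|lborel. a0 + a1 * X u \<omega>) * Z \<omega> + (I t \<omega> - I s \<omega>) * Z \<omega>) \<in> borel_measurable M"
      using borel_measurable_integrable[OF d(2)] borel_measurable_integrable[OF IZ'] by measurable
  qed
  also have "\<dots> = expectation (\<lambda>\<omega>. (LINT u:{s..t}|lborel. a0 + a1 * X u \<omega>) * Z \<omega>)
      + expectation (\<lambda>\<omega>. (I t \<omega> - I s \<omega>) * Z \<omega>)"
    by (rule Bochner_Integration.integral_add[OF d(2) IZ'])
  also have "expectation (\<lambda>\<omega>. (I t \<omega> - I s \<omega>) * Z \<omega>) = 0"
    by (rule ito_increment_orthogonal[OF I(1)[OF t] I(1)[OF st(1)] st Z])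
  finally show ?thesis using d(3) by simp
qed

lemma solution_integrable: "0 \<le> t \<Longrightarrow> integrable M (X t)"
  using square_integrable_mult[OF solution_M[of t] borel_measurable_const sq[of t], of 1] by simp

context
  fixes \<mu> :: real
  assumes mean: "\<And>t. 0 \<le> t \<Longrightarrow> expectation (X t) = \<mu>"
begin

text \<open>Testing the increment over the unit interval with the constant 1: a constant mean leaves
  no average drift.\<close>

lemma stationary_mean: "a0 + a1 * \<mu> = 0"
proof -
  have "0 = expectation (\<lambda>\<omega>. (X 1 \<omega> - X 0 \<omega>) * 1)"
    using mean[of 0] mean[of 1] solution_integrable by simp
  also have "\<dots> = (LINT u:{0..1}|lborel. expectation (\<lambda>\<omega>. (a0 + a1 * X u \<omega>) * 1))"
    by (rule solution_increment) auto
  also have "\<dots> = (LINT u:{0..1::real}|lborel. a0 + a1 * \<mu>)"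
    unfolding set_lebesgue_integral_def
    by (intro Bochner_Integration.integral_cong refl) (auto simp: indicator_def prob_space mean solution_integrable)
  also have "\<dots> = a0 + a1 * \<mu>" by (simp add: set_lebesgue_integral_def)
  finally show ?thesis by simp
qed

lemma centered_square:
  assumes "0 \<le> t"
  shows "integrable M (\<lambda>\<omega>. (X t \<omega> - \<mu>)\<^sup>2)" "expectation (\<lambda>\<omega>. (X t \<omega> - \<mu>)\<^sup>2) = S2 - \<mu>\<^sup>2"
proof -
  have eq: "(X t \<omega> - \<mu>)\<^sup>2 = (X t \<omega>)\<^sup>2 - 2 * \<mu> * X t \<omega> + \<mu>\<^sup>2" for \<omega> by (simp add: power2_eq_square algebra_simps)
  show "integrable M (\<lambda>\<omega>. (X t \<omega> - \<mu>)\<^sup>2)" unfolding eq using sq[OF assms] solution_integrable[OF assms] by simp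
  show "expectation (\<lambda>\<omega>. (X t \<omega> - \<mu>)\<^sup>2) = S2 - \<mu>\<^sup>2"
    unfolding eq using sq[OF assms] solution_integrable[OF assms] S2[OF assms] mean[OF assms]
    by (simp add: prob_space power2_eq_square)
qed

text \<open>With \<open>Z\<close> the centered value at time \<open>s\<close>, the mean equation
  removes \<open>a0\<close> and the drift term becomes \<open>a1\<close> times the covariance
  itself, a linear integral equation.\<close>

lemma stationary_covariance:
  assumes st: "0 \<le> s" "s \<le> t"
  shows "expectation (\<lambda>\<omega>. (X t \<omega> - \<mu>) * (X s \<omega> - \<mu>)) = (S2 - \<mu>\<^sup>2) * exp (a1 * (t - s))"
proof -
  define Z where "Z \<omega> = X s \<omega> - \<mu>" for \<omega>
  define f where "f u = expectation (\<lambda>\<omega>. (X u \<omega> - \<mu>) * Z \<omega>)" for u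
  have Z: "Z \<in> borel_measurable (F s)" "integrable M (\<lambda>\<omega>. (Z \<omega>)\<^sup>2)"
    using solution_F[OF st(1)] centered_square(1)[OF st(1)] unfolding Z_def[abs_def] by measurable
  have ZM: "Z \<in> borel_measurable M" using Z(1) by (rule measurable_F)
  have XZ: "integrable M (\<lambda>\<omega>. X u \<omega> * Z \<omega>)" if "0 \<le> u" for u
    by (rule square_integrable_mult[OF solution_M[OF that] ZM sq[OF that] Z(2)])
  have Zi: "integrable M Z" using square_integrable_mult[OF ZM _ Z(2), of "\<lambda>_. 1"] by simp
  have drift: "expectation (\<lambda>\<omega>. (a0 + a1 * X u \<omega>) * Z \<omega>) = a1 * f u" for u
  proof -
    have "a0 = - (a1 * \<mu>)" using stationary_mean by linarith
    then have "(a0 + a1 * X u \<omega>) * Z \<omega> = a1 * ((X u \<omega> - \<mu>) * Z \<omega>)" for \<omega>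
      by (simp only:) (simp add: algebra_simps)
    then show ?thesis unfolding f_def by (simp only: integral_mult_right_zero)
  qed
  have "f t = f s * exp (a1 * (t - s))"
  proof (rule linear_integral_equation[OF _ _ st(2)])
    fix r assume r: "s \<le> r"
    show "set_integrable lborel {s..r} (\<lambda>u. a1 * f u)"
      using expectation_drift_integral(1)[OF st(1) r ZM Z(2)] by (simp add: drift)
    have "f r - f s = expectation (\<lambda>\<omega>. (X r \<omega> - X s \<omega>) * Z \<omega>)"
      unfolding f_def using XZ[of r] XZ[OF st(1)] Zi r st(1) by (simp add: left_diff_distrib)
    also have "\<dots> = (LINT u:{s..r}|lborel. a1 * f u)"
      using solution_increment[OF st(1) r Z] by (simp add: drift)
    finally show "f r = f s + (LINT u:{s..r}|lborel. a1 * f u)" by simp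
  qed
  moreover have "f s = S2 - \<mu>\<^sup>2"
    using centered_square(2)[OF st(1)] by (simp add: f_def Z_def power2_eq_square)
  ultimately show ?thesis by (simp add: f_def Z_def)
qed

text \<open>For \<open>a1 = 0\<close> the covariance would be constant, so the path would not move and the Ito integral
  would vanish, contradicting the isometry.\<close>

lemma stationary_drift_negative:
  assumes V: "0 < S2 - \<mu>\<^sup>2"
    and nondeg: "(\<integral>\<^sup>+\<omega>. (\<integral>\<^sup>+u\<in>{0..1}. ennreal ((\<sigma> (X u \<omega>))\<^sup>2) \<partial>lborel) \<partial>M) \<noteq> 0"
  shows "a1 < 0"
proof -
  have X1: "(\<lambda>\<omega>. X 1 \<omega> - \<mu>) \<in> borel_measurable M" "(\<lambda>\<omega>. X 0 \<omega> - \<mu>) \<in> borel_measurable M"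
    using solution_M by auto
  have c01: "expectation (\<lambda>\<omega>. (X 1 \<omega> - \<mu>) * (X 0 \<omega> - \<mu>)) = (S2 - \<mu>\<^sup>2) * exp a1"
    using stationary_covariance[of 0 1] by simp
  \<comment> \<open>A covariance cannot exceed the common variance, so
    \<open>exp a1 \<le> 1\<close>.\<close>
  have "((S2 - \<mu>\<^sup>2) * exp a1)\<^sup>2 \<le> (S2 - \<mu>\<^sup>2) * (S2 - \<mu>\<^sup>2)"
    using Cauchy_Schwarz_integral[OF X1 centered_square(1) centered_square(1)] centered_square(2)[of 0] centered_square(2)[of 1] c01
    by simp
  then have "(exp a1)\<^sup>2 \<le> 1" using V by (simp add: power2_eq_square mult_ac)
  then have "exp a1 \<le> 1" using power2_le_imp_le[of "exp a1" 1] by simp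
  then have "a1 \<le> 0" by simp
  moreover have "a1 \<noteq> 0"
  proof
    assume a1: "a1 = 0"
    then have a0: "a0 = 0" using stationary_mean by simp
    \<comment> \<open>The second moment of the displacement is twice the variance minus twice the
      covariance, which are equal when \<open>a1 = 0\<close>.\<close>
    have "expectation (\<lambda>\<omega>. (X 1 \<omega> - \<mu> + (- 1) * (X 0 \<omega> - \<mu>))\<^sup>2) = 0"
      using square_integrable_lincomb(2)[OF X1 centered_square(1) centered_square(1), of "- 1"]
        centered_square(2)[of 0] centered_square(2)[of 1] c01 a1 by simp
    moreover have "integrable M (\<lambda>\<omega>. (X 1 \<omega> - \<mu> + (- 1) * (X 0 \<omega> - \<mu>))\<^sup>2)"
      by (rule square_integrable_lincomb(1)[OF X1 centered_square(1) centered_square(1)]) auto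
    ultimately have eq: "AE \<omega> in M. (X 1 \<omega> - \<mu> + (- 1) * (X 0 \<omega> - \<mu>))\<^sup>2 = 0"
      by (subst (asm) integral_nonneg_eq_0_iff_AE) auto
    obtain I where I: "\<And>t. 0 \<le> t \<Longrightarrow> has_ito_integral M F W (\<lambda>s \<omega>. \<sigma> (X s \<omega>)) t (I t)"
      "\<And>t. 0 \<le> t \<Longrightarrow> AE \<omega> in M. X t \<omega> = X 0 \<omega> + (LINT s:{0..t}|lborel. a0 + a1 * X s \<omega>) + I t \<omega>"
      using solution_ito by blast
    have "AE \<omega> in M. I 1 \<omega> = 0"
      using eq I(2)[OF zero_le_one] by eventually_elim (simp add: a0 a1 set_lebesgue_integral_def)
    then show False using ito_integral_zero[OF I(1)[OF zero_le_one]] nondeg by simp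
  qed
  ultimately show ?thesis by simp
qed

end

end

end

text \<open>An eigenpolynomial of degree \<open>n\<close> has eigenvalue
  \<open>\<kappa> = - n * a1 - n * (n - 1) * d2\<close>. Degree 0 is excluded by
  \<open>\<kappa> > 0\<close>, and with \<open>a1 < 0\<close> and \<open>d2 \<le> 0\<close> the
  least value occurs at degree 1.\<close>

lemma smallest_positive_eigenvalue_eq:
  assumes sm: "smallest_positive_eigenvalue a0 a1 d0 d1 d2 \<theta>" and a1: "a1 < 0" and d2: "d2 \<le> 0"
  shows "\<theta> = - a1"
proof -
  have gen: "pearson_generator a0 a1 d0 d1 d2 (poly Q) y
      = poly ([:a0, a1:] * pderiv Q + [:d0, d1, d2:] * pderiv (pderiv Q)) y" for Q y
  proof -
    have d: "deriv (poly p) = poly (pderiv p)" for p :: "real poly"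
      by (intro ext DERIV_imp_deriv poly_DERIV)
    show ?thesis
      unfolding pearson_generator_def d pearson_drift_def pearson_diffusivity_def
      by (simp add: power2_eq_square algebra_simps)
  qed
  have ge: "- a1 \<le> \<kappa>" if k: "0 < \<kappa>" "neg_generator_eigenvalue a0 a1 d0 d1 d2 \<kappa>" for \<kappa>
  proof -
    obtain Q where Q: "Q \<noteq> 0" "\<And>y. pearson_generator a0 a1 d0 d1 d2 (poly Q) y = - \<kappa> * poly Q y"
      using k(2) unfolding neg_generator_eigenvalue_def by blast
    have "poly ([:a0, a1:] * pderiv Q + [:d0, d1, d2:] * pderiv (pderiv Q) + smult \<kappa> Q) y = 0" for y
      using Q(2)[of y] unfolding gen by simp
    then have P: "[:a0, a1:] * pderiv Q + [:d0, d1, d2:] * pderiv (pderiv Q) + smult \<kappa> Q = 0"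
      using poly_all_0_iff_0 by blast
    define n where "n = degree Q"
    define l where "l = coeff Q n"
    have l: "l \<noteq> 0" using Q(1) by (simp add: l_def n_def)
    have top: "coeff Q i = 0" if "n < i" for i using that by (simp add: n_def coeff_eq_0)
    have eq0: "coeff ([:a0, a1:] * pderiv Q + [:d0, d1, d2:] * pderiv (pderiv Q) + smult \<kappa> Q) n = 0"
      unfolding P by simp
    have "n \<noteq> 0"
    proof
      assume "n = 0"
      then obtain c where "Q = [:c:]" unfolding n_def by (rule degree_eq_zeroE)
      then have "\<kappa> * c = 0" using P by (simp add: pderiv_pCons)
      then show False using \<open>Q = [:c:]\<close> Q(1) k(1) by simp
    qed
    have "real n * a1 * l + real n * (real n - 1) * d2 * l + \<kappa> * l = 0"
    \<comment> \<open>The second-order term contributes to the leading coefficient only from degree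
      2 on; there \<open>n\<close> is written as a double successor so that coefficients can be
      computed.\<close>
    proof (cases "n = 1")
      case True
      then show ?thesis
        using eq0 top by (simp add: l_def coeff_pderiv mult_pCons_left coeff_pCons split: nat.splits)
    next
      case False
      then obtain k where n: "n = Suc (Suc k)" using \<open>n \<noteq> 0\<close> by (metis One_nat_def not0_implies_Suc)
      then show ?thesis
        using eq0 top[of "Suc (Suc (Suc k))"] top[of "Suc (Suc (Suc (Suc k)))"]
        by (simp add: l_def coeff_pderiv mult_pCons_left coeff_pCons algebra_simps)
    qed
    then have "(real n * a1 + real n * (real n - 1) * d2 + \<kappa>) * l = 0" by (simp add: algebra_simps)
    then have \<kappa>: "\<kappa> = real n * (- a1) + real n * (real n - 1) * (- d2)" using l by simp
    have n1: "1 \<le> real n" using \<open>n \<noteq> 0\<close> by simp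
    have "1 * (- a1) \<le> real n * (- a1)" using n1 a1 by (intro mult_right_mono) auto
    moreover have "0 \<le> real n * (real n - 1) * (- d2)" using n1 d2 by (intro mult_nonneg_nonneg) auto
    ultimately show ?thesis using \<kappa> by linarith
  qed
  \<comment> \<open>The witness is the linear polynomial \<open>y + a0 / a1\<close>: the generator
    sends it to the drift \<open>a0 + a1 * y\<close>.\<close>
  have "neg_generator_eigenvalue a0 a1 d0 d1 d2 (- a1)"
    unfolding neg_generator_eigenvalue_def gen
    by (rule exI[of _ "[:a0 / a1, 1:]"]) (use a1 in \<open>auto simp: pderiv_pCons algebra_simps\<close>)
  then show ?thesis
    using sm ge[of \<theta>] a1 unfolding smallest_positive_eigenvalue_def by (metis neg_0_less_iff_less order_antisym)
qed

section \<open>Integrability of the stationary densities and nondegeneracy\<close>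

lemma normal_second_moment:
  assumes r: "0 < r"
  shows "integrable lborel (\<lambda>x. normal_density \<nu> r x * x\<^sup>2)"
proof -
  have eq: "normal_density \<nu> r x * x\<^sup>2 = normal_density \<nu> r x * (x - \<nu>) ^ 2
      + 2 * \<nu> * (normal_density \<nu> r x * (x - \<nu>) ^ 1) + \<nu>\<^sup>2 * (normal_density \<nu> r x * (x - \<nu>) ^ 0)" for x
    by (simp add: power2_eq_square algebra_simps)
  show ?thesis
    unfolding eq
    by (intro Bochner_Integration.integrable_add integrable_mult_right integrable_normal_moment r)
qed

text \<open>With \<open>y = p + q * x\<close> one has
  \<open>q\<^sup>2 * x\<^sup>2 = (y - p)\<^sup>2\<close>, so moments of order at most two of
  \<open>f\<close> suffice.\<close>

lemma affine_second_moment: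
  fixes f :: "real \<Rightarrow> real"
  assumes q: "q \<noteq> 0" and f: "\<And>k. k \<le> 2 \<Longrightarrow> integrable lborel (\<lambda>y. f y * y ^ k)"
  shows "integrable lborel (\<lambda>x. \<bar>q\<bar> * f (p + q * x) * x\<^sup>2)"
proof -
  have "integrable lborel (\<lambda>y. (\<bar>q\<bar> / q\<^sup>2) * (f y * y ^ 2 - 2 * p * (f y * y ^ 1) + p\<^sup>2 * (f y * y ^ 0)))"
    by (intro integrable_mult_right Bochner_Integration.integrable_add Bochner_Integration.integrable_diff f) auto
  from lborel_integrable_real_affine[OF this q, of p]
  have "integrable lborel (\<lambda>x. (\<bar>q\<bar> / q\<^sup>2) * (f (p + q * x) * (p + q * x) ^ 2 - 2 * p * (f (p + q * x) * (p + q * x) ^ 1) + p\<^sup>2 * (f (p + q * x) * (p + q * x) ^ 0)))" .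
  moreover have "(\<bar>q\<bar> / q\<^sup>2) * (f (p + q * x) * (p + q * x) ^ 2 - 2 * p * (f (p + q * x) * (p + q * x) ^ 1) + p\<^sup>2 * (f (p + q * x) * (p + q * x) ^ 0))
      = \<bar>q\<bar> * f (p + q * x) * x\<^sup>2" for x
  proof -
    have "f (p + q * x) * (p + q * x) ^ 2 - 2 * p * (f (p + q * x) * (p + q * x) ^ 1) + p\<^sup>2 * (f (p + q * x) * (p + q * x) ^ 0)
        = q\<^sup>2 * (f (p + q * x) * x\<^sup>2)" by (simp add: power2_eq_square algebra_simps)
    then show ?thesis using q by simp
  qed
  ultimately show ?thesis by simp
qed

text \<open>The Gamma integral with exponent \<open>1 - a - k\<close>, which is below 1 because
  \<open>a\<close> is positive, but may be negative.\<close>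

lemma gamma_density_moments:
  assumes a: "0 < a"
  shows "integrable lborel (\<lambda>y. gamma_density a y * y ^ k)"
proof -
  have "integrable lborel (\<lambda>y. (1 / Gamma a) * (indicator {0<..} y * (exp (- 1 * y) * y powr - (1 - a - real k))))"
    using a by (intro integrable_mult_right integrable.intros[OF has_bochner_integral_exp_powr]) auto
  also have "(\<lambda>y. (1 / Gamma a) * (indicator {0<..} y * (exp (- 1 * y) * y powr - (1 - a - real k)))) = (\<lambda>y. gamma_density a y * y ^ k)"
  proof (rule ext)
    fix y :: real
    have "y powr - (1 - a - real k) = y powr (a - 1) * y ^ k" if "0 < y"
      using that by (simp add: powr_realpow[symmetric] powr_add[symmetric] algebra_simps)
    then show "(1 / Gamma a) * (indicator {0<..} y * (exp (- 1 * y) * y powr - (1 - a - real k))) = gamma_density a y * y ^ k"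
      by (auto simp: gamma_density_def indicator_def)
  qed
  finally show ?thesis .
qed

lemma beta_density_moments:
  assumes ab: "0 < a" "0 < b"
  shows "integrable lborel (\<lambda>y. beta_density a b y * y ^ k)"
proof (rule Bochner_Integration.integrable_bound)
  show "integrable lborel (\<lambda>y. indicator {0..1} y * (y powr (a - 1) * (1 - y) powr (b - 1)) / Beta a b)"
    using integrable_Beta[OF ab] by (simp add: set_integrable_def)
  show "(\<lambda>y. beta_density a b y * y ^ k) \<in> borel_measurable lborel" unfolding beta_density_def by measurable
  show "AE y in lborel. norm (beta_density a b y * y ^ k)
      \<le> norm (indicator {0..1} y * (y powr (a - 1) * (1 - y) powr (b - 1)) / Beta a b)"
  proof (rule AE_I2)
    fix y :: real
    show "norm (beta_density a b y * y ^ k) \<le> norm (indicator {0..1} y * (y powr (a - 1) * (1 - y) powr (b - 1)) / Beta a b)"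
    proof (cases "0 < y \<and> y < 1")
      case True
      then have "\<bar>y ^ k\<bar> \<le> 1" by (simp add: power_le_one)
      then have "\<bar>beta_density a b y\<bar> * \<bar>y ^ k\<bar> \<le> \<bar>beta_density a b y\<bar> * 1" by (intro mult_left_mono) auto
      then show ?thesis using True by (simp add: beta_density_def abs_mult)
    qed (auto simp: beta_density_def)
  qed
qed

text \<open>What the three cases contribute to the covariance argument. The last two facts serve the
  eigenvalue comparison and the nondegeneracy of the noise: a nonzero polynomial has finitely many
  roots.\<close>

lemma pearson_type_facts:
  assumes "hermite_type d0 d1 d2 m \<or> laguerre_type d0 d1 d2 m \<or> jacobi_type d0 d1 d2 m"
  shows "0 \<le> m x" "integrable lborel (\<lambda>x. m x * x\<^sup>2)" "d2 \<le> 0" "[:d0, d1, d2:] \<noteq> 0"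
proof -
  have "0 \<le> m x \<and> integrable lborel (\<lambda>x. m x * x\<^sup>2) \<and> d2 \<le> 0 \<and> [:d0, d1, d2:] \<noteq> 0"
    using assms
  proof (elim disjE)
    assume "hermite_type d0 d1 d2 m"
    then show ?thesis unfolding hermite_type_def by (auto simp: normal_second_moment)
  next
    assume "laguerre_type d0 d1 d2 m"
    then obtain a p q where *: "d2 = 0" "d1 \<noteq> 0" "0 < a" "q \<noteq> 0" and m: "m = (\<lambda>x. \<bar>q\<bar> * gamma_density a (p + q * x))"
      unfolding laguerre_type_def by blast
    have "0 \<le> gamma_density a y" for y using * by (simp add: gamma_density_def)
    then show ?thesis unfolding m using * affine_second_moment[OF _ gamma_density_moments] by simp
  next
    assume "jacobi_type d0 d1 d2 m"
    then obtain a b p q where *: "d2 < 0" "0 < a" "0 < b" "q \<noteq> 0" and m: "m = (\<lambda>x. \<bar>q\<bar> * beta_density a b (p + q * x))"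
      unfolding jacobi_type_def by blast
    have "0 \<le> beta_density a b y" for y using * by (simp add: beta_density_def Beta_def)
    then show ?thesis unfolding m using * affine_second_moment[OF _ beta_density_moments] by simp
  qed
  then show "0 \<le> m x" "integrable lborel (\<lambda>x. m x * x\<^sup>2)" "d2 \<le> 0" "[:d0, d1, d2:] \<noteq> 0" by auto
qed

theorem pearson_stationary_covariance:
  assumes M: "prob_space M"
    and ss: "steady_state_pearson_diffusion M F W a0 a1 d0 d1 d2 \<sigma> m X"
    and \<theta>: "smallest_positive_eigenvalue a0 a1 d0 d1 d2 \<theta>"
  obtains \<mu> V where "0 < V"
    "\<And>t. 0 \<le> t \<Longrightarrow> X t \<in> borel_measurable M"
    "\<And>\<omega>. \<omega> \<in> space M \<Longrightarrow> continuous_on {0..} (\<lambda>t. X t \<omega>)"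
    "\<And>t. 0 \<le> t \<Longrightarrow> prob_space.expectation M (X t) = \<mu>"
    "\<And>t. 0 \<le> t \<Longrightarrow> integrable M (\<lambda>\<omega>. (X t \<omega> - \<mu>)\<^sup>2)"
    "\<And>s t. 0 \<le> s \<Longrightarrow> 0 \<le> t \<Longrightarrow>
      prob_space.expectation M (\<lambda>\<omega>. (X t \<omega> - \<mu>) * (X s \<omega> - \<mu>)) = V * exp (- \<theta> * \<bar>t - s\<bar>)"
proof -
  interpret prob_space M by (rule M)
  have types: "hermite_type d0 d1 d2 m \<or> laguerre_type d0 d1 d2 m \<or> jacobi_type d0 d1 d2 m"
    and \<sigma> [measurable]: "\<sigma> \<in> borel_measurable borel"
    and \<sigma>m: "\<And>x. 0 < m x \<Longrightarrow> (\<sigma> x)\<^sup>2 / 2 = pearson_diffusivity d0 d1 d2 x"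
    and sol: "sde_solution M F W (\<lambda>x. a0 + a1 * x) \<sigma> X"
    and st: "\<And>t. 0 \<le> t \<Longrightarrow> distributed M lborel (X t) (\<lambda>x. ennreal (m x))"
    using ss by (auto simp: steady_state_pearson_diffusion_def in_steady_state_def pearson_drift_def[abs_def])
  interpret brownian M F W using sol by unfold_locales (simp add: sde_solution_def)
  note tf = pearson_type_facts[OF types]
  have m [measurable]: "m \<in> borel_measurable lborel"
    using distributed_real_measurable[OF _ st[of 0]] tf(1) by simp
  have sq: "integrable M (\<lambda>\<omega>. (X t \<omega>)\<^sup>2)" if "0 \<le> t" for t
    using distributed_integrable[OF st[OF that], of "\<lambda>x. x\<^sup>2"] tf(1,2) by simp
  define S2 where "S2 = (\<integral>x. m x * x\<^sup>2 \<partial>lborel)"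
  have S2: "expectation (\<lambda>\<omega>. (X t \<omega>)\<^sup>2) = S2" if "0 \<le> t" for t
    using distributed_integral[OF st[OF that], of "\<lambda>x. x\<^sup>2"] tf(1) by (simp add: S2_def)
  define \<mu> where "\<mu> = (\<integral>x. m x * x \<partial>lborel)"
  have mean: "expectation (X t) = \<mu>" if "0 \<le> t" for t
    using distributed_integral[OF st[OF that], of "\<lambda>x. x"] tf(1) by (simp add: \<mu>_def)
  have XM: "X t \<in> borel_measurable M" if "0 \<le> t" for t
    by (rule solution_M[OF sol sq S2 that])
  have cs1: "integrable M (\<lambda>\<omega>. (X t \<omega> - \<mu>)\<^sup>2)" if "0 \<le> t" for t
    by (rule centered_square(1)[OF sol sq S2 mean that])
  have cs2: "expectation (\<lambda>\<omega>. (X t \<omega> - \<mu>)\<^sup>2) = S2 - \<mu>\<^sup>2" if "0 \<le> t" for t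
    by (rule centered_square(2)[OF sol sq S2 mean that])
  have total: "(\<integral>\<^sup>+x. ennreal (m x) \<partial>lborel) = 1"
    using distributed_nn_integral[OF st[of 0], of "\<lambda>_. 1"] emeasure_space_1 by simp
  \<comment> \<open>Zero variance would concentrate the law of \<open>X 0\<close> at a single point,
    impossible for a law with a density.\<close>
  have V: "0 < S2 - \<mu>\<^sup>2"
  proof -
    have "0 \<le> S2 - \<mu>\<^sup>2" unfolding cs2[OF order_refl, symmetric] by simp
    moreover have "S2 - \<mu>\<^sup>2 \<noteq> 0"
    proof
      assume "S2 - \<mu>\<^sup>2 = 0"
      then have "AE \<omega> in M. (X 0 \<omega> - \<mu>)\<^sup>2 = 0"
        using integral_nonneg_eq_0_iff_AE[OF cs1[OF order_refl]] cs2[OF order_refl] by simp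
      then have "AE \<omega> in M. indicator {\<mu>} (X 0 \<omega>) = (1 :: ennreal)" by eventually_elim simp
      then have "(\<integral>\<^sup>+\<omega>. indicator {\<mu>} (X 0 \<omega>) \<partial>M) = (\<integral>\<^sup>+\<omega>. 1 \<partial>M)" by (rule nn_integral_cong_AE)
      moreover have "(\<integral>\<^sup>+\<omega>. indicator {\<mu>} (X 0 \<omega>) \<partial>M) = (\<integral>\<^sup>+x. ennreal (m x) * indicator {\<mu>} x \<partial>lborel)"
        by (rule distributed_nn_integral[OF st[OF order_refl], symmetric]) simp
      moreover have "(\<integral>\<^sup>+x. ennreal (m x) * indicator {\<mu>} x \<partial>lborel) = 0"
        by (subst nn_integral_null_set) auto
      ultimately show False using emeasure_space_1 by simp
    qed
    ultimately show ?thesis by simp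
  qed
  \<comment> \<open>By stationarity and Fubini the double integral equals the integral of
    \<open>m * \<sigma>\<^sup>2\<close>. If it vanished, \<open>m\<close> would be zero wherever the
    diffusivity is nonzero, that is, off finitely many points, contradicting total mass 1.\<close>
  have nondeg: "(\<integral>\<^sup>+\<omega>. (\<integral>\<^sup>+u\<in>{0..1}. ennreal ((\<sigma> (X u \<omega>))\<^sup>2) \<partial>lborel) \<partial>M) \<noteq> 0"
  proof
    assume zero: "(\<integral>\<^sup>+\<omega>. (\<integral>\<^sup>+u\<in>{0..1}. ennreal ((\<sigma> (X u \<omega>))\<^sup>2) \<partial>lborel) \<partial>M) = 0"
    interpret L: pair_sigma_finite lborel M ..
    define K where "K = (\<integral>\<^sup>+x. ennreal (m x) * ennreal ((\<sigma> x)\<^sup>2) \<partial>lborel)"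
    have [measurable]: "(\<lambda>p. X (max 0 (fst p)) (snd p)) \<in> borel_measurable (lborel \<Otimes>\<^sub>M M)"
      using solution_joint[OF sol sq S2] by (simp add: case_prod_beta measurable_cong_sets[OF sets_pair_measure_cong[OF sets_lborel refl]])
    have jm: "(\<lambda>(u, \<omega>). ennreal ((\<sigma> (X (max 0 u) \<omega>))\<^sup>2) * indicator {0..1} u) \<in> borel_measurable (lborel \<Otimes>\<^sub>M M)"
      unfolding case_prod_beta by measurable
    have "0 = (\<integral>\<^sup>+\<omega>. (\<integral>\<^sup>+u. ennreal ((\<sigma> (X (max 0 u) \<omega>))\<^sup>2) * indicator {0..1} u \<partial>lborel) \<partial>M)"
      unfolding zero[symmetric] by (intro nn_integral_cong) (auto simp: indicator_def)
    also have "\<dots> = (\<integral>\<^sup>+u. (\<integral>\<^sup>+\<omega>. ennreal ((\<sigma> (X (max 0 u) \<omega>))\<^sup>2) * indicator {0..1} u \<partial>M) \<partial>lborel)"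
      by (rule L.Fubini'[OF jm])
    also have "\<dots> = (\<integral>\<^sup>+u. K * indicator {0..1::real} u \<partial>lborel)"
    proof (rule nn_integral_cong)
      fix u :: real
      have "(\<integral>\<^sup>+\<omega>. ennreal ((\<sigma> (X (max 0 u) \<omega>))\<^sup>2) \<partial>M) = K"
        unfolding K_def by (rule distributed_nn_integral[OF st, symmetric]) auto
      then show "(\<integral>\<^sup>+\<omega>. ennreal ((\<sigma> (X (max 0 u) \<omega>))\<^sup>2) * indicator {0..1} u \<partial>M) = K * indicator {0..1} u"
        by (auto simp: indicator_def)
    qed
    also have "\<dots> = K" by (simp add: nn_integral_cmult_indicator)
    finally have "K = 0" by simp
    then have AE0: "AE x in lborel. ennreal (m x) * ennreal ((\<sigma> x)\<^sup>2) = 0"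
      unfolding K_def by (subst (asm) nn_integral_0_iff_AE) auto
    have "finite {x. poly [:d0, d1, d2:] x = 0}" using tf(4) by (rule poly_roots_finite)
    then have "AE x in lborel. x \<notin> {x. poly [:d0, d1, d2:] x = 0}"
      by (intro AE_not_in finite_imp_null_set_lborel)
    with AE0 have "AE x in lborel. ennreal (m x) = 0"
    proof eventually_elim
      case (elim x)
      have "pearson_diffusivity d0 d1 d2 x \<noteq> 0"
        using elim(2) by (simp add: pearson_diffusivity_def power2_eq_square algebra_simps)
      then show ?case using elim(1) \<sigma>m[of x] tf(1)[of x] by (cases "m x = 0") (auto simp: less_le)
    qed
    then have "(\<integral>\<^sup>+x. ennreal (m x) \<partial>lborel) = 0" by (subst nn_integral_0_iff_AE) auto
    then show False using total by simp
  qed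
  have a1: "a1 < 0" by (rule stationary_drift_negative[OF sol sq S2 mean V nondeg])
  have th: "\<theta> = - a1" by (rule smallest_positive_eigenvalue_eq[OF \<theta> a1 tf(3)])
  have cov: "expectation (\<lambda>\<omega>. (X t \<omega> - \<mu>) * (X s \<omega> - \<mu>)) = (S2 - \<mu>\<^sup>2) * exp (- \<theta> * \<bar>t - s\<bar>)"
    if "0 \<le> s" "0 \<le> t" for s t
  proof (cases "s \<le> t")
    case True
    then show ?thesis using stationary_covariance[OF sol sq S2 mean that(1) True] th by simp
  next
    case False
    then have "t \<le> s" by simp
    from stationary_covariance[OF sol sq S2 mean that(2) this] show ?thesis
      using th False by (simp add: mult.commute[of "X t _ - \<mu>"])
  qed
  show thesis
    by (rule that[OF V XM solution_continuous[OF sol sq S2] mean cs1 cov]) (use sq S2 in auto)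
qed

section \<open>Passage times of a subordinator\<close>

lemma inverse_subordinator_nonneg: "0 \<le> inverse_subordinator D t \<omega>"
  unfolding inverse_subordinator_def by (auto intro!: cInf_greatest)

lemma inverse_subordinator_le:
  assumes "0 \<le> w" "t < D w \<omega>"
  shows "inverse_subordinator D t \<omega> \<le> w"
  unfolding inverse_subordinator_def using assms by (auto intro!: cInf_lower bdd_belowI[of _ 0])

text \<open>Together with the preceding lemma this inverts \<open>D\<close> up to one point:
  \<open>E(t) < w\<close> implies \<open>D(w) > t\<close>, which implies
  \<open>E(t) \<le> w\<close>. The assumption \<open>ex\<close> rules out the default value.\<close>

lemma inverse_subordinator_less:
  assumes D: "mono_on {0..} (\<lambda>t. D t \<omega>)" and ex: "\<exists>\<tau>\<ge>0. t < D \<tau> \<omega>"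
    and w: "inverse_subordinator D t \<omega> < w"
  shows "t < D w \<omega>"
proof -
  have "Inf {\<tau>. 0 \<le> \<tau> \<and> t < D \<tau> \<omega>} < w" using w ex by (simp add: inverse_subordinator_def)
  then obtain \<tau> where \<tau>: "0 \<le> \<tau>" "t < D \<tau> \<omega>" "\<tau> < w"
    using ex cInf_lessD[of "{\<tau>. 0 \<le> \<tau> \<and> t < D \<tau> \<omega>}" w] by auto
  then have "D \<tau> \<omega> \<le> D w \<omega>" using mono_onD[OF D, of \<tau> w] by auto
  then show ?thesis using \<tau> by simp
qed

lemma inverse_subordinator_mono:
  assumes D: "mono_on {0..} (\<lambda>t. D t \<omega>)" and ex: "\<exists>\<tau>\<ge>0. t < D \<tau> \<omega>" and st: "s \<le> t"
  shows "inverse_subordinator D s \<omega> \<le> inverse_subordinator D t \<omega>"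
proof (rule field_le_epsilon)
  fix e :: real assume "0 < e"
  then have "t < D (inverse_subordinator D t \<omega> + e) \<omega>" by (intro inverse_subordinator_less[where D = D and \<omega> = \<omega>, OF D ex]) simp
  then show "inverse_subordinator D s \<omega> \<le> inverse_subordinator D t \<omega> + e"
    using st \<open>0 < e\<close> inverse_subordinator_nonneg[of D t \<omega>] by (intro inverse_subordinator_le) auto
qed

text \<open>Writes \<open>exp (- \<theta> * x)\<close> as the probability that an exponential time
  exceeds \<open>x\<close>. With \<open>x\<close> a passage time this exchanges \<open>E\<close> for
  \<open>D\<close> at deterministic times.\<close>

lemma nn_integral_exp_tail:
  assumes "0 < \<theta>"
  shows "(\<integral>\<^sup>+w. ennreal (\<theta> * exp (- \<theta> * w)) * indicator {x..} w \<partial>lborel) = ennreal (exp (- \<theta> * x))"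
proof -
  have "((\<lambda>w. - exp (- \<theta> * w)) \<longlongrightarrow> 0) at_top" using assms by real_asymp
  then have "(\<integral>\<^sup>+w. ennreal (\<theta> * exp (- \<theta> * w)) * indicator {x..} w \<partial>lborel) = ennreal (0 - (- exp (- \<theta> * x)))"
    using assms by (intro nn_integral_FTC_atLeast) (auto intro!: derivative_eq_intros)
  then show ?thesis by simp
qed

text \<open>The growing counterpart: integrating up to the earlier passage time accounts for the
  difference between \<open>exp (\<theta> * E(s))\<close> and 1.\<close>

lemma nn_integral_exp_initial:
  assumes "0 < \<theta>" "0 \<le> x"
  shows "(\<integral>\<^sup>+u. ennreal (\<theta> * exp (\<theta> * u)) * indicator {0..x} u \<partial>lborel) = ennreal (exp (\<theta> * x) - 1)"
proof -
  have "(\<integral>\<^sup>+u. ennreal (\<theta> * exp (\<theta> * u)) * indicator {0..x} u \<partial>lborel) = ennreal (exp (\<theta> * x) - exp (\<theta> * 0))"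
    using assms by (intro nn_integral_FTC_Icc) (auto intro!: derivative_eq_intros simp: has_real_derivative_iff_has_vector_derivative[symmetric])
  then show ?thesis by simp
qed

section \<open>Exponential functionals of passage times as integrals over events of
  \<open>D\<close>\<close>

locale laplace_subordinator = prob_space M for M :: "'a measure" +
  fixes D :: "real \<Rightarrow> 'a \<Rightarrow> real" and \<psi> :: "real \<Rightarrow> real" and \<theta> :: real
  assumes subordinator: "subordinator M D"
    and laplace: "\<And>s t. 0 \<le> s \<Longrightarrow> 0 \<le> t \<Longrightarrow> expectation (\<lambda>\<omega>. exp (- s * D t \<omega>)) = exp (- t * \<psi> s)"
    and psi_pos: "\<And>s. 0 < s \<Longrightarrow> 0 < \<psi> s"
    and theta_pos: "0 < \<theta>"
begin

text \<open>Extended to negative times so that joint measurability on the whole line holds without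
  side conditions.\<close>

definition d :: "real \<Rightarrow> 'a \<Rightarrow> real" where "d w \<omega> = D (max 0 w) \<omega>"

definition weight :: "real \<Rightarrow> ennreal" where "weight w = ennreal (\<theta> * exp (- \<theta> * w)) * indicator {0..} w"

text \<open>The probability that \<open>D\<close> exceeds \<open>t\<close> at an independent
  exponential time of rate \<open>\<theta>\<close>. It will turn out to be \<open>\<Phi> t\<close>,
  in a form whose Laplace transform can be computed.\<close>

definition tail :: "real \<Rightarrow> ennreal" where
  "tail t = (\<integral>\<^sup>+p. weight (fst p) * indicator {t<..} (d (fst p) (snd p)) \<partial>(lborel \<Otimes>\<^sub>M M))"

text \<open>The potential function of \<open>D\<close>: the expected time that \<open>D\<close>
  spends at or below level \<open>s\<close>.\<close>

definition potential :: "real \<Rightarrow> ennreal" where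
  "potential s = (\<integral>\<^sup>+u. indicator {0..} u * emeasure M {\<omega> \<in> space M. d u \<omega> \<le> s} \<partial>lborel)"

lemma D_M [measurable]: "0 \<le> t \<Longrightarrow> D t \<in> borel_measurable M"
  using subordinator unfolding subordinator_def by blast

lemma D_mono: "\<omega> \<in> space M \<Longrightarrow> mono_on {0..} (\<lambda>t. D t \<omega>)"
  using subordinator unfolding subordinator_def by blast

lemma D_right_continuous: "0 \<le> t \<Longrightarrow> \<omega> \<in> space M \<Longrightarrow> continuous (at_right t) (\<lambda>t. D t \<omega>)"
  using subordinator unfolding subordinator_def by blast

lemma D_0: "AE \<omega> in M. D 0 \<omega> = 0"
  using subordinator unfolding subordinator_def by blast

lemma D_nonneg: "AE \<omega> in M. \<forall>t\<ge>0. 0 \<le> D t \<omega>"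
  using D_0 AE_space
proof eventually_elim
  case (elim \<omega>)
  then show ?case using mono_onD[OF D_mono, of \<omega> 0] by fastforce
qed

lemma d_joint [measurable]: "(\<lambda>p. d (fst p) (snd p)) \<in> borel_measurable (lborel \<Otimes>\<^sub>M M)"
  using right_continuous_process_measurable[OF D_M D_right_continuous]
  by (simp add: d_def case_prod_beta measurable_cong_sets[OF sets_pair_measure_cong[OF sets_lborel refl]])

lemma d_comp [measurable (raw)]:
  assumes [measurable]: "f \<in> borel_measurable N" "g \<in> N \<rightarrow>\<^sub>M M"
  shows "(\<lambda>x. d (f x) (g x)) \<in> borel_measurable N"
proof -
  have "(\<lambda>x. (f x, g x)) \<in> N \<rightarrow>\<^sub>M lborel \<Otimes>\<^sub>M M" by measurable
  from measurable_compose[OF this d_joint] show ?thesis by simp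
qed

lemma weight_measurable [measurable]: "weight \<in> borel_measurable borel"
  unfolding weight_def by measurable

lemma exp_D_integrable: "0 \<le> s \<Longrightarrow> 0 \<le> t \<Longrightarrow> integrable M (\<lambda>\<omega>. exp (- s * D t \<omega>))"
proof (rule integrable_const_bound[of _ 1])
  assume st: "0 \<le> s" "0 \<le> t"
  show "AE \<omega> in M. norm (exp (- s * D t \<omega>)) \<le> 1"
    using D_nonneg by eventually_elim (use st in simp)
  show "(\<lambda>\<omega>. exp (- s * D t \<omega>)) \<in> borel_measurable M"
    using D_M[OF st(2)] by measurable
qed

lemma nn_expectation_exp_D:
  assumes "0 \<le> s" "0 \<le> t"
  shows "(\<integral>\<^sup>+\<omega>. ennreal (exp (- s * D t \<omega>)) \<partial>M) = ennreal (exp (- t * \<psi> s))"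
  using nn_integral_eq_integral[OF exp_D_integrable[OF assms]] laplace[OF assms] by simp

text \<open>A path bounded by \<open>N\<close> has \<open>exp (- D n) \<ge> exp (- N)\<close> at
  every integer time \<open>n\<close>, while the expectation of \<open>exp (- D n)\<close> decays
  geometrically because \<open>\<psi> 1\<close> is positive. Countably many levels suffice.\<close>

lemma D_unbounded: "AE \<omega> in M. \<forall>t. \<exists>\<tau>\<ge>0. t < D \<tau> \<omega>"
proof -
  have "AE \<omega> in M. \<exists>n::nat. real N < D (real n) \<omega>" for N :: nat
  proof -
    define A where "A = {\<omega> \<in> space M. \<forall>n::nat. D (real n) \<omega> \<le> real N}"
    have A [measurable]: "A \<in> sets M" unfolding A_def by measurable
    have "emeasure M A \<le> ennreal (exp (real N) * exp (- real n * \<psi> 1))" for n :: nat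
    proof -
      have "emeasure M A = (\<integral>\<^sup>+\<omega>. indicator A \<omega> \<partial>M)" by simp
      also have "\<dots> \<le> (\<integral>\<^sup>+\<omega>. ennreal (exp (real N)) * ennreal (exp (- 1 * D (real n) \<omega>)) \<partial>M)"
      proof (rule nn_integral_mono)
        fix \<omega> assume "\<omega> \<in> space M"
        have "1 \<le> exp (real N) * exp (- 1 * D (real n) \<omega>)" if "\<omega> \<in> A"
          using that by (simp add: A_def exp_add[symmetric])
        then show "indicator A \<omega> \<le> ennreal (exp (real N)) * ennreal (exp (- 1 * D (real n) \<omega>))"
          by (auto simp: indicator_def ennreal_mult[symmetric] ennreal_ge_1)
      qed
      also have "\<dots> = ennreal (exp (real N)) * ennreal (exp (- real n * \<psi> 1))"
        using nn_expectation_exp_D[of 1 "real n"] by (subst nn_integral_cmult) auto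
      finally show ?thesis by (simp add: ennreal_mult)
    qed
    moreover have "(\<lambda>n::nat. ennreal (exp (real N) * exp (- real n * \<psi> 1))) \<longlonglongrightarrow> ennreal 0"
    proof (rule tendsto_ennrealI)
      have "0 < \<psi> 1" by (rule psi_pos) simp
      then show "(\<lambda>n::nat. exp (real N) * exp (- real n * \<psi> 1)) \<longlonglongrightarrow> 0" by real_asymp
    qed
    ultimately have "emeasure M A \<le> 0"
      by (intro LIMSEQ_le_const[of "\<lambda>n::nat. ennreal (exp (real N) * exp (- real n * \<psi> 1))"]) auto
    then have "A \<in> null_sets M" by auto
    then have "AE \<omega> in M. \<omega> \<notin> A" by (rule AE_not_in)
    then show ?thesis using AE_space by eventually_elim (auto simp: A_def not_le)
  qed
  then have "AE \<omega> in M. \<forall>N::nat. \<exists>n::nat. real N < D (real n) \<omega>" by (simp add: AE_all_countable)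
  then show ?thesis
  proof eventually_elim
    case (elim \<omega>)
    show ?case
    proof
      fix t
      obtain N :: nat where "t < real N" using reals_Archimedean2 by blast
      moreover obtain n :: nat where "real N < D (real n) \<omega>" using elim by blast
      ultimately show "\<exists>\<tau>\<ge>0. t < D \<tau> \<omega>" by (intro exI[of _ "real n"]) auto
    qed
  qed
qed

text \<open>The process restarted at \<open>u\<close> passes \<open>t\<close> after the remaining
  time \<open>E(t) - u\<close>, up to one point in \<open>w\<close>. The condition
  \<open>u \<le> E(t)\<close> keeps this threshold in the support of the weight.\<close>

lemma passage_after:
  assumes \<omega>: "\<omega> \<in> space M" and ex: "\<exists>\<tau>\<ge>0. t < D \<tau> \<omega>"
    and u: "0 \<le> u" "u \<le> inverse_subordinator D t \<omega>"
  shows "(\<integral>\<^sup>+w. weight w * indicator {t<..} (d (u + max 0 w) \<omega>) \<partial>lborel)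
    = ennreal (exp (- \<theta> * (inverse_subordinator D t \<omega> - u)))"
proof -
  let ?x = "inverse_subordinator D t \<omega> - u"
  have "(\<integral>\<^sup>+w. weight w * indicator {t<..} (d (u + max 0 w) \<omega>) \<partial>lborel)
      = (\<integral>\<^sup>+w. ennreal (\<theta> * exp (- \<theta> * w)) * indicator {?x..} w \<partial>lborel)"
  proof (rule nn_integral_cong_AE)
    show "AE w in lborel. weight w * indicator {t<..} (d (u + max 0 w) \<omega>)
        = ennreal (\<theta> * exp (- \<theta> * w)) * indicator {?x..} w"
      using AE_lborel_singleton[of ?x]
    proof eventually_elim
      case (elim w)
      show ?case
      proof (cases "0 \<le> w")
        case True
        then have d: "d (u + max 0 w) \<omega> = D (u + w) \<omega>" using u by (simp add: d_def)
        have "t < D (u + w) \<omega> \<longleftrightarrow> ?x \<le> w"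
        proof
          assume "t < D (u + w) \<omega>"
          then show "?x \<le> w" using inverse_subordinator_le[of "u + w" t D \<omega>] u True by simp
        next
          assume "?x \<le> w"
          then show "t < D (u + w) \<omega>" using elim by (intro inverse_subordinator_less[where D = D and \<omega> = \<omega>, OF D_mono[OF \<omega>] ex]) auto
        qed
        then show ?thesis using True d by (simp add: weight_def indicator_def)
      next
        case False
        then show ?thesis using u by (simp add: weight_def)
      qed
    qed
  qed
  then show ?thesis using nn_integral_exp_tail[OF theta_pos] by simp
qed

lemma expectation_exp_passage:
  "(\<integral>\<^sup>+\<omega>. ennreal (exp (- \<theta> * inverse_subordinator D t \<omega>)) \<partial>M) = tail t"
proof -
  interpret L: pair_sigma_finite lborel M ..
  have "(\<integral>\<^sup>+\<omega>. ennreal (exp (- \<theta> * inverse_subordinator D t \<omega>)) \<partial>M)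
      = (\<integral>\<^sup>+\<omega>. (\<integral>\<^sup>+w. weight w * indicator {t<..} (d w \<omega>) \<partial>lborel) \<partial>M)"
  proof (rule nn_integral_cong_AE)
    show "AE \<omega> in M. ennreal (exp (- \<theta> * inverse_subordinator D t \<omega>)) = (\<integral>\<^sup>+w. weight w * indicator {t<..} (d w \<omega>) \<partial>lborel)"
      using D_unbounded AE_space
    proof eventually_elim
      case (elim \<omega>)
      have "d (0 + max 0 w) \<omega> = d w \<omega>" for w by (simp add: d_def)
      then show ?case
        using passage_after[of \<omega> t 0] elim inverse_subordinator_nonneg[of D t \<omega>] by simp
    qed
  qed
  also have "\<dots> = tail t"
    unfolding tail_def by (subst L.nn_integral_snd[symmetric]) auto
  finally show ?thesis .
qed

text \<open>The random limit of integration \<open>E(s)\<close> becomes the condition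
  \<open>D(u) \<le> s\<close>, and the inner integral is the exponential of the time still needed
  from \<open>u\<close>. Both passage times are thus replaced by \<open>D\<close> at deterministic
  times.\<close>

lemma passage_gap:
  assumes \<omega>: "\<omega> \<in> space M" and ex: "\<And>t. \<exists>\<tau>\<ge>0. t < D \<tau> \<omega>" and st: "s \<le> t"
  shows "ennreal (exp (- \<theta> * (inverse_subordinator D t \<omega> - inverse_subordinator D s \<omega>)))
    = ennreal (exp (- \<theta> * inverse_subordinator D t \<omega>))
      + (\<integral>\<^sup>+u. (ennreal \<theta> * indicator {0..} u * indicator {..s} (d u \<omega>))
          * (\<integral>\<^sup>+w. weight w * indicator {t<..} (d (max 0 u + max 0 w) \<omega>) \<partial>lborel) \<partial>lborel)"
proof -
  define a b where "a = inverse_subordinator D s \<omega>" and "b = inverse_subordinator D t \<omega>"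
  have ab: "0 \<le> a" "a \<le> b"
    using inverse_subordinator_nonneg inverse_subordinator_mono[where D = D and \<omega> = \<omega>, OF D_mono[OF \<omega>] ex st] by (auto simp: a_def b_def)
  have "(\<integral>\<^sup>+u. (ennreal \<theta> * indicator {0..} u * indicator {..s} (d u \<omega>))
          * (\<integral>\<^sup>+w. weight w * indicator {t<..} (d (max 0 u + max 0 w) \<omega>) \<partial>lborel) \<partial>lborel)
      = (\<integral>\<^sup>+u. ennreal (exp (- \<theta> * b)) * (ennreal (\<theta> * exp (\<theta> * u)) * indicator {0..a} u) \<partial>lborel)"
  proof (rule nn_integral_cong_AE)
    show "AE u in lborel. (ennreal \<theta> * indicator {0..} u * indicator {..s} (d u \<omega>))
          * (\<integral>\<^sup>+w. weight w * indicator {t<..} (d (max 0 u + max 0 w) \<omega>) \<partial>lborel)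
        = ennreal (exp (- \<theta> * b)) * (ennreal (\<theta> * exp (\<theta> * u)) * indicator {0..a} u)"
      using AE_lborel_singleton[of a]
    proof eventually_elim
      case (elim u)
      \<comment> \<open>At \<open>u = a\<close> the position of \<open>D(u)\<close> relative to
        \<open>s\<close> is undetermined; this single point has been discarded.\<close>
      consider "u < 0" | "0 \<le> u" "u < a" | "a < u" "0 \<le> u" using elim by linarith
      then show ?case
      proof cases
        case 2
        then have "d u \<omega> \<le> s"
          using inverse_subordinator_le[of u s D \<omega>] by (force simp: d_def a_def not_less[symmetric])
        moreover have "(\<integral>\<^sup>+w. weight w * indicator {t<..} (d (max 0 u + max 0 w) \<omega>) \<partial>lborel) = ennreal (exp (- \<theta> * (b - u)))"
          using passage_after[OF \<omega> ex, of u t] 2 ab by (simp add: b_def max_def)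
        moreover have "\<theta> * exp (- \<theta> * (b - u)) = exp (- \<theta> * b) * (\<theta> * exp (\<theta> * u))"
          by (simp add: exp_add[symmetric] algebra_simps)
        ultimately show ?thesis using 2 theta_pos by (simp add: ennreal_mult[symmetric])
      next
        case 3
        then have "s < d u \<omega>"
          using inverse_subordinator_less[where D = D and \<omega> = \<omega>, OF D_mono[OF \<omega>] ex, of s u] by (simp add: d_def a_def)
        then show ?thesis using 3 by simp
      qed auto
    qed
  qed
  also have "\<dots> = ennreal (exp (- \<theta> * b)) * ennreal (exp (\<theta> * a) - 1)"
    using nn_integral_exp_initial[OF theta_pos ab(1)] by (subst nn_integral_cmult) auto
  finally have "ennreal (exp (- \<theta> * b)) + (\<integral>\<^sup>+u. (ennreal \<theta> * indicator {0..} u * indicator {..s} (d u \<omega>))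
          * (\<integral>\<^sup>+w. weight w * indicator {t<..} (d (max 0 u + max 0 w) \<omega>) \<partial>lborel) \<partial>lborel)
      = ennreal (exp (- \<theta> * b) + exp (- \<theta> * b) * (exp (\<theta> * a) - 1))"
    using ab theta_pos by (simp add: ennreal_mult ennreal_plus)
  also have "exp (- \<theta> * b) + exp (- \<theta> * b) * (exp (\<theta> * a) - 1) = exp (- \<theta> * (b - a))"
    by (simp add: exp_add[symmetric] algebra_simps)
  finally show ?thesis by (simp add: a_def b_def)
qed

text \<open>Stationary increments compare with \<open>D w - D 0\<close>, and \<open>D 0\<close> is
  zero only almost surely, so the events agree up to a null set.\<close>

lemma increment_tail_prob:
  assumes "0 \<le> u" "0 \<le> w"
  shows "prob {\<omega> \<in> space M. t < D (u + w) \<omega> - D u \<omega>} = prob {\<omega> \<in> space M. t < d w \<omega>}"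
proof -
  have "measure (distr M borel (\<lambda>\<omega>. D (u + w) \<omega> - D u \<omega>)) {t<..} = measure (distr M borel (\<lambda>\<omega>. D w \<omega> - D 0 \<omega>)) {t<..}"
    using subordinator assms by (simp add: subordinator_def)
  then have "prob {\<omega> \<in> space M. t < D (u + w) \<omega> - D u \<omega>} = prob {\<omega> \<in> space M. t < D w \<omega> - D 0 \<omega>}"
    using assms by (simp add: measure_distr vimage_def Int_def conj_commute)
  also have "\<dots> = prob {\<omega> \<in> space M. t < d w \<omega>}"
    using assms D_0 by (intro measure_eq_AE) (auto simp: d_def)
  finally show ?thesis .
qed

lemma increment_independent:
  assumes "0 \<le> u" "0 \<le> w"
  shows "prob {\<omega> \<in> space M. d u \<omega> \<le> s \<and> t < D (u + w) \<omega> - D u \<omega>}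
    = prob {\<omega> \<in> space M. d u \<omega> \<le> s} * prob {\<omega> \<in> space M. t < d w \<omega>}"
proof -
  \<comment> \<open>A grid of two steps, from 0 to \<open>u\<close> and on to \<open>u + w\<close>;
    the value \<open>D u\<close> is almost surely the first increment.\<close>
  define \<tau> where "\<tau> i = (if i = 0 then 0 else if i = 1 then u else u + w)" for i :: nat
  define A where "A i = (if i = 0 then {..s} else {t<..})" for i :: nat
  define X where "X i \<omega> = D (\<tau> (Suc i)) \<omega> - D (\<tau> i) \<omega>" for i \<omega>
  have mono: "\<forall>i<2. \<tau> i \<le> \<tau> (Suc i)" using assms by (auto simp: \<tau>_def less_2_cases_iff)
  have "0 \<le> \<tau> 0 \<and> (\<forall>i<k. \<tau> i \<le> \<tau> (Suc i)) \<longrightarrow>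
      indep_vars (\<lambda>_. borel) (\<lambda>i \<omega>. D (\<tau> (Suc i)) \<omega> - D (\<tau> i) \<omega>) {..<k}" for k
    using subordinator unfolding subordinator_def by blast
  from this[of 2] mono have ind: "indep_vars (\<lambda>_. borel) X {..<2}"
    by (simp add: X_def[abs_def] \<tau>_def[of 0])
  have "X i \<in> borel_measurable M" for i
    unfolding X_def[abs_def] using assms by (intro borel_measurable_diff D_M) (auto simp: \<tau>_def)
  then have ev: "X i -` A i \<inter> space M \<in> events" for i
    by (rule measurable_sets) (simp add: A_def)
  have "prob (\<Inter>i\<in>{..<2}. X i -` A i \<inter> space M) = (\<Prod>i\<in>{..<2}. prob (X i -` A i \<inter> space M))"
    by (rule indep_varsD_finite[OF ind]) (auto simp: A_def lessThan_empty_iff)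
  moreover have "{..<2::nat} = {0, 1}" by auto
  ultimately have "prob ((X 0 -` A 0 \<inter> space M) \<inter> (X 1 -` A 1 \<inter> space M)) = prob (X 0 -` A 0 \<inter> space M) * prob (X 1 -` A 1 \<inter> space M)"
    by simp
  moreover have "prob ((X 0 -` A 0 \<inter> space M) \<inter> (X 1 -` A 1 \<inter> space M)) = prob {\<omega> \<in> space M. d u \<omega> \<le> s \<and> t < D (u + w) \<omega> - D u \<omega>}"
  proof (rule measure_eq_AE)
    show "AE \<omega> in M. (\<omega> \<in> (X 0 -` A 0 \<inter> space M) \<inter> (X 1 -` A 1 \<inter> space M)) = (\<omega> \<in> {\<omega> \<in> space M. d u \<omega> \<le> s \<and> t < D (u + w) \<omega> - D u \<omega>})"
      using D_0 by eventually_elim (use assms in \<open>auto simp: X_def A_def \<tau>_def d_def\<close>)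
  qed (use ev[of 0] ev[of 1] assms in auto)
  moreover have "prob (X 0 -` A 0 \<inter> space M) = prob {\<omega> \<in> space M. d u \<omega> \<le> s}"
  proof (rule measure_eq_AE)
    show "AE \<omega> in M. (\<omega> \<in> X 0 -` A 0 \<inter> space M) = (\<omega> \<in> {\<omega> \<in> space M. d u \<omega> \<le> s})"
      using D_0 by eventually_elim (use assms in \<open>auto simp: X_def A_def \<tau>_def d_def\<close>)
  qed (use ev[of 0] assms in auto)
  moreover have "X 1 -` A 1 \<inter> space M = {\<omega> \<in> space M. t < D (u + w) \<omega> - D u \<omega>}"
    by (auto simp: X_def A_def \<tau>_def)
  ultimately show ?thesis using increment_tail_prob[OF assms, of t] by simp
qed

text \<open>The source of the sandwich. Given \<open>0 \<le> D(u) \<le> s\<close>, an increment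
  above \<open>t\<close> forces \<open>D(u + w) > t\<close>, and this forces an increment above
  \<open>t - s\<close>; the increment is independent of \<open>D(u)\<close>.\<close>

lemma joint_passage_bounds:
  assumes uw: "0 \<le> u" "0 \<le> w"
  shows "prob {\<omega> \<in> space M. d u \<omega> \<le> s} * prob {\<omega> \<in> space M. t < d w \<omega>}
      \<le> prob {\<omega> \<in> space M. d u \<omega> \<le> s \<and> t < d (u + w) \<omega>}"
    and "prob {\<omega> \<in> space M. d u \<omega> \<le> s \<and> t < d (u + w) \<omega>}
      \<le> prob {\<omega> \<in> space M. d u \<omega> \<le> s} * prob {\<omega> \<in> space M. t - s < d w \<omega>}"
proof -
  have m [measurable]: "D u \<in> borel_measurable M" "D (u + w) \<in> borel_measurable M" using uw by auto
  show "prob {\<omega> \<in> space M. d u \<omega> \<le> s} * prob {\<omega> \<in> space M. t < d w \<omega>}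
      \<le> prob {\<omega> \<in> space M. d u \<omega> \<le> s \<and> t < d (u + w) \<omega>}"
    unfolding increment_independent[OF uw, symmetric]
  proof (rule finite_measure_mono_AE)
    show "AE \<omega> in M. \<omega> \<in> {\<omega> \<in> space M. d u \<omega> \<le> s \<and> t < D (u + w) \<omega> - D u \<omega>}
        \<longrightarrow> \<omega> \<in> {\<omega> \<in> space M. d u \<omega> \<le> s \<and> t < d (u + w) \<omega>}"
      using D_nonneg
    proof eventually_elim
      case (elim \<omega>)
      then have "0 \<le> D u \<omega>" using uw by simp
      then show ?case using uw by (auto simp: d_def)
    qed
  qed measurable
  show "prob {\<omega> \<in> space M. d u \<omega> \<le> s \<and> t < d (u + w) \<omega>}
      \<le> prob {\<omega> \<in> space M. d u \<omega> \<le> s} * prob {\<omega> \<in> space M. t - s < d w \<omega>}"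
    unfolding increment_independent[OF uw, symmetric]
    by (rule finite_measure_mono) (use uw in \<open>auto simp: d_def\<close>)
qed

lemma tail_iterated: "tail t = (\<integral>\<^sup>+w. weight w * emeasure M {\<omega> \<in> space M. t < d w \<omega>} \<partial>lborel)"
proof -
  have "tail t = (\<integral>\<^sup>+w. (\<integral>\<^sup>+\<omega>. weight w * indicator {t<..} (d w \<omega>) \<partial>M) \<partial>lborel)"
    unfolding tail_def by (subst nn_integral_fst[symmetric]) auto
  also have "\<dots> = (\<integral>\<^sup>+w. weight w * emeasure M {\<omega> \<in> space M. t < d w \<omega>} \<partial>lborel)"
  proof (rule nn_integral_cong)
    fix w
    have "(\<integral>\<^sup>+\<omega>. weight w * indicator {t<..} (d w \<omega>) \<partial>M) = (\<integral>\<^sup>+\<omega>. weight w * indicator {\<omega> \<in> space M. t < d w \<omega>} \<omega> \<partial>M)"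
      by (rule nn_integral_cong) (auto simp: indicator_def)
    then show "(\<integral>\<^sup>+\<omega>. weight w * indicator {t<..} (d w \<omega>) \<partial>M) = weight w * emeasure M {\<omega> \<in> space M. t < d w \<omega>}"
      by (simp add: nn_integral_cmult_indicator)
  qed
  finally show ?thesis .
qed

lemma prob_measurable [measurable]:
  "(\<lambda>u. emeasure M {\<omega> \<in> space M. d u \<omega> \<le> s}) \<in> borel_measurable borel"
  "(\<lambda>u. emeasure M {\<omega> \<in> space M. t < d u \<omega>}) \<in> borel_measurable borel"
proof -
  have "(\<lambda>u. \<integral>\<^sup>+\<omega>. indicator {..s} (d u \<omega>) \<partial>M) \<in> borel_measurable borel"
    "(\<lambda>u. \<integral>\<^sup>+\<omega>. indicator {t<..} (d u \<omega>) \<partial>M) \<in> borel_measurable borel"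
    by measurable
  moreover have "(\<integral>\<^sup>+\<omega>. indicator A (d u \<omega>) \<partial>M) = emeasure M {\<omega> \<in> space M. d u \<omega> \<in> A}"
    if "A \<in> sets borel" for u A
  proof -
    have "(\<integral>\<^sup>+\<omega>. indicator A (d u \<omega>) \<partial>M) = (\<integral>\<^sup>+\<omega>. indicator {\<omega> \<in> space M. d u \<omega> \<in> A} \<omega> \<partial>M)"
      by (rule nn_integral_cong) (simp add: indicator_def)
    then show ?thesis using that by simp
  qed
  from this[of "{..s}"] this[of "{t<..}"]
  have "(\<integral>\<^sup>+\<omega>. indicator {..s} (d u \<omega>) \<partial>M) = emeasure M {\<omega> \<in> space M. d u \<omega> \<le> s}"
    "(\<integral>\<^sup>+\<omega>. indicator {t<..} (d u \<omega>) \<partial>M) = emeasure M {\<omega> \<in> space M. t < d u \<omega>}" for u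
    by simp_all
  ultimately show "(\<lambda>u. emeasure M {\<omega> \<in> space M. d u \<omega> \<le> s}) \<in> borel_measurable borel"
    "(\<lambda>u. emeasure M {\<omega> \<in> space M. t < d u \<omega>}) \<in> borel_measurable borel" by simp_all
qed

text \<open>The pathwise identity integrated by Tonelli. Measurability of the passage time is
  assumed here and later obtained from the independence assumption.\<close>

lemma expectation_exp_passage_gap:
  assumes st: "0 \<le> s" "s \<le> t" and E: "inverse_subordinator D t \<in> borel_measurable M"
  shows "(\<integral>\<^sup>+\<omega>. ennreal (exp (- \<theta> * (inverse_subordinator D t \<omega> - inverse_subordinator D s \<omega>))) \<partial>M)
    = tail t + (\<integral>\<^sup>+u. ennreal \<theta> * indicator {0..} u * (\<integral>\<^sup>+w. weight w
        * emeasure M {\<omega> \<in> space M. d u \<omega> \<le> s \<and> t < d (max 0 u + max 0 w) \<omega>} \<partial>lborel) \<partial>lborel)"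
proof -
  interpret L: pair_sigma_finite lborel M ..
  define G where "G u \<omega> = (ennreal \<theta> * indicator {0..} u * indicator {..s} (d u \<omega>))
          * (\<integral>\<^sup>+w. weight w * indicator {t<..} (d (max 0 u + max 0 w) \<omega>) \<partial>lborel)" for u \<omega>
  have G [measurable]: "(\<lambda>(u, \<omega>). G u \<omega>) \<in> borel_measurable (lborel \<Otimes>\<^sub>M M)"
    unfolding G_def by measurable
  have "(\<integral>\<^sup>+\<omega>. ennreal (exp (- \<theta> * (inverse_subordinator D t \<omega> - inverse_subordinator D s \<omega>))) \<partial>M)
      = (\<integral>\<^sup>+\<omega>. ennreal (exp (- \<theta> * inverse_subordinator D t \<omega>)) + (\<integral>\<^sup>+u. G u \<omega> \<partial>lborel) \<partial>M)"
    by (rule nn_integral_cong_AE) (use D_unbounded AE_space in eventually_elim, use passage_gap[OF _ _ st(2)] in \<open>simp add: G_def\<close>)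
  also have "\<dots> = tail t + (\<integral>\<^sup>+\<omega>. (\<integral>\<^sup>+u. G u \<omega> \<partial>lborel) \<partial>M)"
    unfolding expectation_exp_passage[symmetric] using E by (intro nn_integral_add) auto
  also have "(\<integral>\<^sup>+\<omega>. (\<integral>\<^sup>+u. G u \<omega> \<partial>lborel) \<partial>M) = (\<integral>\<^sup>+u. (\<integral>\<^sup>+\<omega>. G u \<omega> \<partial>M) \<partial>lborel)"
    by (rule L.Fubini'[OF G])
  also have "\<dots> = (\<integral>\<^sup>+u. ennreal \<theta> * indicator {0..} u * (\<integral>\<^sup>+w. weight w
        * emeasure M {\<omega> \<in> space M. d u \<omega> \<le> s \<and> t < d (max 0 u + max 0 w) \<omega>} \<partial>lborel) \<partial>lborel)"
  proof (rule nn_integral_cong)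
    fix u :: real
    define J where "J w \<omega> = (indicator {\<omega> \<in> space M. d u \<omega> \<le> s \<and> t < d (max 0 u + max 0 w) \<omega>} \<omega> :: ennreal)" for w \<omega>
    have J: "(\<lambda>(w, \<omega>). weight w * (indicator {..s} (d u \<omega>) * indicator {t<..} (d (max 0 u + max 0 w) \<omega>)))
        \<in> borel_measurable (lborel \<Otimes>\<^sub>M M)"
      by measurable
    have "(\<integral>\<^sup>+\<omega>. G u \<omega> \<partial>M) = (\<integral>\<^sup>+\<omega>. ennreal \<theta> * indicator {0..} u * (\<integral>\<^sup>+w. weight w *
        (indicator {..s} (d u \<omega>) * indicator {t<..} (d (max 0 u + max 0 w) \<omega>)) \<partial>lborel) \<partial>M)"
    proof (rule nn_integral_cong)
      fix \<omega> assume [measurable]: "\<omega> \<in> space M"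
      have [measurable]: "(\<lambda>w. d (max 0 u + max 0 w) \<omega>) \<in> borel_measurable borel" by measurable
      have "(\<integral>\<^sup>+w. weight w * (indicator {..s} (d u \<omega>) * indicator {t<..} (d (max 0 u + max 0 w) \<omega>)) \<partial>lborel)
          = indicator {..s} (d u \<omega>) * (\<integral>\<^sup>+w. weight w * indicator {t<..} (d (max 0 u + max 0 w) \<omega>) \<partial>lborel)"
        by (subst nn_integral_cmult[symmetric]) (auto simp: mult_ac)
      then show "G u \<omega> = ennreal \<theta> * indicator {0..} u * (\<integral>\<^sup>+w. weight w *
        (indicator {..s} (d u \<omega>) * indicator {t<..} (d (max 0 u + max 0 w) \<omega>)) \<partial>lborel)"
        by (simp add: G_def mult_ac)
    qed
    also have "\<dots> = ennreal \<theta> * indicator {0..} u * (\<integral>\<^sup>+\<omega>. (\<integral>\<^sup>+w. weight w *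
        (indicator {..s} (d u \<omega>) * indicator {t<..} (d (max 0 u + max 0 w) \<omega>)) \<partial>lborel) \<partial>M)"
      by (rule nn_integral_cmult) measurable
    also have "(\<integral>\<^sup>+\<omega>. (\<integral>\<^sup>+w. weight w * (indicator {..s} (d u \<omega>) * indicator {t<..} (d (max 0 u + max 0 w) \<omega>)) \<partial>lborel) \<partial>M)
       = (\<integral>\<^sup>+w. (\<integral>\<^sup>+\<omega>. weight w * (indicator {..s} (d u \<omega>) * indicator {t<..} (d (max 0 u + max 0 w) \<omega>)) \<partial>M) \<partial>lborel)"
      by (rule L.Fubini'[OF J])
    also have "\<dots> = (\<integral>\<^sup>+w. weight w * emeasure M {\<omega> \<in> space M. d u \<omega> \<le> s \<and> t < d (max 0 u + max 0 w) \<omega>} \<partial>lborel)"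
    proof (rule nn_integral_cong)
      fix w
      have "(\<integral>\<^sup>+\<omega>. weight w * (indicator {..s} (d u \<omega>) * indicator {t<..} (d (max 0 u + max 0 w) \<omega>)) \<partial>M)
          = (\<integral>\<^sup>+\<omega>. weight w * J w \<omega> \<partial>M)"
        by (rule nn_integral_cong) (auto simp: J_def indicator_def)
      also have "\<dots> = weight w * emeasure M {\<omega> \<in> space M. d u \<omega> \<le> s \<and> t < d (max 0 u + max 0 w) \<omega>}"
        unfolding J_def by (rule nn_integral_cmult_indicator) measurable
      finally show "(\<integral>\<^sup>+\<omega>. weight w * (indicator {..s} (d u \<omega>) * indicator {t<..} (d (max 0 u + max 0 w) \<omega>)) \<partial>M)
          = weight w * emeasure M {\<omega> \<in> space M. d u \<omega> \<le> s \<and> t < d (max 0 u + max 0 w) \<omega>}" .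
    qed
    finally show "(\<integral>\<^sup>+\<omega>. G u \<omega> \<partial>M) = ennreal \<theta> * indicator {0..} u * (\<integral>\<^sup>+w. weight w
        * emeasure M {\<omega> \<in> space M. d u \<omega> \<le> s \<and> t < d (max 0 u + max 0 w) \<omega>} \<partial>lborel)" .
  qed
  finally show ?thesis .
qed

text \<open>If the joint probability factored exactly, the double integral would be
  \<open>\<theta>\<close> times the potential times a tail. The two one-sided factorizations give
  this product with the tail at \<open>t\<close> and at \<open>t - s\<close>.\<close>

lemma passage_gap_bounds:
  assumes st: "0 \<le> s" "s \<le> t" and E: "inverse_subordinator D t \<in> borel_measurable M"
  defines "g \<equiv> \<integral>\<^sup>+\<omega>. ennreal (exp (- \<theta> * (inverse_subordinator D t \<omega> - inverse_subordinator D s \<omega>))) \<partial>M"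
  shows "tail t + ennreal \<theta> * potential s * tail t \<le> g"
    and "g \<le> tail t + ennreal \<theta> * potential s * tail (t - s)"
proof -
  have prod: "ennreal \<theta> * potential s * tail r = (\<integral>\<^sup>+u. ennreal \<theta> * indicator {0..} u * (\<integral>\<^sup>+w. weight w
      * (emeasure M {\<omega> \<in> space M. d u \<omega> \<le> s} * emeasure M {\<omega> \<in> space M. r < d w \<omega>}) \<partial>lborel) \<partial>lborel)" for r
  proof -
    have "(\<integral>\<^sup>+u. ennreal \<theta> * indicator {0..} u * (\<integral>\<^sup>+w. weight w
      * (emeasure M {\<omega> \<in> space M. d u \<omega> \<le> s} * emeasure M {\<omega> \<in> space M. r < d w \<omega>}) \<partial>lborel) \<partial>lborel)
      = (\<integral>\<^sup>+u. ennreal \<theta> * tail r * (indicator {0..} u * emeasure M {\<omega> \<in> space M. d u \<omega> \<le> s}) \<partial>lborel)"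
    proof (rule nn_integral_cong)
      fix u
      have "(\<integral>\<^sup>+w. weight w * (emeasure M {\<omega> \<in> space M. d u \<omega> \<le> s} * emeasure M {\<omega> \<in> space M. r < d w \<omega>}) \<partial>lborel)
        = emeasure M {\<omega> \<in> space M. d u \<omega> \<le> s} * tail r"
        unfolding tail_iterated by (subst nn_integral_cmult[symmetric]) (auto simp: mult_ac)
      then show "ennreal \<theta> * indicator {0..} u * (\<integral>\<^sup>+w. weight w
          * (emeasure M {\<omega> \<in> space M. d u \<omega> \<le> s} * emeasure M {\<omega> \<in> space M. r < d w \<omega>}) \<partial>lborel)
        = ennreal \<theta> * tail r * (indicator {0..} u * emeasure M {\<omega> \<in> space M. d u \<omega> \<le> s})"
        by (simp add: mult_ac)
    qed
    also have "\<dots> = ennreal \<theta> * tail r * potential s"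
      unfolding potential_def by (rule nn_integral_cmult) measurable
    finally show ?thesis by (simp add: mult_ac)
  qed
  have g: "g = tail t + (\<integral>\<^sup>+u. ennreal \<theta> * indicator {0..} u * (\<integral>\<^sup>+w. weight w
        * emeasure M {\<omega> \<in> space M. d u \<omega> \<le> s \<and> t < d (max 0 u + max 0 w) \<omega>} \<partial>lborel) \<partial>lborel)"
    unfolding g_def by (rule expectation_exp_passage_gap[OF st E])
  have le1: "ennreal \<theta> * indicator {0..} u * (\<integral>\<^sup>+w. weight w
      * (emeasure M {\<omega> \<in> space M. d u \<omega> \<le> s} * emeasure M {\<omega> \<in> space M. t < d w \<omega>}) \<partial>lborel)
    \<le> ennreal \<theta> * indicator {0..} u * (\<integral>\<^sup>+w. weight w
        * emeasure M {\<omega> \<in> space M. d u \<omega> \<le> s \<and> t < d (max 0 u + max 0 w) \<omega>} \<partial>lborel)" for u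
  proof (cases "0 \<le> u")
    case True
    have "weight w * (emeasure M {\<omega> \<in> space M. d u \<omega> \<le> s} * emeasure M {\<omega> \<in> space M. t < d w \<omega>})
      \<le> weight w * emeasure M {\<omega> \<in> space M. d u \<omega> \<le> s \<and> t < d (max 0 u + max 0 w) \<omega>}" for w
      using joint_passage_bounds(1)[OF True, of w s t] True
      by (cases "0 \<le> w") (auto simp: weight_def emeasure_eq_measure ennreal_mult[symmetric] intro!: mult_left_mono)
    then show ?thesis by (intro mult_left_mono[OF nn_integral_mono] zero_le)
  qed simp
  have le2: "ennreal \<theta> * indicator {0..} u * (\<integral>\<^sup>+w. weight w
        * emeasure M {\<omega> \<in> space M. d u \<omega> \<le> s \<and> t < d (max 0 u + max 0 w) \<omega>} \<partial>lborel)
    \<le> ennreal \<theta> * indicator {0..} u * (\<integral>\<^sup>+w. weight w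
      * (emeasure M {\<omega> \<in> space M. d u \<omega> \<le> s} * emeasure M {\<omega> \<in> space M. t - s < d w \<omega>}) \<partial>lborel)" for u
  proof (cases "0 \<le> u")
    case True
    have "weight w * emeasure M {\<omega> \<in> space M. d u \<omega> \<le> s \<and> t < d (max 0 u + max 0 w) \<omega>}
      \<le> weight w * (emeasure M {\<omega> \<in> space M. d u \<omega> \<le> s} * emeasure M {\<omega> \<in> space M. t - s < d w \<omega>})" for w
      using joint_passage_bounds(2)[OF True, of w s t] True
      by (cases "0 \<le> w") (auto simp: weight_def emeasure_eq_measure ennreal_mult[symmetric] intro!: mult_left_mono)
    then show ?thesis by (intro mult_left_mono[OF nn_integral_mono] zero_le)
  qed simp
  show "tail t + ennreal \<theta> * potential s * tail t \<le> g"
    unfolding g prod by (intro add_left_mono nn_integral_mono le1)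
  show "g \<le> tail t + ennreal \<theta> * potential s * tail (t - s)"
    unfolding g prod by (intro add_left_mono nn_integral_mono le2)
qed

end

section \<open>Laplace transform and power decay of the tail\<close>

context laplace_subordinator
begin

lemma tail_antimono: "s \<le> t \<Longrightarrow> tail t \<le> tail s"
  unfolding tail_def by (intro nn_integral_mono mult_left_mono) (auto simp: indicator_def)

lemma tail_le_1: "tail t \<le> 1"
proof -
  have "tail t \<le> (\<integral>\<^sup>+\<omega>. 1 \<partial>M)"
    unfolding expectation_exp_passage[symmetric]
    using theta_pos inverse_subordinator_nonneg[of D t] by (intro nn_integral_mono) (simp add: ennreal_le_1)
  then show ?thesis using emeasure_space_1 by simp
qed

lemma tail_finite: "tail t < \<infinity>"
  using tail_le_1[of t] by (rule le_less_trans) simp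

lemma tail_measurable [measurable]: "tail \<in> borel_measurable borel"
proof -
  have [measurable]: "(\<lambda>(t, p). weight (fst p) * indicator {t<..} (d (fst p) (snd p))) \<in> borel_measurable (borel \<Otimes>\<^sub>M (lborel \<Otimes>\<^sub>M M))"
  proof -
    have "(\<lambda>(t, p). weight (fst p) * (if t < d (fst p) (snd p) then 1 else 0)) \<in> borel_measurable (borel \<Otimes>\<^sub>M (lborel \<Otimes>\<^sub>M M))"
      by measurable
    also have "(\<lambda>(t, p). weight (fst p) * (if t < d (fst p) (snd p) then 1 else 0)) = (\<lambda>(t, p). weight (fst p) * indicator {t<..} (d (fst p) (snd p)))"
      by (auto simp: indicator_def fun_eq_iff)
    finally show ?thesis .
  qed
  interpret pair_sigma_finite lborel M ..
  show ?thesis unfolding tail_def[abs_def] by measurable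
qed

lemma nn_expectation_exp_D_complement:
  assumes q: "0 < q" and w: "0 \<le> w"
  shows "(\<integral>\<^sup>+\<omega>. ennreal ((1 - exp (- q * d w \<omega>)) / q) \<partial>M) = ennreal ((1 - exp (- w * \<psi> q)) / q)"
proof -
  have i: "integrable M (\<lambda>\<omega>. (1 - exp (- q * d w \<omega>)) / q)"
    using exp_D_integrable[of q w] q w by (simp add: d_def max_absorb2)
  have e: "expectation (\<lambda>\<omega>. (1 - exp (- q * d w \<omega>)) / q) = (1 - exp (- w * \<psi> q)) / q"
    using exp_D_integrable[of q w] laplace[of q w] q w by (simp add: d_def max_absorb2 prob_space)
  show ?thesis
    unfolding e[symmetric]
  proof (rule nn_integral_eq_integral[OF i])
    show "AE \<omega> in M. 0 \<le> (1 - exp (- q * d w \<omega>)) / q"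
      using D_nonneg by eventually_elim (use q w in \<open>simp add: d_def\<close>)
  qed
qed

text \<open>Innermost of the three integrations for the transform of \<open>tail\<close>: level
  first, then path, then exponential time.\<close>

lemma nn_integral_exp_below:
  assumes q: "0 < q" and x: "0 \<le> x"
  shows "(\<integral>\<^sup>+t. ennreal (exp (- q * t)) * indicator {0<..} t * indicator {t<..} x \<partial>lborel) = ennreal ((1 - exp (- q * x)) / q)"
proof -
  have "(\<integral>\<^sup>+t. ennreal (exp (- q * t)) * indicator {0<..} t * indicator {t<..} x \<partial>lborel)
      = (\<integral>\<^sup>+t. ennreal (exp (- q * t)) * indicator {0..x} t \<partial>lborel)"
  proof (rule nn_integral_cong_AE)
    show "AE t in lborel. ennreal (exp (- q * t)) * indicator {0<..} t * indicator {t<..} x = ennreal (exp (- q * t)) * indicator {0..x} t"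
      using AE_lborel_singleton[of 0] AE_lborel_singleton[of x]
      by eventually_elim (auto simp: indicator_def)
  qed
  also have "\<dots> = ennreal ((- exp (- q * x) / q) - (- exp (- q * 0) / q))"
    using q x by (intro nn_integral_FTC_Icc) (auto intro!: derivative_eq_intros simp: has_real_derivative_iff_has_vector_derivative[symmetric])
  finally show ?thesis by (simp add: diff_divide_distrib)
qed

text \<open>An exponential time of rate \<open>\<theta>\<close> has Laplace transform
  \<open>\<theta> / (\<theta> + p)\<close>; its complement is
  \<open>p / (\<theta> + p)\<close>.\<close>

lemma nn_integral_weight_complement:
  assumes q: "0 < q" and p: "0 < p"
  shows "(\<integral>\<^sup>+w. weight w * ennreal ((1 - exp (- w * p)) / q) \<partial>lborel) = ennreal (p / (q * (\<theta> + p)))"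
proof -
  \<comment> \<open>The antiderivative that vanishes at infinity, so that the integral is minus its
    value at 0.\<close>
  define G where "G w = (- exp (- \<theta> * w) + \<theta> / (\<theta> + p) * exp (- (\<theta> + p) * w)) / q" for w
  have "(\<integral>\<^sup>+w. weight w * ennreal ((1 - exp (- w * p)) / q) \<partial>lborel)
      = (\<integral>\<^sup>+w. ennreal (\<theta> * exp (- \<theta> * w) * ((1 - exp (- w * p)) / q)) * indicator {0..} w \<partial>lborel)"
  proof (rule nn_integral_cong)
    fix w
    show "weight w * ennreal ((1 - exp (- w * p)) / q) = ennreal (\<theta> * exp (- \<theta> * w) * ((1 - exp (- w * p)) / q)) * indicator {0..} w"
      using q p theta_pos by (cases "0 \<le> w") (auto simp: weight_def ennreal_mult[symmetric])
  qed
  also have "\<dots> = ennreal (0 - G 0)"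
  proof (rule nn_integral_FTC_atLeast)
    have lim: "((\<lambda>w. exp (- r * w)) \<longlongrightarrow> 0) at_top" if "0 < r" for r :: real
      using that by real_asymp
    have "(G \<longlongrightarrow> (- 0 + \<theta> / (\<theta> + p) * 0) / q) at_top"
      unfolding G_def using theta_pos p q by (intro tendsto_intros lim) auto
    then show "(G \<longlongrightarrow> 0) at_top" by simp
    fix w :: real assume "0 \<le> w"
    then show "0 \<le> \<theta> * exp (- \<theta> * w) * ((1 - exp (- w * p)) / q)" using theta_pos p q by simp
    have e: "exp (- (\<theta> + p) * w) = exp (- \<theta> * w) * exp (- w * p)" by (simp add: exp_add[symmetric] algebra_simps)
    have "DERIV G w :> (\<theta> * exp (- \<theta> * w) + \<theta> / (\<theta> + p) * (- (\<theta> + p) * exp (- (\<theta> + p) * w))) / q"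
      unfolding G_def by (rule derivative_eq_intros refl | simp add: q less_imp_neq[OF q, symmetric])+
    also have "(\<theta> * exp (- \<theta> * w) + \<theta> / (\<theta> + p) * (- (\<theta> + p) * exp (- (\<theta> + p) * w))) / q
        = \<theta> * exp (- \<theta> * w) * ((1 - exp (- w * p)) / q)"
    proof -
      have "\<theta> / (\<theta> + p) * (- (\<theta> + p) * exp (- (\<theta> + p) * w)) = - \<theta> * exp (- (\<theta> + p) * w)"
      proof -
        have "\<theta> / c * (- c * x) = - \<theta> * x" if "c \<noteq> 0" for c x :: real using that by simp
        from this[of "\<theta> + p"] show ?thesis using theta_pos p by simp
      qed
      then show ?thesis unfolding e by (simp add: algebra_simps)
    qed
    finally show "DERIV G w :> \<theta> * exp (- \<theta> * w) * ((1 - exp (- w * p)) / q)" .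
  qed measurable
  also have "0 - G 0 = p / (q * (\<theta> + p))"
    using theta_pos p q by (simp add: G_def divide_simps)
  finally show ?thesis .
qed

text \<open>Tonelli moves the level integral inside; the definition of \<open>\<psi>\<close> as
  Laplace exponent then evaluates the expectation at each fixed time.\<close>

lemma nn_laplace_tail:
  assumes q: "0 < q"
  shows "(\<integral>\<^sup>+t. ennreal (exp (- q * t)) * indicator {0<..} t * tail t \<partial>lborel) = ennreal (\<psi> q / (q * (\<theta> + \<psi> q)))"
proof -
  interpret L: pair_sigma_finite lborel M ..
  interpret N: sigma_finite_measure "lborel \<Otimes>\<^sub>M M" by (rule L.sigma_finite_measure_axioms)
  interpret LN: pair_sigma_finite lborel "lborel \<Otimes>\<^sub>M M" ..
  define A where "A t = ennreal (exp (- q * t)) * indicator {0<..} t" for t :: real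
  have [measurable]: "A \<in> borel_measurable borel" unfolding A_def by measurable
  have ind [measurable]: "(\<lambda>x. indicator {fst x<..} (d (fst (snd x)) (snd (snd x))) :: ennreal) \<in> borel_measurable (lborel \<Otimes>\<^sub>M (lborel \<Otimes>\<^sub>M M))"
  proof -
    have "(\<lambda>x. if fst x < d (fst (snd x)) (snd (snd x)) then 1 else 0 :: ennreal) \<in> borel_measurable (lborel \<Otimes>\<^sub>M (lborel \<Otimes>\<^sub>M M))"
      by measurable
    then show ?thesis by (simp add: indicator_def)
  qed
  have jm: "(\<lambda>(t, p). A t * (weight (fst p) * indicator {t<..} (d (fst p) (snd p)))) \<in> borel_measurable (lborel \<Otimes>\<^sub>M (lborel \<Otimes>\<^sub>M M))"
    unfolding case_prod_beta by measurable
  have "(\<integral>\<^sup>+t. A t * tail t \<partial>lborel) = (\<integral>\<^sup>+t. (\<integral>\<^sup>+p. A t * (weight (fst p) * indicator {t<..} (d (fst p) (snd p))) \<partial>(lborel \<Otimes>\<^sub>M M)) \<partial>lborel)"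
    unfolding tail_def by (intro nn_integral_cong nn_integral_cmult[symmetric]) measurable
  also have "\<dots> = (\<integral>\<^sup>+p. (\<integral>\<^sup>+t. A t * (weight (fst p) * indicator {t<..} (d (fst p) (snd p))) \<partial>lborel) \<partial>(lborel \<Otimes>\<^sub>M M))"
    by (rule LN.Fubini'[OF jm, symmetric])
  also have "\<dots> = (\<integral>\<^sup>+p. weight (fst p) * (\<integral>\<^sup>+t. A t * indicator {t<..} (d (fst p) (snd p)) \<partial>lborel) \<partial>(lborel \<Otimes>\<^sub>M M))"
  proof (rule nn_integral_cong)
    fix p :: "real \<times> 'a"
    have "(\<lambda>t. indicator {t<..} (d (fst p) (snd p)) :: ennreal) = indicator {..<d (fst p) (snd p)}"
      by (auto simp: indicator_def)
    then have [measurable]: "(\<lambda>t. indicator {t<..} (d (fst p) (snd p)) :: ennreal) \<in> borel_measurable borel" by simp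
    show "(\<integral>\<^sup>+t. A t * (weight (fst p) * indicator {t<..} (d (fst p) (snd p))) \<partial>lborel)
        = weight (fst p) * (\<integral>\<^sup>+t. A t * indicator {t<..} (d (fst p) (snd p)) \<partial>lborel)"
      by (subst nn_integral_cmult[symmetric]) (auto simp: mult_ac)
  qed
  also have "\<dots> = (\<integral>\<^sup>+w. (\<integral>\<^sup>+\<omega>. weight w * (\<integral>\<^sup>+t. A t * indicator {t<..} (d w \<omega>) \<partial>lborel) \<partial>M) \<partial>lborel)"
  proof -
    have "(\<lambda>(p, t). A t * indicator {t<..} (d (fst p) (snd p))) \<in> borel_measurable ((lborel \<Otimes>\<^sub>M M) \<Otimes>\<^sub>M lborel)"
    proof -
      have "(\<lambda>(p, t). A t * (if t < d (fst p) (snd p) then 1 else 0)) \<in> borel_measurable ((lborel \<Otimes>\<^sub>M M) \<Otimes>\<^sub>M lborel)"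
        unfolding case_prod_beta by measurable
      then show ?thesis by (simp add: indicator_def)
    qed
    from lborel.borel_measurable_nn_integral[OF this]
    have m: "(\<lambda>p. weight (fst p) * (\<integral>\<^sup>+t. A t * indicator {t<..} (d (fst p) (snd p)) \<partial>lborel)) \<in> borel_measurable (lborel \<Otimes>\<^sub>M M)"
      by measurable
    show ?thesis using nn_integral_fst[OF m] by simp
  qed
  also have "\<dots> = (\<integral>\<^sup>+w. weight w * ennreal ((1 - exp (- w * \<psi> q)) / q) \<partial>lborel)"
  proof (rule nn_integral_cong)
    fix w
    show "(\<integral>\<^sup>+\<omega>. weight w * (\<integral>\<^sup>+t. A t * indicator {t<..} (d w \<omega>) \<partial>lborel) \<partial>M) = weight w * ennreal ((1 - exp (- w * \<psi> q)) / q)"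
    proof (cases "0 \<le> w")
      case True
      have "(\<integral>\<^sup>+\<omega>. weight w * (\<integral>\<^sup>+t. A t * indicator {t<..} (d w \<omega>) \<partial>lborel) \<partial>M)
          = (\<integral>\<^sup>+\<omega>. weight w * ennreal ((1 - exp (- q * d w \<omega>)) / q) \<partial>M)"
      proof (rule nn_integral_cong_AE)
        show "AE \<omega> in M. weight w * (\<integral>\<^sup>+t. A t * indicator {t<..} (d w \<omega>) \<partial>lborel) = weight w * ennreal ((1 - exp (- q * d w \<omega>)) / q)"
          using D_nonneg
        proof eventually_elim
          case (elim \<omega>)
          then have "0 \<le> d w \<omega>" by (simp add: d_def)
          from nn_integral_exp_below[OF q this] show ?case by (simp add: A_def)
        qed
      qed
      also have "\<dots> = weight w * ennreal ((1 - exp (- w * \<psi> q)) / q)"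
        using nn_expectation_exp_D_complement[OF q True] by (subst nn_integral_cmult) auto
      finally show ?thesis .
    qed (simp add: weight_def)
  qed
  also have "\<dots> = ennreal (\<psi> q / (q * (\<theta> + \<psi> q)))"
    by (rule nn_integral_weight_complement[OF q psi_pos[OF q]])
  finally show ?thesis by (simp add: A_def)
qed

lemma laplace_tail:
  assumes q: "0 < q"
  shows "set_integrable lborel {0<..} (\<lambda>t. exp (- q * t) * enn2real (tail t))"
    and "(LINT t:{0<..}|lborel. exp (- q * t) * enn2real (tail t)) = \<psi> q / (q * (\<theta> + \<psi> q))"
proof -
  have "has_bochner_integral lborel (\<lambda>t. indicator {0<..} t *\<^sub>R (exp (- q * t) * enn2real (tail t))) (\<psi> q / (q * (\<theta> + \<psi> q)))"
  proof (rule has_bochner_integral_nn_integral)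
    have "(\<integral>\<^sup>+t. ennreal (indicator {0<..} t *\<^sub>R (exp (- q * t) * enn2real (tail t))) \<partial>lborel)
        = (\<integral>\<^sup>+t. ennreal (exp (- q * t)) * indicator {0<..} t * tail t \<partial>lborel)"
      using tail_finite by (intro nn_integral_cong) (auto simp: indicator_def ennreal_mult)
    then show "(\<integral>\<^sup>+t. ennreal (indicator {0<..} t *\<^sub>R (exp (- q * t) * enn2real (tail t))) \<partial>lborel) = ennreal (\<psi> q / (q * (\<theta> + \<psi> q)))"
      using nn_laplace_tail[OF q] by simp
    show "0 \<le> \<psi> q / (q * (\<theta> + \<psi> q))" using q psi_pos[OF q] theta_pos by simp
  qed auto
  then show "set_integrable lborel {0<..} (\<lambda>t. exp (- q * t) * enn2real (tail t))"
    and "(LINT t:{0<..}|lborel. exp (- q * t) * enn2real (tail t)) = \<psi> q / (q * (\<theta> + \<psi> q))"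
    by (auto simp: set_integrable_def set_lebesgue_integral_def intro: integrable.intros has_bochner_integral_integral_eq)
qed

text \<open>Multiplied by \<open>q powr (1 - b)\<close>, the transform becomes
  \<open>(\<psi> q / q powr b) / (\<theta> + \<psi> q)\<close>, which tends to
  \<open>c / \<theta>\<close>; \<open>tail\<close> is monotone, so the Tauberian theorem
  applies.\<close>

lemma tail_asymptotics:
  assumes b: "b < 1" and lim: "((\<lambda>q. \<psi> q / q powr b) \<longlongrightarrow> c) (at_right 0)" and psi0: "(\<psi> \<longlongrightarrow> 0) (at_right 0)"
  shows "((\<lambda>t. t powr b * enn2real (tail t)) \<longlongrightarrow> c / \<theta> / Gamma (1 - b)) at_top"
proof (rule karamata_tauberian_monotone[OF _ _ b laplace_tail(1)])
  show "enn2real (tail t) \<le> enn2real (tail s)" if "s \<le> t" for s t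
    using tail_antimono[OF that] tail_finite by (intro enn2real_mono) auto
  have "((\<lambda>q. (\<psi> q / q powr b) / (\<theta> + \<psi> q)) \<longlongrightarrow> c / (\<theta> + 0)) (at_right 0)"
    using theta_pos by (intro tendsto_intros lim psi0) auto
  then have "((\<lambda>q. (\<psi> q / q powr b) / (\<theta> + \<psi> q)) \<longlongrightarrow> c / \<theta>) (at_right 0)" by simp
  then show "((\<lambda>q. q powr (1 - b) * (LINT t:{0<..}|lborel. exp (- q * t) * enn2real (tail t))) \<longlongrightarrow> c / \<theta>) (at_right 0)"
  proof (rule Lim_transform_eventually)
    show "\<forall>\<^sub>F q in at_right 0. (\<psi> q / q powr b) / (\<theta> + \<psi> q) = q powr (1 - b) * (LINT t:{0<..}|lborel. exp (- q * t) * enn2real (tail t))"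
      using eventually_at_right_less[of 0]
    proof eventually_elim
      case (elim q)
      then show ?case unfolding laplace_tail(2)[OF elim] by (simp add: powr_diff)
    qed
  qed
qed auto

section \<open>The occupation measure of \<open>D\<close> and its identification with
  \<open>h\<close>\<close>

definition potential_measure :: "real measure" where
  "potential_measure = distr (density (lborel \<Otimes>\<^sub>M M) (\<lambda>p. indicator {0..} (fst p))) borel (\<lambda>p. d (fst p) (snd p))"

lemma nn_integral_potential_measure:
  assumes f [measurable]: "f \<in> borel_measurable borel"
  shows "(\<integral>\<^sup>+y. f y \<partial>potential_measure) = (\<integral>\<^sup>+u. indicator {0..} u * (\<integral>\<^sup>+\<omega>. f (d u \<omega>) \<partial>M) \<partial>lborel)"
proof -
  have "(\<integral>\<^sup>+y. f y \<partial>potential_measure) = (\<integral>\<^sup>+p. indicator {0..} (fst p) * f (d (fst p) (snd p)) \<partial>(lborel \<Otimes>\<^sub>M M))"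
    unfolding potential_measure_def by (subst nn_integral_distr, simp, simp, subst nn_integral_density) auto
  also have "\<dots> = (\<integral>\<^sup>+u. (\<integral>\<^sup>+\<omega>. indicator {0..} u * f (d u \<omega>) \<partial>M) \<partial>lborel)"
    by (subst nn_integral_fst[symmetric]) auto
  also have "\<dots> = (\<integral>\<^sup>+u. indicator {0..} u * (\<integral>\<^sup>+\<omega>. f (d u \<omega>) \<partial>M) \<partial>lborel)"
    by (intro nn_integral_cong nn_integral_cmult) measurable
  finally show ?thesis .
qed

text \<open>The expectation of \<open>exp (- q * D u)\<close> is
  \<open>exp (- u * \<psi> q)\<close>, whose integral over \<open>u\<close> is
  \<open>1 / \<psi> q\<close>. The indicator is needed because uniqueness speaks of functions
  vanishing on the negatives, while \<open>D\<close> is nonnegative only almost surely.\<close>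

lemma laplace_potential:
  assumes q: "0 < q"
  shows "has_bochner_integral potential_measure (\<lambda>y. exp (- q * y) * indicator {0..} y) (1 / \<psi> q)"
proof (rule has_bochner_integral_nn_integral)
  have p: "0 < \<psi> q" by (rule psi_pos[OF q])
  show "(\<lambda>y. exp (- q * y) * indicator {0..} y) \<in> borel_measurable potential_measure"
    unfolding potential_measure_def by measurable
  have "(\<integral>\<^sup>+y. ennreal (exp (- q * y) * indicator {0..} y) \<partial>potential_measure)
      = (\<integral>\<^sup>+u. indicator {0..} u * (\<integral>\<^sup>+\<omega>. ennreal (exp (- q * d u \<omega>) * indicator {0..} (d u \<omega>)) \<partial>M) \<partial>lborel)"
    by (rule nn_integral_potential_measure) measurable
  also have "\<dots> = (\<integral>\<^sup>+u. ennreal (1 / \<psi> q) * (ennreal (\<psi> q * exp (- \<psi> q * u)) * indicator {0..} u) \<partial>lborel)"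
  proof (rule nn_integral_cong)
    fix u :: real
    show "indicator {0..} u * (\<integral>\<^sup>+\<omega>. ennreal (exp (- q * d u \<omega>) * indicator {0..} (d u \<omega>)) \<partial>M)
        = ennreal (1 / \<psi> q) * (ennreal (\<psi> q * exp (- \<psi> q * u)) * indicator {0..} u)"
    proof (cases "0 \<le> u")
      case True
      have "(\<integral>\<^sup>+\<omega>. ennreal (exp (- q * d u \<omega>) * indicator {0..} (d u \<omega>)) \<partial>M) = (\<integral>\<^sup>+\<omega>. ennreal (exp (- q * D u \<omega>)) \<partial>M)"
      proof (rule nn_integral_cong_AE)
        show "AE \<omega> in M. ennreal (exp (- q * d u \<omega>) * indicator {0..} (d u \<omega>)) = ennreal (exp (- q * D u \<omega>))"
          using D_nonneg by eventually_elim (use True in \<open>simp add: d_def\<close>)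
      qed
      also have "\<dots> = ennreal (exp (- u * \<psi> q))" using q True by (intro nn_expectation_exp_D) auto
      also have "\<dots> = ennreal (1 / \<psi> q) * ennreal (\<psi> q * exp (- \<psi> q * u))"
        using p by (simp add: ennreal_mult[symmetric] mult.commute)
      finally show ?thesis using True by simp
    qed simp
  qed
  also have "\<dots> = ennreal (1 / \<psi> q)"
    using nn_integral_exp_tail[OF p, of 0] by (subst nn_integral_cmult) auto
  finally show "(\<integral>\<^sup>+y. ennreal (exp (- q * y) * indicator {0..} y) \<partial>potential_measure) = ennreal (1 / \<psi> q)" .
  show "0 \<le> 1 / \<psi> q" using p by simp
qed auto

text \<open>The potential is the distribution function of the occupation measure, which connects it
  with Laplace transforms.\<close>

lemma potential_eq_measure: "potential s = (\<integral>\<^sup>+y. ennreal (indicator {..s} y * indicator {0..} y) \<partial>potential_measure)"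
proof -
  have "(\<integral>\<^sup>+y. ennreal (indicator {..s} y * indicator {0..} y) \<partial>potential_measure)
      = (\<integral>\<^sup>+u. indicator {0..} u * (\<integral>\<^sup>+\<omega>. ennreal (indicator {..s} (d u \<omega>) * indicator {0..} (d u \<omega>)) \<partial>M) \<partial>lborel)"
    by (rule nn_integral_potential_measure) measurable
  also have "\<dots> = potential s"
    unfolding potential_def
  proof (rule nn_integral_cong)
    fix u :: real
    show "indicator {0..} u * (\<integral>\<^sup>+\<omega>. ennreal (indicator {..s} (d u \<omega>) * indicator {0..} (d u \<omega>)) \<partial>M)
        = indicator {0..} u * emeasure M {\<omega> \<in> space M. d u \<omega> \<le> s}"
    proof (cases "0 \<le> u")
      case True
      have "(\<integral>\<^sup>+\<omega>. ennreal (indicator {..s} (d u \<omega>) * indicator {0..} (d u \<omega>)) \<partial>M)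
          = (\<integral>\<^sup>+\<omega>. indicator {\<omega> \<in> space M. d u \<omega> \<le> s} \<omega> \<partial>M)"
      proof (rule nn_integral_cong_AE)
        show "AE \<omega> in M. ennreal (indicator {..s} (d u \<omega>) * indicator {0..} (d u \<omega>)) = indicator {\<omega> \<in> space M. d u \<omega> \<le> s} \<omega>"
          using D_nonneg AE_space by eventually_elim (auto simp: d_def indicator_def)
      qed
      then show ?thesis by simp
    qed simp
  qed
  finally show ?thesis by simp
qed

text \<open>On \<open>y \<le> s\<close> the indicator is at most \<open>exp s * exp (- y)\<close>,
  whose integral is \<open>exp s / \<psi> 1\<close>.\<close>

lemma potential_finite: "potential s < \<infinity>"
proof -
  have "potential s \<le> (\<integral>\<^sup>+y. ennreal (exp s * (exp (- 1 * y) * indicator {0..} y)) \<partial>potential_measure)"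
    unfolding potential_eq_measure
  proof (rule nn_integral_mono, rule ennreal_leI)
    fix y :: real
    have "1 \<le> exp s * exp (- 1 * y)" if "y \<le> s" using that by (simp add: exp_add[symmetric])
    then show "indicator {..s} y * indicator {0..} y \<le> exp s * (exp (- 1 * y) * indicator {0..} y)"
      by (auto simp: indicator_def)
  qed
  also have "\<dots> < \<infinity>"
  proof -
    have i: "integrable potential_measure (\<lambda>y. exp s * (exp (- 1 * y) * indicator {0..} y))"
      using laplace_potential[of 1] by (intro integrable_mult_right) (auto simp: integrable.simps)
    have "(\<integral>\<^sup>+y. ennreal (exp s * (exp (- 1 * y) * indicator {0..} y)) \<partial>potential_measure)
        = ennreal (\<integral>y. exp s * (exp (- 1 * y) * indicator {0..} y) \<partial>potential_measure)"
      by (rule nn_integral_eq_integral[OF i]) auto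
    then show ?thesis by simp
  qed
  finally show ?thesis .
qed

text \<open>Both sides have transform \<open>1 / \<psi>\<close> at all positive integers. Uniqueness
  allows signed integrands, so no sign of \<open>h\<close> enters.\<close>

lemma potential_eq_integral:
  fixes h :: "real \<Rightarrow> real"
  assumes h: "\<And>q. 0 < q \<Longrightarrow> set_integrable lborel {0<..} (\<lambda>y. exp (- q * y) * h y)"
    "\<And>q. 0 < q \<Longrightarrow> (LINT y:{0<..}|lborel. exp (- q * y) * h y) = 1 / \<psi> q"
  shows "enn2real (potential s) = (LINT y:{0<..<s}|lborel. h y)"
proof -
  have h_int: "integrable lborel (\<lambda>y. exp (- q * y) * (indicator {0<..} y * h y))" if "0 < q" for q
    using h(1)[OF that] by (simp add: set_integrable_def mult_ac)
  have h_val: "(\<integral>y. exp (- q * y) * (indicator {0<..} y * h y) \<partial>lborel) = 1 / \<psi> q" if "0 < q" for q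
    using h(2)[OF that] by (simp add: set_lebesgue_integral_def mult_ac)
  have [measurable]: "(\<lambda>y. indicator {0<..} y * h y) \<in> borel_measurable borel"
  proof -
    have "(\<lambda>y. exp y * (exp (- 1 * y) * (indicator {0<..} y * h y))) \<in> borel_measurable lborel"
      using borel_measurable_integrable[OF h_int[of 1]] by measurable
    then show ?thesis by (simp add: mult.assoc[symmetric] exp_add[symmetric])
  qed
  have p: "has_bochner_integral potential_measure (\<lambda>y. exp (- q * y) * indicator {0..} y) (1 / \<psi> q)" if "0 < q" for q
    by (rule laplace_potential[OF that])
  have "enn2real (potential s) = (\<integral>y. indicator {..s} y * indicator {0..} y \<partial>potential_measure)"
    unfolding potential_eq_measure by (rule integral_eq_nn_integral[symmetric]) (auto simp: potential_measure_def)
  also have "\<dots> = (\<integral>y. indicator {..s} y * (indicator {0<..} y * h y) \<partial>lborel)"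
  proof (rule laplace_transform_unique_integral)
    show "sets potential_measure = sets borel" by (simp add: potential_measure_def)
    show "integrable potential_measure (\<lambda>y. exp (- y) * indicator {0..} y)"
      using p[of 1] by (auto simp: integrable.simps)
    show "integrable lborel (\<lambda>y. exp (- y) * (indicator {0<..} y * h y))" using h_int[of 1] by simp
    show "(\<integral>y. exp (- real (Suc i) * y) * indicator {0..} y \<partial>potential_measure)
        = (\<integral>y. exp (- real (Suc i) * y) * (indicator {0<..} y * h y) \<partial>lborel)" for i
      using has_bochner_integral_integral_eq[OF p[of "real (Suc i)"]] h_val[of "real (Suc i)"] by simp
  qed auto
  \<comment> \<open>Up to the null point \<open>s\<close>, the half line below \<open>s\<close> and
    the open interval select the same positive arguments.\<close>
  also have "\<dots> = (\<integral>y. indicator {0<..<s} y * (indicator {0<..} y * h y) \<partial>lborel)"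
  proof (rule integral_cong_AE)
    show "AE y in lborel. indicator {..s} y * (indicator {0<..} y * h y) = indicator {0<..<s} y * (indicator {0<..} y * h y)"
      using AE_lborel_singleton[of s] by eventually_elim (auto simp: indicator_def)
  qed measurable
  also have "\<dots> = (LINT y:{0<..<s}|lborel. h y)"
    unfolding set_lebesgue_integral_def by (rule Bochner_Integration.integral_cong) (auto simp: indicator_def)
  finally show ?thesis .
qed

end

section \<open>The time-changed Pearson diffusion\<close>

text \<open>Subtracting \<open>c * harm H\<close> absorbs the first \<open>H\<close> terms, where
  only nonnegativity is known; the rest is compared with the harmonic series.\<close>

lemma sum_at_top_of_harmonic_bound:
  fixes f :: "nat \<Rightarrow> real"
  assumes nonneg: "\<And>h. 0 \<le> f h" and c: "0 < c" and bound: "\<And>h. H \<le> h \<Longrightarrow> c / real h \<le> f h"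
  shows "filterlim (\<lambda>N. \<Sum>h=1..N. f h) at_top sequentially"
proof -
  have *: "c * harm N - c * harm H \<le> (\<Sum>h=1..N. f h)" for N
  proof (induction N)
    case 0
    have "(0::real) \<le> harm H" by (rule harm_nonneg)
    then show ?case using c by (simp add: harm_expand)
  next
    case (Suc N)
    show ?case
    proof (cases "Suc N \<le> H")
      case True
      then have "harm (Suc N) \<le> (harm H :: real)" by (rule harm_mono)
      then have "c * harm (Suc N) \<le> c * harm H" using c by simp
      then show ?thesis using sum_nonneg[of "{1..Suc N}" f] nonneg by simp
    next
      case False
      then show ?thesis using Suc bound[of "Suc N"] by (simp add: harm_Suc distrib_left divide_inverse)
    qed
  qed
  have "filterlim (\<lambda>N. - (c * harm H) + c * harm N) at_top sequentially"
    using c by (intro filterlim_tendsto_add_at_top[OF tendsto_const] filterlim_tendsto_pos_mult_at_top[OF tendsto_const] harm_at_top)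
  then show ?thesis
    by (rule filterlim_at_top_mono) (use * in \<open>simp add: algebra_simps\<close>)
qed

text \<open>After division by \<open>q powr \<beta> 1\<close> every other term carries a positive
  power of \<open>q\<close> and vanishes at 0.\<close>

lemma power_sum_exponent:
  fixes c \<beta> :: "nat \<Rightarrow> real" and \<psi> :: "real \<Rightarrow> real"
  assumes n: "1 \<le> n" and b1: "0 < \<beta> 1" and mono: "strict_mono_on {1..n} \<beta>"
    and c1: "0 < c 1" and c: "\<forall>i\<in>{2..n}. 0 \<le> c i"
    and \<psi>_def: "\<psi> = (\<lambda>s. \<Sum>i=1..n. c i * s powr \<beta> i)"
  shows "0 < s \<Longrightarrow> 0 < \<psi> s" "((\<lambda>q. \<psi> q / q powr \<beta> 1) \<longlongrightarrow> c 1) (at_right 0)" "(\<psi> \<longlongrightarrow> 0) (at_right 0)"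
proof -
  have set: "{1..n} = insert 1 {2..n}" using n by auto
  have \<psi>: "\<psi> q = c 1 * q powr \<beta> 1 + (\<Sum>i=2..n. c i * q powr \<beta> i)" for q
    unfolding \<psi>_def set by (subst sum.insert) auto
  have b: "\<beta> 1 < \<beta> i" if "i \<in> {2..n}" for i
    using that strict_mono_onD[OF mono, of 1 i] by auto
  have lim: "((\<lambda>q. q powr r) \<longlongrightarrow> 0) (at_right 0)" if "0 < r" for r :: real
    using that by real_asymp
  show "0 < \<psi> s" if "0 < s"
    unfolding \<psi> using that c1 c by (intro add_pos_nonneg sum_nonneg mult_nonneg_nonneg) auto
  have "(\<psi> \<longlongrightarrow> c 1 * 0 + (\<Sum>i=2..n. c i * 0)) (at_right 0)"
    unfolding \<psi>[abs_def] using b b1 by (intro tendsto_intros lim) (auto intro: less_trans)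
  then show "(\<psi> \<longlongrightarrow> 0) (at_right 0)" by simp
  have "((\<lambda>q. c 1 + (\<Sum>i=2..n. c i * q powr (\<beta> i - \<beta> 1))) \<longlongrightarrow> c 1 + (\<Sum>i=2..n. c i * 0)) (at_right 0)"
    using b by (intro tendsto_intros lim) auto
  then have "((\<lambda>q. c 1 + (\<Sum>i=2..n. c i * q powr (\<beta> i - \<beta> 1))) \<longlongrightarrow> c 1) (at_right 0)" by simp
  then show "((\<lambda>q. \<psi> q / q powr \<beta> 1) \<longlongrightarrow> c 1) (at_right 0)"
  proof (rule Lim_transform_eventually)
    show "\<forall>\<^sub>F q in at_right 0. c 1 + (\<Sum>i=2..n. c i * q powr (\<beta> i - \<beta> 1)) = \<psi> q / q powr \<beta> 1"
      using eventually_at_right_less[of 0]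
    proof eventually_elim
      case (elim q)
      then show ?case by (simp add: \<psi> powr_diff add_divide_distrib sum_divide_distrib)
    qed
  qed
qed

text \<open>A fixed shift is invisible at this scale because \<open>t / (t - s)\<close> tends to
  1.\<close>

lemma powr_mult_shift_tendsto:
  fixes f :: "real \<Rightarrow> real"
  assumes "((\<lambda>t. t powr b * f t) \<longlongrightarrow> L) at_top"
  shows "((\<lambda>t. t powr b * f (t - s)) \<longlongrightarrow> L) at_top"
proof -
  have "filterlim (\<lambda>t::real. t - s) at_top at_top" by real_asymp
  from filterlim_compose[OF assms this]
  have 1: "((\<lambda>t. (t - s) powr b * f (t - s)) \<longlongrightarrow> L) at_top" .
  have "((\<lambda>t. t / (t - s)) \<longlongrightarrow> 1) at_top" by real_asymp
  then have "((\<lambda>t. (t / (t - s)) powr b) \<longlongrightarrow> 1 powr b) at_top" by (intro tendsto_intros) auto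
  from tendsto_mult[OF this 1]
  have "((\<lambda>t. (t / (t - s)) powr b * ((t - s) powr b * f (t - s))) \<longlongrightarrow> L) at_top" by simp
  then show ?thesis
  proof (rule Lim_transform_eventually)
    show "\<forall>\<^sub>F t in at_top. (t / (t - s)) powr b * ((t - s) powr b * f (t - s)) = t powr b * f (t - s)"
      using eventually_gt_at_top[of "max 0 s"]
    proof eventually_elim
      case (elim t)
      then have "(t / (t - s)) powr b * (t - s) powr b = t powr b" by (simp add: powr_mult[symmetric])
      then show ?case by (simp only: mult.assoc[symmetric])
    qed
  qed
qed

text \<open>For frozen times the mean and variance of \<open>X\<close> are constants, so the random
  time leaves them unchanged and only the covariance keeps a dependence on \<open>E\<close>.\<close>

lemma (in prob_space) correlation_time_change:
  fixes X E :: "real \<Rightarrow> 'a \<Rightarrow> real"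
  assumes ind: "indep_processes M E X"
    and cont: "\<And>\<omega>. \<omega> \<in> space M \<Longrightarrow> continuous_on {0..} (\<lambda>t. X t \<omega>)"
    and E: "\<And>t \<omega>. 0 \<le> t \<Longrightarrow> \<omega> \<in> space M \<Longrightarrow> 0 \<le> E t \<omega>"
    and XM: "\<And>t. 0 \<le> t \<Longrightarrow> X t \<in> borel_measurable M"
    and mean: "\<And>t. 0 \<le> t \<Longrightarrow> expectation (X t) = \<mu>"
    and sq: "\<And>t. 0 \<le> t \<Longrightarrow> integrable M (\<lambda>\<omega>. (X t \<omega> - \<mu>)\<^sup>2)"
    and cov: "\<And>s t. 0 \<le> s \<Longrightarrow> 0 \<le> t \<Longrightarrow> expectation (\<lambda>\<omega>. (X t \<omega> - \<mu>) * (X s \<omega> - \<mu>)) = V * \<rho> (t - s)"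
    and V: "0 < V" and \<rho>0: "\<rho> 0 = 1"
    and t: "0 \<le> t" "0 \<le> s"
  shows "correlation M (\<lambda>\<omega>. X (E t \<omega>) \<omega>) (\<lambda>\<omega>. X (E s \<omega>) \<omega>) = expectation (\<lambda>\<omega>. \<rho> (E t \<omega> - E s \<omega>))"
proof -
  have var: "expectation (\<lambda>\<omega>. (X u \<omega> - \<mu>)\<^sup>2) = V" if "0 \<le> u" for u
    using cov[OF that that] \<rho>0 by (simp add: power2_eq_square)
  have Xi: "integrable M (\<lambda>\<omega>. X u \<omega> - \<mu>)" if "0 \<le> u" for u
    using square_integrable_mult[OF _ borel_measurable_const sq[OF that], of 1] XM[OF that] by simp
  have Xi': "integrable M (X u)" if "0 \<le> u" for u
    using Bochner_Integration.integrable_add[OF Xi[OF that], of "\<lambda>_. \<mu>"] by simp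
  \<comment> \<open>One majorant serves the mean, the variance and the covariance; its expectation
    is \<open>1 + 2 * V\<close> at every pair of times.\<close>
  have bound: "(\<integral>\<^sup>+\<omega>. ennreal \<bar>g (X u \<omega>, X v \<omega>)\<bar> \<partial>M) \<le> ennreal (1 + 2 * V)"
    if g: "\<And>x y. \<bar>g (x, y)\<bar> \<le> 1 + (x - \<mu>)\<^sup>2 + (y - \<mu>)\<^sup>2" and uv: "0 \<le> u" "0 \<le> v" for g :: "real \<times> real \<Rightarrow> real" and u v
  proof -
    have "(\<integral>\<^sup>+\<omega>. ennreal \<bar>g (X u \<omega>, X v \<omega>)\<bar> \<partial>M) \<le> (\<integral>\<^sup>+\<omega>. ennreal (1 + (X u \<omega> - \<mu>)\<^sup>2 + (X v \<omega> - \<mu>)\<^sup>2) \<partial>M)"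
      by (intro nn_integral_mono ennreal_leI g)
    also have "\<dots> = ennreal (expectation (\<lambda>\<omega>. 1 + (X u \<omega> - \<mu>)\<^sup>2 + (X v \<omega> - \<mu>)\<^sup>2))"
      using sq uv by (intro nn_integral_eq_integral) auto
    also have "expectation (\<lambda>\<omega>. 1 + (X u \<omega> - \<mu>)\<^sup>2 + (X v \<omega> - \<mu>)\<^sup>2) = 1 + 2 * V"
      using sq uv var by (simp add: prob_space)
    finally show ?thesis .
  qed
  have g1: "\<bar>fst (x, y) - \<mu>\<bar> \<le> 1 + (x - \<mu>)\<^sup>2 + (y - \<mu>)\<^sup>2" for x y :: real
  proof -
    have "\<bar>x - \<mu>\<bar> \<le> 1 + (x - \<mu>)\<^sup>2"
    proof -
      have "2 * \<bar>x - \<mu>\<bar> * 1 \<le> \<bar>x - \<mu>\<bar>\<^sup>2 + 1\<^sup>2" by (rule sum_squares_bound)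
      then have le: "2 * \<bar>x - \<mu>\<bar> \<le> (x - \<mu>)\<^sup>2 + 1" by simp
      have "a \<le> 1 + z" if "2 * a \<le> z + 1" "0 \<le> a" for a z :: real using that by linarith
      from this[OF le abs_ge_zero] show ?thesis .
    qed
    then show ?thesis unfolding fst_conv by (rule add_increasing2[OF zero_le_power2])
  qed
  have g2: "\<bar>(fst (x, y) - \<mu>)\<^sup>2\<bar> \<le> 1 + (x - \<mu>)\<^sup>2 + (y - \<mu>)\<^sup>2" for x y :: real by simp
  have g3: "\<bar>(fst (x, y) - \<mu>) * (snd (x, y) - \<mu>)\<bar> \<le> 1 + (x - \<mu>)\<^sup>2 + (y - \<mu>)\<^sup>2" for x y :: real
    using sum_squares_bound[of "\<bar>x - \<mu>\<bar>" "\<bar>y - \<mu>\<bar>"] mult_nonneg_nonneg[OF abs_ge_zero[of "x - \<mu>"] abs_ge_zero[of "y - \<mu>"]]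
    unfolding power2_abs abs_mult fst_conv snd_conv by linarith
  have [measurable]: "fst \<in> borel_measurable (borel :: (real \<times> real) measure)"
    "snd \<in> borel_measurable (borel :: (real \<times> real) measure)"
    by (auto intro!: borel_measurable_continuous_onI continuous_intros)
  have gm: "(\<lambda>p. fst p - \<mu>) \<in> borel_measurable (borel :: (real \<times> real) measure)"
    "(\<lambda>p. (fst p - \<mu>)\<^sup>2) \<in> borel_measurable (borel :: (real \<times> real) measure)"
    "(\<lambda>p. (fst p - \<mu>) * (snd p - \<mu>)) \<in> borel_measurable (borel :: (real \<times> real) measure)"
    by measurable
  note tc = time_change_expectation[OF ind cont E _ bound]
  have c1: "integrable M (\<lambda>\<omega>. X (E r \<omega>) \<omega> - \<mu>) \<and> expectation (\<lambda>\<omega>. X (E r \<omega>) \<omega> - \<mu>) = 0" if r: "0 \<le> r" for r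
  proof -
    have "integrable M (\<lambda>\<omega>. fst (X (E r \<omega>) \<omega>, X (E r \<omega>) \<omega>) - \<mu>)"
      by (rule tc(1)[where g = "\<lambda>p. fst p - \<mu>"]) (use g1 gm r in \<open>auto simp: less_top[symmetric]\<close>)
    moreover have "expectation (\<lambda>\<omega>. fst (X (E r \<omega>) \<omega>, X (E r \<omega>) \<omega>) - \<mu>)
        = expectation (\<lambda>\<omega>. expectation (\<lambda>\<omega>'. fst (X (E r \<omega>) \<omega>', X (E r \<omega>) \<omega>') - \<mu>))"
      by (rule tc(2)[where g = "\<lambda>p. fst p - \<mu>"]) (use g1 gm r in \<open>auto simp: less_top[symmetric]\<close>)
    moreover have "expectation (\<lambda>\<omega>. expectation (\<lambda>\<omega>'. fst (X (E r \<omega>) \<omega>', X (E r \<omega>) \<omega>') - \<mu>)) = expectation (\<lambda>\<omega>. 0)"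
      using E[OF r] mean Xi' by (intro Bochner_Integration.integral_cong) (auto simp: prob_space)
    ultimately show ?thesis by simp
  qed
  have c2: "expectation (\<lambda>\<omega>. (X (E r \<omega>) \<omega> - \<mu>)\<^sup>2) = V" if r: "0 \<le> r" for r
  proof -
    have "expectation (\<lambda>\<omega>. (fst (X (E r \<omega>) \<omega>, X (E r \<omega>) \<omega>) - \<mu>)\<^sup>2)
        = expectation (\<lambda>\<omega>. expectation (\<lambda>\<omega>'. (fst (X (E r \<omega>) \<omega>', X (E r \<omega>) \<omega>') - \<mu>)\<^sup>2))"
      by (rule tc(2)[where g = "\<lambda>p. (fst p - \<mu>)\<^sup>2"]) (use g2 gm r in \<open>auto simp: less_top[symmetric]\<close>)
    also have "\<dots> = expectation (\<lambda>\<omega>. V)"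
      using E[OF r] var by (intro Bochner_Integration.integral_cong) auto
    finally show ?thesis by (simp add: prob_space)
  qed
  have "expectation (\<lambda>\<omega>. (fst (X (E t \<omega>) \<omega>, X (E s \<omega>) \<omega>) - \<mu>) * (snd (X (E t \<omega>) \<omega>, X (E s \<omega>) \<omega>) - \<mu>))
      = expectation (\<lambda>\<omega>. expectation (\<lambda>\<omega>'. (fst (X (E t \<omega>) \<omega>', X (E s \<omega>) \<omega>') - \<mu>) * (snd (X (E t \<omega>) \<omega>', X (E s \<omega>) \<omega>') - \<mu>)))"
    by (rule tc(2)[where g = "\<lambda>p. (fst p - \<mu>) * (snd p - \<mu>)"]) (use g3 gm t in \<open>auto simp: less_top[symmetric]\<close>)
  also have "\<dots> = expectation (\<lambda>\<omega>. V * \<rho> (E t \<omega> - E s \<omega>))"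
    using E t cov by (intro Bochner_Integration.integral_cong) auto
  finally have c3: "expectation (\<lambda>\<omega>. (X (E t \<omega>) \<omega> - \<mu>) * (X (E s \<omega>) \<omega> - \<mu>)) = V * expectation (\<lambda>\<omega>. \<rho> (E t \<omega> - E s \<omega>))"
    by simp
  have m: "expectation (\<lambda>\<omega>. X (E r \<omega>) \<omega>) = \<mu>" if r: "0 \<le> r" for r
  proof -
    have "expectation (\<lambda>\<omega>. (X (E r \<omega>) \<omega> - \<mu>) + \<mu>) = \<mu>"
      using c1[OF r] by (subst Bochner_Integration.integral_add) (auto simp: prob_space)
    then show ?thesis by simp
  qed
  show ?thesis using V t by (simp add: correlation_def m c2 c3)
qed

section \<open>Real-valued bounds and the final asymptotics\<close>

context laplace_subordinator
begin

lemma correlation_bounds: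
  assumes E: "\<And>t. 0 \<le> t \<Longrightarrow> inverse_subordinator D t \<in> borel_measurable M" and st: "0 \<le> s" "s \<le> t"
  defines "k \<equiv> expectation (\<lambda>\<omega>. exp (- \<theta> * \<bar>inverse_subordinator D t \<omega> - inverse_subordinator D s \<omega>\<bar>))"
  shows "(1 + \<theta> * enn2real (potential s)) * enn2real (tail t) \<le> k"
    and "k \<le> enn2real (tail t) + \<theta> * enn2real (potential s) * enn2real (tail (t - s))"
proof -
  have t0: "0 \<le> t" using st by simp
  note [measurable] = E[OF t0] E[OF st(1)]
  have i: "integrable M (\<lambda>\<omega>. exp (- \<theta> * \<bar>inverse_subordinator D t \<omega> - inverse_subordinator D s \<omega>\<bar>))"
    using theta_pos by (intro integrable_const_bound[of _ 1]) auto
  have "ennreal k = (\<integral>\<^sup>+\<omega>. ennreal (exp (- \<theta> * \<bar>inverse_subordinator D t \<omega> - inverse_subordinator D s \<omega>\<bar>)) \<partial>M)"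
    unfolding k_def by (rule nn_integral_eq_integral[OF i, symmetric]) simp
  also have "\<dots> = (\<integral>\<^sup>+\<omega>. ennreal (exp (- \<theta> * (inverse_subordinator D t \<omega> - inverse_subordinator D s \<omega>))) \<partial>M)"
  proof (rule nn_integral_cong_AE)
    show "AE \<omega> in M. ennreal (exp (- \<theta> * \<bar>inverse_subordinator D t \<omega> - inverse_subordinator D s \<omega>\<bar>))
        = ennreal (exp (- \<theta> * (inverse_subordinator D t \<omega> - inverse_subordinator D s \<omega>)))"
      using D_unbounded AE_space
    proof eventually_elim
      case (elim \<omega>)
      then have "inverse_subordinator D s \<omega> \<le> inverse_subordinator D t \<omega>"
        by (intro inverse_subordinator_mono[where D = D and \<omega> = \<omega>] D_mono st(2)) auto
      then show ?case by simp
    qed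
  qed
  finally have k: "ennreal k = (\<integral>\<^sup>+\<omega>. ennreal (exp (- \<theta> * (inverse_subordinator D t \<omega> - inverse_subordinator D s \<omega>))) \<partial>M)" .
  have k0: "0 \<le> k" unfolding k_def by simp
  define a where "a r = enn2real (tail r)" for r
  define p where "p = enn2real (potential s)"
  have a: "tail r = ennreal (a r)" "0 \<le> a r" for r using tail_finite[of r] by (auto simp: a_def)
  have p: "potential s = ennreal p" "0 \<le> p" using potential_finite[of s] by (auto simp: p_def)
  have "ennreal (a t + \<theta> * p * a t) \<le> ennreal k"
    using passage_gap_bounds(1)[OF st E[OF t0]] theta_pos a p
    unfolding k[symmetric] by (simp add: a(1) p(1) ennreal_mult[symmetric] ennreal_plus[symmetric] del: ennreal_plus)
  then have "a t + \<theta> * p * a t \<le> k" using k0 by (simp add: ennreal_le_iff)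
  then show "(1 + \<theta> * enn2real (potential s)) * enn2real (tail t) \<le> k"
    by (simp add: a_def[symmetric] p_def[symmetric] algebra_simps)
  have "ennreal k \<le> ennreal (a t + \<theta> * p * a (t - s))"
    using passage_gap_bounds(2)[OF st E[OF t0]] theta_pos a p
    unfolding k[symmetric] by (simp add: a(1) p(1) ennreal_mult[symmetric] ennreal_plus[symmetric] del: ennreal_plus)
  moreover have "0 \<le> a t + \<theta> * p * a (t - s)" using a p theta_pos by simp
  ultimately have "k \<le> a t + \<theta> * p * a (t - s)" by (simp add: ennreal_le_iff)
  then show "k \<le> enn2real (tail t) + \<theta> * enn2real (potential s) * enn2real (tail (t - s))"
    by (simp add: a_def p_def)
qed

lemma expectation_exp_passage_real:
  assumes E: "inverse_subordinator D t \<in> borel_measurable M"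
  shows "expectation (\<lambda>\<omega>. exp (- \<theta> * inverse_subordinator D t \<omega>)) = enn2real (tail t)"
  unfolding expectation_exp_passage[symmetric] using E by (intro integral_eq_nn_integral) auto

end

theorem mainTheorem4:
  fixes M :: "'a measure" and F :: "real \<Rightarrow> 'a measure"
    and W X1 D E X :: "real \<Rightarrow> 'a \<Rightarrow> real"
    and a0 a1 d0 d1 d2 \<theta> :: real and \<sigma> m :: "real \<Rightarrow> real"
    and n :: nat and \<beta> c :: "nat \<Rightarrow> real" and \<psi> \<Phi> h :: "real \<Rightarrow> real"
  assumes "prob_space M"
    and "steady_state_pearson_diffusion M F W a0 a1 d0 d1 d2 \<sigma> m X1"
    and "smallest_positive_eigenvalue a0 a1 d0 d1 d2 \<theta>"
    and "1 \<le> n" and "0 < \<beta> 1" and "strict_mono_on {1..n} \<beta>" and "\<beta> n < 1"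
    and "0 < c 1" and "\<forall>i\<in>{2..n}. 0 \<le> c i"
    and "\<psi> = (\<lambda>s. \<Sum>i=1..n. c i * s powr \<beta> i)"
    and "subordinator M D"
    and "\<forall>t\<ge>0. \<forall>s\<ge>0. prob_space.expectation M (\<lambda>\<omega>. exp (- s * D t \<omega>)) = exp (- t * \<psi> s)"
    and "E = inverse_subordinator D"
    and "indep_processes M E X1"
    and "X = (\<lambda>t \<omega>. X1 (E t \<omega>) \<omega>)"
    and "\<Phi> = (\<lambda>t. prob_space.expectation M (\<lambda>\<omega>. exp (- \<theta> * E t \<omega>)))"
    and "\<forall>s>0. set_integrable lborel {0<..} (\<lambda>y. exp (- s * y) * h y) \<and>
           (LINT y:{0<..}|lborel. exp (- s * y) * h y) = 1 / \<psi> s"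
  shows "(\<forall>t\<ge>0. \<forall>s\<ge>0. correlation M (X1 t) (X1 s) = exp (- \<theta> * \<bar>t - s\<bar>)) \<and>
         \<Phi> \<sim>[at_top] (\<lambda>t. c 1 / (\<theta> * Gamma (1 - \<beta> 1) * t powr \<beta> 1)) \<and>
         (\<forall>s>0. (\<lambda>t. correlation M (X t) (X s)) \<sim>[at_top]
           (\<lambda>t. 1 / (t powr \<beta> 1 * Gamma (1 - \<beta> 1)) *
                (c 1 / \<theta> + c 1 * (LINT y:{0<..<s}|lborel. h y)))) \<and>
         long_range_dependent M X"
proof -
  interpret prob_space M by fact
  note psi = power_sum_exponent[OF assms(4,5,6,8,9,10)]
  have \<theta>: "0 < \<theta>" using assms(3) by (simp add: smallest_positive_eigenvalue_def)
  obtain \<mu> V where V: "0 < V" and XM: "\<And>t. 0 \<le> t \<Longrightarrow> X1 t \<in> borel_measurable M"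
    and cont: "\<And>\<omega>. \<omega> \<in> space M \<Longrightarrow> continuous_on {0..} (\<lambda>t. X1 t \<omega>)"
    and mean: "\<And>t. 0 \<le> t \<Longrightarrow> expectation (X1 t) = \<mu>"
    and sq: "\<And>t. 0 \<le> t \<Longrightarrow> integrable M (\<lambda>\<omega>. (X1 t \<omega> - \<mu>)\<^sup>2)"
    and cov: "\<And>s t. 0 \<le> s \<Longrightarrow> 0 \<le> t \<Longrightarrow>
      expectation (\<lambda>\<omega>. (X1 t \<omega> - \<mu>) * (X1 s \<omega> - \<mu>)) = V * exp (- \<theta> * \<bar>t - s\<bar>)"
    by (rule pearson_stationary_covariance[OF assms(1,2,3)]) (rule that)
  interpret laplace_subordinator M D \<psi> \<theta>
    by unfold_locales (fact assms(11), use assms(12) in blast, rule psi(1), assumption, fact \<theta>)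
  have b: "\<beta> 1 < 1"
    using assms(4,7) strict_mono_on_leD[OF assms(6), of 1 n] by simp
  have G: "0 < Gamma (1 - \<beta> 1)" using b by simp
  have E0: "0 \<le> E t \<omega>" for t \<omega> unfolding assms(13) by (rule inverse_subordinator_nonneg)
  \<comment> \<open>Independence of processes includes measurability of the path map of
    \<open>E\<close>, hence of each coordinate.\<close>
  have EM: "inverse_subordinator D t \<in> borel_measurable M" if "0 \<le> t" for t
  proof -
    have "(\<lambda>\<omega>. \<lambda>t\<in>{0..}. E t \<omega>) \<in> M \<rightarrow>\<^sub>M (\<Pi>\<^sub>M t\<in>{0..}. borel)"
      using assms(14) unfolding indep_processes_def by (rule indep_var_rv1)
    from measurable_compose[OF this measurable_component_singleton[of t]]
    show ?thesis using that by (simp add: assms(13))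
  qed
  define k where "k t s = expectation (\<lambda>\<omega>. exp (- \<theta> * \<bar>E t \<omega> - E s \<omega>\<bar>))" for t s
  have corr: "correlation M (X t) (X s) = k t s" if "0 \<le> t" "0 \<le> s" for t s
    unfolding assms(15) k_def
    by (rule correlation_time_change[OF assms(14) cont E0 XM mean sq cov V _ that]) auto
  define L where "L = c 1 / \<theta> / Gamma (1 - \<beta> 1)"
  have L: "0 < L" using assms(8) \<theta> G by (simp add: L_def)
  define a where "a t = enn2real (tail t)" for t
  have lim: "((\<lambda>t. t powr \<beta> 1 * a t) \<longlongrightarrow> L) at_top"
    unfolding a_def L_def by (rule tail_asymptotics[OF b psi(2,3)])
  define p where "p s = enn2real (potential s)" for s
  have p_eq: "p s = (LINT y:{0<..<s}|lborel. h y)" for s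
    unfolding p_def using assms(17) by (intro potential_eq_integral) auto
  have p0: "0 \<le> p s" for s by (simp add: p_def)
  have bounds: "(1 + \<theta> * p s) * a t \<le> k t s" "k t s \<le> a t + \<theta> * p s * a (t - s)" if "0 \<le> s" "s \<le> t" for s t
    using correlation_bounds[OF EM that] by (simp_all add: k_def a_def p_def assms(13))
  \<comment> \<open>Scaled by \<open>t powr \<beta> 1\<close>, both bounds tend to the same value;
    for the upper one the shift by \<open>s\<close> is harmless.\<close>
  have klim: "((\<lambda>t. t powr \<beta> 1 * k t s) \<longlongrightarrow> (1 + \<theta> * p s) * L) at_top" if s: "0 \<le> s" for s
  proof (rule tendsto_sandwich)
    show "\<forall>\<^sub>F t in at_top. (1 + \<theta> * p s) * (t powr \<beta> 1 * a t) \<le> t powr \<beta> 1 * k t s"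
      using eventually_ge_at_top[of s]
    proof eventually_elim
      case (elim t)
      from mult_left_mono[OF bounds(1)[OF s elim], of "t powr \<beta> 1"] show ?case by (simp add: mult_ac)
    qed
    show "\<forall>\<^sub>F t in at_top. t powr \<beta> 1 * k t s \<le> t powr \<beta> 1 * a t + \<theta> * p s * (t powr \<beta> 1 * a (t - s))"
      using eventually_ge_at_top[of s]
    proof eventually_elim
      case (elim t)
      from mult_left_mono[OF bounds(2)[OF s elim], of "t powr \<beta> 1"] show ?case by (simp add: algebra_simps)
    qed
    show "((\<lambda>t. (1 + \<theta> * p s) * (t powr \<beta> 1 * a t)) \<longlongrightarrow> (1 + \<theta> * p s) * L) at_top"
      by (intro tendsto_intros lim)
    have "((\<lambda>t. t powr \<beta> 1 * a t + \<theta> * p s * (t powr \<beta> 1 * a (t - s))) \<longlongrightarrow> L + \<theta> * p s * L) at_top"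
      by (intro tendsto_intros lim powr_mult_shift_tendsto)
    then show "((\<lambda>t. t powr \<beta> 1 * a t + \<theta> * p s * (t powr \<beta> 1 * a (t - s))) \<longlongrightarrow> (1 + \<theta> * p s) * L) at_top"
      by (simp add: algebra_simps)
  qed
  have asymp: "f \<sim>[at_top] (\<lambda>t. C / t powr \<beta> 1)"
    if "((\<lambda>t. t powr \<beta> 1 * f t) \<longlongrightarrow> C) at_top" "C \<noteq> 0" for f :: "real \<Rightarrow> real" and C
  proof (rule asymp_equivI')
    have "((\<lambda>t. t powr \<beta> 1 * f t / C) \<longlongrightarrow> C / C) at_top" by (intro tendsto_intros that)
    then show "((\<lambda>t. f t / (C / t powr \<beta> 1)) \<longlongrightarrow> 1) at_top" using that(2) by (simp add: mult.commute)
  qed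
  have 1: "correlation M (X1 t) (X1 s) = exp (- \<theta> * \<bar>t - s\<bar>)" if "0 \<le> t" "0 \<le> s" for t s
  proof -
    have "variance (X1 u) = V" if "0 \<le> u" for u
      using cov[OF that that] mean[OF that] by (simp add: power2_eq_square)
    then show ?thesis using cov[OF that(2,1)] mean that V by (simp add: correlation_def)
  qed
  have 2: "\<Phi> \<sim>[at_top] (\<lambda>t. c 1 / (\<theta> * Gamma (1 - \<beta> 1) * t powr \<beta> 1))"
  proof -
    have \<Phi>: "\<Phi> t = a t" if "0 \<le> t" for t
      unfolding assms(13,16) a_def by (rule expectation_exp_passage_real[OF EM[OF that]])
    have "\<forall>\<^sub>F t in at_top. t powr \<beta> 1 * a t = t powr \<beta> 1 * \<Phi> t"
      using eventually_ge_at_top[of 0] by eventually_elim (simp add: \<Phi>)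
    then have "((\<lambda>t. t powr \<beta> 1 * \<Phi> t) \<longlongrightarrow> L) at_top" by (rule Lim_transform_eventually[OF lim])
    then have "\<Phi> \<sim>[at_top] (\<lambda>t. L / t powr \<beta> 1)" using L by (intro asymp) auto
    then show ?thesis by (simp add: L_def mult.assoc)
  qed
  have 3: "(\<lambda>t. correlation M (X t) (X s)) \<sim>[at_top]
      (\<lambda>t. 1 / (t powr \<beta> 1 * Gamma (1 - \<beta> 1)) * (c 1 / \<theta> + c 1 * (LINT y:{0<..<s}|lborel. h y)))" if s: "0 < s" for s
  proof -
    have "\<forall>\<^sub>F t in at_top. t powr \<beta> 1 * k t s = t powr \<beta> 1 * correlation M (X t) (X s)"
      using eventually_ge_at_top[of 0] by eventually_elim (use s corr in simp)
    then have "((\<lambda>t. t powr \<beta> 1 * correlation M (X t) (X s)) \<longlongrightarrow> (1 + \<theta> * p s) * L) at_top"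
      by (rule Lim_transform_eventually[OF klim[OF less_imp_le[OF s]]])
    moreover have "(1 + \<theta> * p s) * L \<noteq> 0"
    proof -
      have "0 \<le> \<theta> * p s" using \<theta> p0[of s] by simp
      then have "0 < 1 + \<theta> * p s" by linarith
      then show ?thesis using L by simp
    qed
    ultimately have asymp_s: "(\<lambda>t. correlation M (X t) (X s)) \<sim>[at_top] (\<lambda>t. (1 + \<theta> * p s) * L / t powr \<beta> 1)"
      by (rule asymp)
    \<comment> \<open>\<open>L\<close> contains \<open>c 1 / \<theta>\<close>, so its product with
      \<open>\<theta> * p s\<close> is the integral term of the claimed constant.\<close>
    have "(1 + \<theta> * p s) * L / t powr \<beta> 1
        = 1 / (t powr \<beta> 1 * Gamma (1 - \<beta> 1)) * (c 1 / \<theta> + c 1 * (LINT y:{0<..<s}|lborel. h y))" for t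
      unfolding p_eq[symmetric] L_def using \<theta> by (simp add: field_simps)
    then show ?thesis using asymp_s by (simp only:)
  qed
  have 4: "long_range_dependent M X"
    unfolding long_range_dependent_def
  proof (intro allI impI)
    fix t :: real assume t: "0 < t"
    have k0: "0 \<le> k u v" for u v by (simp add: k_def)
    have k_sym: "k u v = k v u" for u v unfolding k_def by (simp add: abs_minus_commute)
    have "\<forall>\<^sub>F r in at_top. L / 2 < r powr \<beta> 1 * a r" using lim L by (intro order_tendstoD) auto
    then obtain R where R: "\<And>r. R \<le> r \<Longrightarrow> L / 2 < r powr \<beta> 1 * a r" by (auto simp: eventually_at_top_linorder)
    \<comment> \<open>Beyond \<open>H\<close> the index is at least 1 and \<open>t + j\<close>
      exceeds \<open>R\<close>.\<close>
    obtain H :: nat where H: "max R 1 < real H" using reals_Archimedean2 by blast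
    \<comment> \<open>With \<open>r = t + j\<close>: the limit gives
      \<open>L / 2 < r powr \<beta> 1 * a r\<close>, the power is at most \<open>r\<close> since
      \<open>\<beta> 1 < 1 \<le> r\<close>, and \<open>r \<le> (t + 1) * j\<close>. This produces
      the harmonic lower bound.\<close>
    have "L / (2 * (t + 1)) / real j \<le> k t (t + real j)" if j: "H \<le> j" for j
    proof -
      have j1: "max R 1 < real j" using H j by (meson less_le_trans of_nat_le_iff)
      define r where "r = t + real j"
      have r: "R \<le> r" "1 \<le> r" "t \<le> r" using j1 t by (auto simp: r_def)
      have a0: "0 \<le> a r" by (simp add: a_def)
      have "r powr \<beta> 1 \<le> r powr 1" using r b by (intro powr_mono) auto
      then have "L / 2 \<le> r * a r" using R[OF r(1)] r a0 mult_right_mono[of "r powr \<beta> 1" r "a r"] by simp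
      moreover have "r \<le> (t + 1) * real j"
      proof -
        have "t * 1 \<le> t * real j" using t j1 by (intro mult_left_mono) auto
        then show ?thesis by (simp add: r_def algebra_simps)
      qed
      ultimately have le: "L / 2 \<le> ((t + 1) * real j) * a r" using a0 mult_right_mono[of r "(t + 1) * real j" "a r"] by linarith
      have pos: "0 < (t + 1) * real j" using t j1 by simp
      have "L / 2 \<le> a r * ((t + 1) * real j)" using le by (simp only: mult.commute)
      then have "L / 2 / ((t + 1) * real j) \<le> a r" by (simp only: pos_divide_le_eq[OF pos])
      then have "L / (2 * (t + 1)) / real j \<le> a r"
        by (simp only: divide_divide_eq_left mult.assoc)
      also have "a r \<le> (1 + \<theta> * p t) * a r" using p0[of t] \<theta> a0 by (simp add: distrib_right)
      also have "\<dots> \<le> k r t" using t r by (intro bounds) auto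
      finally show ?thesis by (simp add: r_def k_sym)
    qed
    then have "filterlim (\<lambda>N. \<Sum>j=1..N. k t (t + real j)) at_top sequentially"
      using L t k0 by (intro sum_at_top_of_harmonic_bound[where c = "L / (2 * (t + 1))" and H = H]) auto
    then show "filterlim (\<lambda>N. \<Sum>h=1..N. correlation M (X t) (X (t + real h))) at_top sequentially"
      using corr t by simp
  qed
  show ?thesis using 1 2 3 4 by blast
qed

end
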